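(* Let $G$ be a finite group with socle $S$. Let $\sum^{*}$ denote summation over the characters $\chi$ of all faithful irreducible complex representations of $G$ (up to equivalence). Let $A_1,\dots,A_a$ be representatives of the $G$-isomorphism classes of elementary Abelian minimal normal subgroups of $G$; let $d_i$ be such that the subgroup generated by all minimal normal subgroups of $G$ that are $G$-isomorphic to $A_i$ is isomorphic to $A_i^{d_i}$; let $q_i=|\mathrm{Hom}_G(A_i,A_i)|$; and let $S_{a+1},\dots,S_{a+b}$ be the non-Abelian minimal normal subgroups of $G$. (a) If conjugacy classes $A$ and $B$ of $G$ are distinct modulo the socle $S$ of $G$, then $$\sum\nolimits^{*}\chi(A)\overline{\chi}(B)=0.$$ (b) If a conjugacy class $C$ of $G$ is such that $|CS|=|C||S|$, then $$\sum\nolimits^{*}\chi(C)\overline{\chi}(C)=\frac{|G|}{|C|}\prod_{i=1}^{a}\prod_{j=0}^{d_i-1}\left(1-\frac{q_i^{j}}{|A_i|}\right)\prod_{k=a+1}^{a+b}\left(1-\frac{1}{|S_k|}\right).$$ (c) The sum of squared dimensions of the faithful irreducible representations of $G$, i.e. $\sum^{*}\chi(1)^2$, is divisible by the cardinality of any conjugacy class $C$ of $G$ that satisfies $|CS|=|C||S|$.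
   Context: The socle of $G$ is the subgroup generated by all minimal normal subgroups of $G$. For a conjugacy class $C$, $\chi(C)$ is the common value of $\chi$ on elements of $C$, $\overline{\chi}$ is the complex conjugate of $\chi$, and $CS=\{cs:c\in C,\ s\in S\}$. Classes $A,B$ are distinct modulo $S$ if their images in $G/S$ under the natural epimorphism are distinct conjugacy classes of $G/S$. An elementary Abelian minimal normal subgroup of $G$ is viewed as a simple $G$-module, $G$ acting by conjugation; two such subgroups $M,M'$ are $G$-isomorphic if there is a group isomorphism $f:M\to M'$ with $f(x^g)=f(x)^g$ for all $g\in G$. $\mathrm{Hom}_G(A_i,A_i)$ is the set of group homomorphisms $A_i\to A_i$ commuting with the conjugation action of $G$. Empty sums are $0$ and empty products are $1$. *)

theory Defs
  imports
    "HOL-Computational_Algebra.Primes"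
    "HOL-Algebra.Generated_Groups"
    "HOL-Algebra.Group_Action"
    "HOL-Algebra.Product_Groups"
    "Jordan_Normal_Form.VS_Connect"
    Complex_Main
begin

definition min_normal :: "('a, 'b) monoid_scheme \<Rightarrow> 'a set \<Rightarrow> bool" where
  "min_normal G N \<longleftrightarrow> N \<lhd> G \<and> N \<noteq> {\<one>\<^bsub>G\<^esub>} \<and>
     (\<forall>K. K \<lhd> G \<and> K \<subseteq> N \<and> K \<noteq> {\<one>\<^bsub>G\<^esub>} \<longrightarrow> K = N)"

definition socle :: "('a, 'b) monoid_scheme \<Rightarrow> 'a set" where
  "socle G = generate G (\<Union> {N. min_normal G N})"

definition abelian_subgroup :: "('a, 'b) monoid_scheme \<Rightarrow> 'a set \<Rightarrow> bool" where
  "abelian_subgroup G N \<longleftrightarrow> comm_group (G\<lparr>carrier := N\<rparr>)"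

definition elementary_abelian_subgroup :: "('a, 'b) monoid_scheme \<Rightarrow> 'a set \<Rightarrow> bool" where
  "elementary_abelian_subgroup G N \<longleftrightarrow> abelian_subgroup G N \<and>
     (\<exists>p::nat. prime p \<and> (\<forall>x\<in>N. x [^]\<^bsub>G\<^esub> p = \<one>\<^bsub>G\<^esub>))"

definition elem_abelian_min_normals :: "('a, 'b) monoid_scheme \<Rightarrow> 'a set set" where
  "elem_abelian_min_normals G = {N. min_normal G N \<and> elementary_abelian_subgroup G N}"

definition nonabelian_min_normals :: "('a, 'b) monoid_scheme \<Rightarrow> 'a set set" where
  "nonabelian_min_normals G = {N. min_normal G N \<and> \<not> abelian_subgroup G N}"

definition G_equivariant ::
  "('a, 'b) monoid_scheme \<Rightarrow> 'a set \<Rightarrow> ('a \<Rightarrow> 'a) \<Rightarrow> bool" where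
  "G_equivariant G M f \<longleftrightarrow> (\<forall>g\<in>carrier G. \<forall>x\<in>M.
     f (inv\<^bsub>G\<^esub> g \<otimes>\<^bsub>G\<^esub> x \<otimes>\<^bsub>G\<^esub> g) = inv\<^bsub>G\<^esub> g \<otimes>\<^bsub>G\<^esub> f x \<otimes>\<^bsub>G\<^esub> g)"

definition G_isomorphic ::
  "('a, 'b) monoid_scheme \<Rightarrow> 'a set \<Rightarrow> 'a set \<Rightarrow> bool" where
  "G_isomorphic G M N \<longleftrightarrow>
     (\<exists>f \<in> iso (G\<lparr>carrier := M\<rparr>) (G\<lparr>carrier := N\<rparr>). G_equivariant G M f)"

text \<open>Members of \<^const>\<open>hom\<close> are unconstrained outside the carrier; intersecting with
  \<^const>\<open>extensional\<close> makes two of them equal iff they agree on \<open>M\<close>, so that counting them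
  counts homomorphisms.\<close>

definition G_hom :: "('a, 'b) monoid_scheme \<Rightarrow> 'a set \<Rightarrow> 'a set \<Rightarrow> ('a \<Rightarrow> 'a) set" where
  "G_hom G M N = {f \<in> hom (G\<lparr>carrier := M\<rparr>) (G\<lparr>carrier := N\<rparr>) \<inter> extensional M.
     G_equivariant G M f}"

definition homogeneous_component ::
  "('a, 'b) monoid_scheme \<Rightarrow> 'a set \<Rightarrow> 'a set" where
  "homogeneous_component G M = generate G (\<Union> {N. min_normal G N \<and> G_isomorphic G N M})"

definition conjugacy_classes :: "('a, 'b) monoid_scheme \<Rightarrow> 'a set set" where
  "conjugacy_classes G =
     orbits G (carrier G) (\<lambda>g. \<lambda>h \<in> carrier G. g \<otimes>\<^bsub>G\<^esub> h \<otimes>\<^bsub>G\<^esub> inv\<^bsub>G\<^esub> g)"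

text \<open>For normal \<open>S\<close> the image of a class under the epimorphism from \<open>G\<close> onto \<open>G Mod S\<close>
  is a class of the quotient.\<close>

definition distinct_modulo ::
  "('a, 'b) monoid_scheme \<Rightarrow> 'a set \<Rightarrow> 'a set \<Rightarrow> 'a set \<Rightarrow> bool" where
  "distinct_modulo G S A B \<longleftrightarrow> (\<lambda>x. S #>\<^bsub>G\<^esub> x) ` A \<noteq> (\<lambda>x. S #>\<^bsub>G\<^esub> x) ` B"

text \<open>Meaningful for \<open>f\<close> constant on the nonempty set \<open>C\<close>, as characters are on
  conjugacy classes.\<close>

definition class_value :: "('a \<Rightarrow> 'c) \<Rightarrow> 'a set \<Rightarrow> 'c" where
  "class_value f C = the_elem (f ` C)"

text \<open>Representations are matrix representations, so that the degree can vary within one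
  type; it is read off from the image of the identity. Values outside the carrier of \<open>G\<close>
  are irrelevant and are ignored by \<open>rep_equivalent\<close> below.\<close>

definition rep_degree :: "('a, 'b) monoid_scheme \<Rightarrow> ('a \<Rightarrow> complex mat) \<Rightarrow> nat" where
  "rep_degree G \<rho> = dim_row (\<rho> \<one>\<^bsub>G\<^esub>)"

definition representation ::
  "('a, 'b) monoid_scheme \<Rightarrow> ('a \<Rightarrow> complex mat) \<Rightarrow> bool" where
  "representation G \<rho> \<longleftrightarrow>
     \<rho> \<in> hom G (units_of (ring_mat TYPE(complex) (rep_degree G \<rho>) ()))"

definition irreducible_rep ::
  "('a, 'b) monoid_scheme \<Rightarrow> ('a \<Rightarrow> complex mat) \<Rightarrow> bool" where
  "irreducible_rep G \<rho> \<longleftrightarrow> representation G \<rho> \<and> rep_degree G \<rho> > 0 \<and>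
     (\<forall>W. VectorSpace.subspace class_ring W (module_vec TYPE(complex) (rep_degree G \<rho>)) \<and>
          (\<forall>g\<in>carrier G. \<forall>w\<in>W. \<rho> g *\<^sub>v w \<in> W) \<longrightarrow>
          W = {0\<^sub>v (rep_degree G \<rho>)} \<or> W = carrier_vec (rep_degree G \<rho>))"

definition faithful_irreps ::
  "('a, 'b) monoid_scheme \<Rightarrow> ('a \<Rightarrow> complex mat) set" where
  "faithful_irreps G = {\<rho>. irreducible_rep G \<rho> \<and> inj_on \<rho> (carrier G)}"

definition rep_equivalent ::
  "('a, 'b) monoid_scheme \<Rightarrow> ('a \<Rightarrow> complex mat) \<Rightarrow> ('a \<Rightarrow> complex mat) \<Rightarrow> bool" where
  "rep_equivalent G \<rho> \<sigma> \<longleftrightarrow>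
     (\<exists>P Q. \<forall>g\<in>carrier G. similar_mat_wit (\<rho> g) (\<sigma> g) P Q)"

definition rep_character :: "('a \<Rightarrow> complex mat) \<Rightarrow> 'a \<Rightarrow> complex" where
  "rep_character \<rho> g = sum_list (diag_mat (\<rho> g))"

definition representatives :: "'c set \<Rightarrow> ('c \<Rightarrow> 'c \<Rightarrow> bool) \<Rightarrow> 'c set \<Rightarrow> bool" where
  "representatives X E R \<longleftrightarrow> R \<subseteq> X \<and> (\<forall>x\<in>X. \<exists>!r. r \<in> R \<and> E r x)"

end

(*
  Write e(N) for the average of a normal subgroup N, acting on an irreducible representation rho.
  By Schur's lemma e(N) is the identity if N lies in the kernel of rho and 0 otherwise, and rho is
  faithful iff its kernel contains no minimal normal subgroup. Hence the sum over the faithful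
  characters is the sum over all irreducible characters weighted by the product of 1 - e(N) over the
  minimal normal N. Expanding the product and applying column orthogonality in G itself, without
  passing to quotients, gives

    sum* chi(x) cnj chi(y) = sum over U of (-1)^|U| / |<U>| * #{(m, g). m in <U>, x m g = g y},

  where U runs over the sets of minimal normal subgroups. If x and y are not conjugate modulo the
  socle S, no such (m, g) exists. If |CS| = |C||S| for the class C of x, then m = 1, so the sum is
  |C_G(x)| f(S) with f(L) = sum over U of (-1)^|U| / |<U>|, U ranging over the sets of minimal
  normal subgroups inside L. It is an integer, because S centralizes x, so that |<U>| divides
  |C_G(x)|; with C = 1 this gives (c).

  To evaluate f(S), adjoin minimal normal subgroups A one at a time: if A is not contained in L, then
  f(LA) = f(L) (1 - k / |A|), where k is the number of minimal normal subgroups of LA not contained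
  in L. These are the graphs of the G-homomorphisms from A to L; so k = 1 if A is non-Abelian, and
  k = q^m if A is Abelian and m of the factors adjoined before are G-isomorphic to A.
*)
theory Submission
  imports
    Defs
    "HOL-Algebra.Multiplicative_Group"
    "Jordan_Normal_Form.Spectral_Radius"
    "Jordan_Normal_Form.Schur_Decomposition"
begin

section \<open>Traces and sums of matrices\<close>

text \<open>The weights of the inclusion-exclusion depend on a set of minimal normal subgroups only
  through its join, and a join can arise from many sets. This redundancy drives the evaluation of f:
  as soon as a join contains a further minimal normal subgroup, adding and removing that subgroup
  cancels.

  The numbers \<open>d i\<close> are known only through the isomorphism type of a homogeneous
  component, whereas the induction decides for itself which factors it adjoins. Both are compared
  through the number of G-homomorphisms out of \<open>M i\<close>: adjoining a subgroup G-isomorphic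
  to \<open>M i\<close> multiplies it by \<open>q i\<close>, every other adjunction preserves it,
  and for the socle it is \<open>q i ^ d i\<close>. As \<open>q i\<close> exceeds 1, the exponents
  agree.

  On the character side everything global comes from the regular character. Decomposing it bounds
  the number of irreducible representations and yields the sum of degree times character, which
  vanishes away from the identity; evaluated at the products of \<open>x\<close> with conjugates of
  the inverse of \<open>y\<close>, it becomes column orthogonality as a count of solutions, a form
  that can be summed over a normal subgroup.\<close>

definition mat_trace :: "complex mat \<Rightarrow> complex" where
  "mat_trace A = (\<Sum>i<dim_row A. A $$ (i, i))"

lemma rep_character_eq_trace: "rep_character \<rho> g = mat_trace (\<rho> g)"
  unfolding rep_character_def mat_trace_def diag_mat_def
  by (simp add: interv_sum_list_conv_sum_set_nat atLeast0LessThan)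

lemma index_mult_mat_sum:
  assumes "A \<in> carrier_mat n m" "B \<in> carrier_mat m k" "i < n" "j < k"
  shows "(A * B) $$ (i, j) = (\<Sum>l<m. A $$ (i, l) * B $$ (l, j))"
  using assms by (simp add: scalar_prod_def atLeast0LessThan)

lemma mat_trace_mult_commute:
  assumes A: "A \<in> carrier_mat n m" and B: "B \<in> carrier_mat m n"
  shows "mat_trace (A * B) = mat_trace (B * A)"
proof -
  have "mat_trace (A * B) = (\<Sum>i<n. \<Sum>l<m. A $$ (i, l) * B $$ (l, i))"
    using A by (simp add: mat_trace_def index_mult_mat_sum[OF A B] del: index_mult_mat(1))
  also have "\<dots> = (\<Sum>l<m. \<Sum>i<n. A $$ (i, l) * B $$ (l, i))"
    by (rule sum.swap)
  also have "\<dots> = mat_trace (B * A)"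
    using B by (simp add: mat_trace_def index_mult_mat_sum[OF B A] mult.commute del: index_mult_mat(1))
  finally show ?thesis .
qed

lemma mat_trace_one: "mat_trace (1\<^sub>m n) = of_nat n"
  by (simp add: mat_trace_def)

lemma mat_trace_smult: "mat_trace (c \<cdot>\<^sub>m A) = c * mat_trace A" if "A \<in> carrier_mat n n"
  using that by (simp add: mat_trace_def sum_distrib_left)

lemma mat_trace_similar:
  assumes "similar_mat_wit A B P Q"
  shows "mat_trace A = mat_trace B"
proof -
  obtain n where n: "n = dim_row A" by simp
  note s = similar_mat_witD[OF n assms]
  have "mat_trace A = mat_trace (Q * (P * B))"
    unfolding s(3) using mat_trace_mult_commute[of "P * B" n n Q] s by simp
  also have "Q * (P * B) = Q * P * B" by (rule assoc_mult_mat[symmetric, OF s(7,6,5)])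
  finally show ?thesis using s by simp
qed

text \<open>The size of a matrix is not visible in its type, so the sum carries it as arguments;
  over the empty set it is the zero matrix of that size.\<close>

definition mat_sum :: "nat \<Rightarrow> nat \<Rightarrow> ('i \<Rightarrow> complex mat) \<Rightarrow> 'i set \<Rightarrow> complex mat" where
  "mat_sum n m F I = mat n m (\<lambda>(i, j). \<Sum>x\<in>I. F x $$ (i, j))"

lemma mat_sum_carrier [simp]: "mat_sum n m F I \<in> carrier_mat n m"
  by (simp add: mat_sum_def)

lemma mat_sum_index [simp]:
  "i < n \<Longrightarrow> j < m \<Longrightarrow> mat_sum n m F I $$ (i, j) = (\<Sum>x\<in>I. F x $$ (i, j))"
  by (simp add: mat_sum_def)

lemma mat_sum_dim [simp]: "dim_row (mat_sum n m F I) = n" "dim_col (mat_sum n m F I) = m"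
  by (simp_all add: mat_sum_def)

lemma mat_sum_cong: "(\<And>x. x \<in> I \<Longrightarrow> F x = H x) \<Longrightarrow> mat_sum n m F I = mat_sum n m H I"
  by (simp add: mat_sum_def)

lemma mat_sum_reindex:
  assumes "bij_betw h I J"
  shows "mat_sum n m F J = mat_sum n m (\<lambda>x. F (h x)) I"
  unfolding mat_sum_def using sum.reindex_bij_betw[OF assms, symmetric] by (intro cong_mat) auto

lemma mult_mat_sum:
  assumes A: "A \<in> carrier_mat k n" and F: "\<And>x. x \<in> I \<Longrightarrow> F x \<in> carrier_mat n m"
  shows "A * mat_sum n m F I = mat_sum k m (\<lambda>x. A * F x) I"
proof (rule eq_matI)
  fix i j assume "i < dim_row (mat_sum k m (\<lambda>x. A * F x) I)" "j < dim_col (mat_sum k m (\<lambda>x. A * F x) I)"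
  hence ij: "i < k" "j < m" by auto
  have "(A * mat_sum n m F I) $$ (i, j) = (\<Sum>l<n. A $$ (i, l) * (\<Sum>x\<in>I. F x $$ (l, j)))"
    using index_mult_mat_sum[OF A mat_sum_carrier ij] ij by simp
  also have "\<dots> = (\<Sum>l<n. \<Sum>x\<in>I. A $$ (i, l) * F x $$ (l, j))"
    by (simp add: sum_distrib_left)
  also have "\<dots> = (\<Sum>x\<in>I. \<Sum>l<n. A $$ (i, l) * F x $$ (l, j))"
    by (rule sum.swap)
  also have "\<dots> = (\<Sum>x\<in>I. (A * F x) $$ (i, j))"
    by (rule sum.cong) (simp_all add: index_mult_mat_sum[OF A F ij] del: index_mult_mat)
  finally show "(A * mat_sum n m F I) $$ (i, j) = mat_sum k m (\<lambda>x. A * F x) I $$ (i, j)"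
    using ij by simp
qed (use A in auto)

lemma mat_sum_mult:
  assumes A: "A \<in> carrier_mat m k" and F: "\<And>x. x \<in> I \<Longrightarrow> F x \<in> carrier_mat n m"
  shows "mat_sum n m F I * A = mat_sum n k (\<lambda>x. F x * A) I"
proof (rule eq_matI)
  fix i j assume "i < dim_row (mat_sum n k (\<lambda>x. F x * A) I)" "j < dim_col (mat_sum n k (\<lambda>x. F x * A) I)"
  hence ij: "i < n" "j < k" by auto
  have "(mat_sum n m F I * A) $$ (i, j) = (\<Sum>l<m. (\<Sum>x\<in>I. F x $$ (i, l)) * A $$ (l, j))"
    using index_mult_mat_sum[OF mat_sum_carrier A ij] ij by simp
  also have "\<dots> = (\<Sum>l<m. \<Sum>x\<in>I. F x $$ (i, l) * A $$ (l, j))"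
    by (simp add: sum_distrib_right)
  also have "\<dots> = (\<Sum>x\<in>I. \<Sum>l<m. F x $$ (i, l) * A $$ (l, j))"
    by (rule sum.swap)
  also have "\<dots> = (\<Sum>x\<in>I. (F x * A) $$ (i, j))"
    by (rule sum.cong) (simp_all add: index_mult_mat_sum[OF F A ij] del: index_mult_mat)
  finally show "(mat_sum n m F I * A) $$ (i, j) = mat_sum n k (\<lambda>x. F x * A) I $$ (i, j)"
    using ij by simp
qed (use A in auto)

lemma mat_trace_mat_sum:
  assumes "\<And>x. x \<in> I \<Longrightarrow> F x \<in> carrier_mat n n"
  shows "mat_trace (mat_sum n n F I) = (\<Sum>x\<in>I. mat_trace (F x))"
proof -
  have "mat_trace (mat_sum n n F I) = (\<Sum>i<n. \<Sum>x\<in>I. F x $$ (i, i))"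
    by (simp add: mat_trace_def)
  also have "\<dots> = (\<Sum>x\<in>I. \<Sum>i<n. F x $$ (i, i))"
    by (rule sum.swap)
  finally show ?thesis using assms by (auto simp: mat_trace_def intro!: sum.cong)
qed

section \<open>Matrix representations of a finite group\<close>

locale fin_group = group G for G (structure) +
  assumes finite_carrier [simp, intro]: "finite (carrier G)"
begin

text \<open>The degree is a parameter, so that carrier facts speak of a variable \<open>n\<close>,
  and invertibility is encoded by the value at \<open>\<one>\<close>.\<close>

definition matrix_rep :: "nat \<Rightarrow> ('a \<Rightarrow> complex mat) \<Rightarrow> bool" where
  "matrix_rep n \<rho> \<longleftrightarrow> (\<forall>g\<in>carrier G. \<rho> g \<in> carrier_mat n n) \<and> \<rho> \<one> = 1\<^sub>m n \<and>
     (\<forall>g\<in>carrier G. \<forall>h\<in>carrier G. \<rho> (g \<otimes> h) = \<rho> g * \<rho> h)"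

definition invariant_subspace :: "nat \<Rightarrow> ('a \<Rightarrow> complex mat) \<Rightarrow> complex vec set \<Rightarrow> bool" where
  "invariant_subspace n \<rho> W \<longleftrightarrow> VectorSpace.subspace class_ring W (module_vec TYPE(complex) n) \<and>
     (\<forall>g\<in>carrier G. \<forall>w\<in>W. \<rho> g *\<^sub>v w \<in> W)"

definition irreducible_matrix_rep :: "nat \<Rightarrow> ('a \<Rightarrow> complex mat) \<Rightarrow> bool" where
  "irreducible_matrix_rep n \<rho> \<longleftrightarrow> matrix_rep n \<rho> \<and> n > 0 \<and>
     (\<forall>W. invariant_subspace n \<rho> W \<longrightarrow> W = {0\<^sub>v n} \<or> W = carrier_vec n)"

lemma matrix_repD:
  assumes "matrix_rep n \<rho>"
  shows "\<And>g. g \<in> carrier G \<Longrightarrow> \<rho> g \<in> carrier_mat n n" "\<rho> \<one> = 1\<^sub>m n"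
    "\<And>g h. g \<in> carrier G \<Longrightarrow> h \<in> carrier G \<Longrightarrow> \<rho> (g \<otimes> h) = \<rho> g * \<rho> h"
  using assms by (auto simp: matrix_rep_def)

lemma matrix_rep_inv:
  assumes "matrix_rep n \<rho>" "g \<in> carrier G"
  shows "\<rho> g * \<rho> (inv g) = 1\<^sub>m n" "\<rho> (inv g) * \<rho> g = 1\<^sub>m n"
  using matrix_repD[OF assms(1)] assms(2) by (metis inv_closed r_inv l_inv)+

lemma matrix_rep_degree: "matrix_rep n \<rho> \<Longrightarrow> rep_degree G \<rho> = n"
  by (simp add: matrix_rep_def rep_degree_def)

text \<open>A homomorphism into the unit group preserves the identity; conversely
  \<open>\<rho> (inv g)\<close> is the inverse that makes \<open>\<rho> g\<close> a unit.\<close>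

lemma representation_iff_matrix_rep: "representation G \<rho> \<longleftrightarrow> matrix_rep (rep_degree G \<rho>) \<rho>"
proof
  assume r: "representation G \<rho>"
  let ?n = "rep_degree G \<rho>"
  let ?U = "units_of (ring_mat TYPE(complex) ?n ())"
  have h: "\<rho> \<in> hom G ?U" using r by (simp add: representation_def)
  have U: "Group.group ?U"
    by (rule monoid.units_group) (simp add: ring.is_monoid ring_mat semiring_mat semiring.axioms(2))
  interpret gh: group_hom G ?U \<rho>
    by (intro group_hom.intro group_hom_axioms.intro U h is_group)
  have "\<rho> \<one> = 1\<^sub>m ?n"
    using gh.hom_one by (simp add: units_of_def ring_mat_simps)
  moreover have "\<rho> g \<in> carrier_mat ?n ?n" if "g \<in> carrier G" for g
    using gh.hom_closed[OF that] by (simp add: units_of_def Units_def ring_mat_simps)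
  moreover have "\<rho> (g \<otimes> h) = \<rho> g * \<rho> h" if "g \<in> carrier G" "h \<in> carrier G" for g h
    using gh.hom_mult[OF that] by (simp add: units_of_def ring_mat_simps)
  ultimately show "matrix_rep ?n \<rho>" by (simp add: matrix_rep_def)
next
  assume m: "matrix_rep (rep_degree G \<rho>) \<rho>"
  show "representation G \<rho>"
    unfolding representation_def hom_def units_of_def Units_def
    using matrix_repD[OF m] matrix_rep_inv[OF m]
    by (auto simp: ring_mat_simps intro!: bexI[of _ "\<rho> (inv _)"])
qed

lemma irreducible_rep_iff:
  "irreducible_rep G \<rho> \<longleftrightarrow> irreducible_matrix_rep (rep_degree G \<rho>) \<rho>"
  by (auto simp: irreducible_rep_def irreducible_matrix_rep_def invariant_subspace_def
      representation_iff_matrix_rep)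

lemma irreducible_repI: "irreducible_matrix_rep n \<rho> \<Longrightarrow> irreducible_rep G \<rho>"
  using irreducible_rep_iff irreducible_matrix_rep_def matrix_rep_degree by metis

lemma irreducible_matrix_repD:
  assumes "irreducible_matrix_rep n \<rho>"
  shows "matrix_rep n \<rho>" "n > 0"
    "\<And>W. invariant_subspace n \<rho> W \<Longrightarrow> W = {0\<^sub>v n} \<or> W = carrier_vec n"
  using assms by (auto simp: irreducible_matrix_rep_def)

end

lemma subspace_vecI:
  fixes W :: "complex vec set"
  assumes "W \<subseteq> carrier_vec n" "0\<^sub>v n \<in> W" "\<And>v w. v \<in> W \<Longrightarrow> w \<in> W \<Longrightarrow> v + w \<in> W"
    "\<And>c v. v \<in> W \<Longrightarrow> c \<cdot>\<^sub>v v \<in> W"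
  shows "VectorSpace.subspace class_ring W (module_vec TYPE(complex) n)"
proof -
  interpret vec_space "TYPE(complex)" n .
  show ?thesis
    unfolding VectorSpace.subspace_def submodule_def
    using assms vectorspace_axioms module_axioms by (auto simp: module_vec_simps class_ring_simps)
qed

lemma subspace_vecD:
  fixes W :: "complex vec set"
  assumes "VectorSpace.subspace class_ring W (module_vec TYPE(complex) n)"
  shows "W \<subseteq> carrier_vec n" "0\<^sub>v n \<in> W" "\<And>v w. v \<in> W \<Longrightarrow> w \<in> W \<Longrightarrow> v + w \<in> W"
    "\<And>c v. v \<in> W \<Longrightarrow> c \<cdot>\<^sub>v v \<in> W"
proof -
  interpret vec_space "TYPE(complex)" n .
  have s: "submodule class_ring W V" using assms by (simp add: VectorSpace.subspace_def)
  show "W \<subseteq> carrier_vec n" "0\<^sub>v n \<in> W" "\<And>v w. v \<in> W \<Longrightarrow> w \<in> W \<Longrightarrow> v + w \<in> W"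
    "\<And>c v. v \<in> W \<Longrightarrow> c \<cdot>\<^sub>v v \<in> W"
    using s by (auto simp: submodule_def module_vec_simps class_ring_simps)
qed

section \<open>Schur's lemma\<close>

lemma mat_eq_zero_if_mult_vec_zero:
  fixes Y :: "complex mat"
  assumes Y: "Y \<in> carrier_mat n m" and z: "\<And>v. v \<in> carrier_vec m \<Longrightarrow> Y *\<^sub>v v = 0\<^sub>v n"
  shows "Y = 0\<^sub>m n m"
proof (rule eq_matI)
  fix i j assume "i < dim_row (0\<^sub>m n m :: complex mat)" "j < dim_col (0\<^sub>m n m :: complex mat)"
  hence ij: "i < n" "j < m" by auto
  have "col Y j = 0\<^sub>v n"
    using z[of "unit_vec m j"] Y ij col_mult2[OF Y one_carrier_mat, of j] by simp
  hence "col Y j $ i = 0" using ij by simp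
  thus "Y $$ (i, j) = 0\<^sub>m n m $$ (i, j)" using Y ij by simp
qed (use Y in auto)

lemma smult_one_mat_mult_vec:
  fixes w :: "complex vec"
  assumes "w \<in> carrier_vec n"
  shows "(k \<cdot>\<^sub>m 1\<^sub>m n) *\<^sub>v w = k \<cdot>\<^sub>v w"
  using assms by (intro eq_vecI) auto

text \<open>The columns of \<open>Q\<close> are preimages of the unit vectors.\<close>

lemma surj_mat_right_inverse:
  fixes Y :: "complex mat"
  assumes Y: "Y \<in> carrier_mat n m"
    and surj: "\<And>w. w \<in> carrier_vec n \<Longrightarrow> \<exists>v\<in>carrier_vec m. Y *\<^sub>v v = w"
  shows "\<exists>Q\<in>carrier_mat m n. Y * Q = 1\<^sub>m n"
proof -
  have "\<forall>i. \<exists>v. i < n \<longrightarrow> v \<in> carrier_vec m \<and> Y *\<^sub>v v = unit_vec n i"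
    using surj unit_vec_carrier by metis
  then obtain q where q: "\<And>i. i < n \<Longrightarrow> q i \<in> carrier_vec m \<and> Y *\<^sub>v q i = unit_vec n i"
    by metis
  define Q where "Q = mat_of_cols m (map q [0..<n])"
  have Q: "Q \<in> carrier_mat m n" using mat_of_cols_carrier(1)[of m "map q [0..<n]"] by (simp add: Q_def)
  have "Y * Q = 1\<^sub>m n"
  proof (rule mat_col_eqI)
    fix i assume i: "i < dim_col (1\<^sub>m n :: complex mat)"
    have "col Q i = q i" using i q[of i] by (simp add: Q_def)
    thus "col (Y * Q) i = col (1\<^sub>m n) i" using i q col_mult2[OF Y Q] by simp
  qed (use Y Q in auto)
  with Q show ?thesis by blast
qed

text \<open>Surjectivity gives a right inverse \<open>Q\<close>. It is also a left inverse, because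
  \<open>Y\<close> maps \<open>Q *\<^sub>v (Y *\<^sub>v v)\<close> and \<open>v\<close> to the same
  vector and is injective.\<close>

lemma bij_mat_imp_inverse:
  fixes Y :: "complex mat"
  assumes Y: "Y \<in> carrier_mat n m"
    and inj: "\<And>v. v \<in> carrier_vec m \<Longrightarrow> Y *\<^sub>v v = 0\<^sub>v n \<Longrightarrow> v = 0\<^sub>v m"
    and surj: "\<And>w. w \<in> carrier_vec n \<Longrightarrow> \<exists>v\<in>carrier_vec m. Y *\<^sub>v v = w"
  obtains Q where "n = m" "Q \<in> carrier_mat n n" "Y * Q = 1\<^sub>m n" "Q * Y = 1\<^sub>m n"
proof -
  obtain Q where Q: "Q \<in> carrier_mat m n" and YQ: "Y * Q = 1\<^sub>m n"
    using surj_mat_right_inverse[OF Y surj] by blast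
  have QY: "Q * Y = 1\<^sub>m m"
  proof -
    have "Q * Y - 1\<^sub>m m = 0\<^sub>m m m"
    proof (rule mat_eq_zero_if_mult_vec_zero)
      fix v :: "complex vec" assume v: "v \<in> carrier_vec m"
      have Yv: "Y *\<^sub>v v \<in> carrier_vec n" using Y v by simp
      have "Y *\<^sub>v (Q *\<^sub>v (Y *\<^sub>v v)) = (Y * Q) *\<^sub>v (Y *\<^sub>v v)"
        by (rule assoc_mult_mat_vec[symmetric, OF Y Q Yv])
      also have "\<dots> = Y *\<^sub>v v" using Yv by (simp add: YQ)
      finally have "Y *\<^sub>v (Q *\<^sub>v (Y *\<^sub>v v) - v) = 0\<^sub>v n"
        using mult_minus_distrib_mat_vec[OF Y _ v, of "Q *\<^sub>v (Y *\<^sub>v v)"] Y Q v Yv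
        by simp
      hence "Q *\<^sub>v (Y *\<^sub>v v) - v = 0\<^sub>v m" using inj Q Yv v by simp
      moreover have "(Q * Y - 1\<^sub>m m) *\<^sub>v v = Q *\<^sub>v (Y *\<^sub>v v) - v"
        using Q Y v by (simp add: minus_mult_distrib_mat_vec[of _ m m])
      ultimately show "(Q * Y - 1\<^sub>m m) *\<^sub>v v = 0\<^sub>v m" by simp
    qed (use Q Y in auto)
    show ?thesis
    proof (rule eq_matI)
      fix i j assume ij: "i < dim_row (1\<^sub>m m :: complex mat)" "j < dim_col (1\<^sub>m m :: complex mat)"
      hence "(Q * Y - 1\<^sub>m m) $$ (i, j) = 0" using \<open>Q * Y - 1\<^sub>m m = 0\<^sub>m m m\<close> by simp
      thus "(Q * Y) $$ (i, j) = 1\<^sub>m m $$ (i, j)"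
        using Q Y ij by (simp add: index_minus_mat del: index_mult_mat(1))
    qed (use Q Y in auto)
  qed
  \<comment> \<open>The traces of \<open>Y * Q\<close> and \<open>Q * Y\<close> agree, and both
    products are identity matrices, of sizes \<open>n\<close> and \<open>m\<close>.\<close>
  have "(of_nat n :: complex) = of_nat m"
    using mat_trace_mult_commute[OF Y Q] YQ QY mat_trace_one by simp
  hence "n = m" by simp
  with that Q YQ QY show ?thesis by blast
qed

context fin_group begin

lemma intertwiner_kernel_invariant:
  assumes \<rho>: "matrix_rep n \<rho>" and \<sigma>: "matrix_rep m \<sigma>" and Y: "Y \<in> carrier_mat n m"
    and c: "\<And>g. g \<in> carrier G \<Longrightarrow> \<rho> g * Y = Y * \<sigma> g"
  shows "invariant_subspace m \<sigma> {v \<in> carrier_vec m. Y *\<^sub>v v = 0\<^sub>v n}"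
  unfolding invariant_subspace_def
proof (intro conjI ballI)
  show "VectorSpace.subspace class_ring {v \<in> carrier_vec m. Y *\<^sub>v v = 0\<^sub>v n} (module_vec TYPE(complex) m)"
    by (rule subspace_vecI)
      (use Y in \<open>auto simp: mult_add_distrib_mat_vec[OF Y] mult_mat_vec[OF Y]\<close>)
next
  fix g w assume g: "g \<in> carrier G" and w: "w \<in> {v \<in> carrier_vec m. Y *\<^sub>v v = 0\<^sub>v n}"
  note r = matrix_repD(1)[OF \<rho> g] matrix_repD(1)[OF \<sigma> g]
  have "Y *\<^sub>v (\<sigma> g *\<^sub>v w) = (\<rho> g * Y) *\<^sub>v w"
    using w by (simp add: c[OF g] assoc_mult_mat_vec[OF Y r(2)])
  also have "\<dots> = 0\<^sub>v n"
    using w r by (auto simp: assoc_mult_mat_vec[OF r(1) Y])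
  finally show "\<sigma> g *\<^sub>v w \<in> {v \<in> carrier_vec m. Y *\<^sub>v v = 0\<^sub>v n}" using r w by simp
qed

lemma intertwiner_image_invariant:
  assumes \<rho>: "matrix_rep n \<rho>" and \<sigma>: "matrix_rep m \<sigma>" and Y: "Y \<in> carrier_mat n m"
    and c: "\<And>g. g \<in> carrier G \<Longrightarrow> \<rho> g * Y = Y * \<sigma> g"
  shows "invariant_subspace n \<rho> ((\<lambda>v. Y *\<^sub>v v) ` carrier_vec m)"
  unfolding invariant_subspace_def
proof (intro conjI ballI)
  show "VectorSpace.subspace class_ring ((\<lambda>v. Y *\<^sub>v v) ` carrier_vec m) (module_vec TYPE(complex) n)"
  proof (rule subspace_vecI)
    show "0\<^sub>v n \<in> (*\<^sub>v) Y ` carrier_vec m"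
      by (rule image_eqI[of _ _ "0\<^sub>v m"]) (use Y in auto)
  next
    fix v w assume "v \<in> (*\<^sub>v) Y ` carrier_vec m" "w \<in> (*\<^sub>v) Y ` carrier_vec m"
    then obtain v' w' where "v' \<in> carrier_vec m" "w' \<in> carrier_vec m" "v = Y *\<^sub>v v'" "w = Y *\<^sub>v w'" by auto
    thus "v + w \<in> (*\<^sub>v) Y ` carrier_vec m"
      by (intro image_eqI[of _ _ "v' + w'"]) (auto simp: mult_add_distrib_mat_vec[OF Y])
  next
    fix a v assume "v \<in> (*\<^sub>v) Y ` carrier_vec m"
    then obtain v' where "v' \<in> carrier_vec m" "v = Y *\<^sub>v v'" by auto
    thus "a \<cdot>\<^sub>v v \<in> (*\<^sub>v) Y ` carrier_vec m"
      by (intro image_eqI[of _ _ "a \<cdot>\<^sub>v v'"]) (auto simp: mult_mat_vec[OF Y])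
  qed (use Y in auto)
next
  fix g w assume g: "g \<in> carrier G" and w: "w \<in> (*\<^sub>v) Y ` carrier_vec m"
  then obtain v where v: "v \<in> carrier_vec m" "w = Y *\<^sub>v v" by auto
  note r = matrix_repD(1)[OF \<rho> g] matrix_repD(1)[OF \<sigma> g]
  have "\<rho> g *\<^sub>v w = Y *\<^sub>v (\<sigma> g *\<^sub>v v)"
    using v c[OF g] assoc_mult_mat_vec[OF Y r(2) v(1)] assoc_mult_mat_vec[OF r(1) Y v(1)] by metis
  thus "\<rho> g *\<^sub>v w \<in> (*\<^sub>v) Y ` carrier_vec m" using v r by auto
qed

text \<open>The kernel of \<open>Y\<close> is invariant and proper, hence zero; the image is
  invariant and nonzero, hence everything. So \<open>Y\<close> itself is the change of
  basis.\<close>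

lemma schur_intertwiner:
  assumes \<rho>: "irreducible_matrix_rep n \<rho>" and \<sigma>: "irreducible_matrix_rep m \<sigma>"
    and Y: "Y \<in> carrier_mat n m"
    and c: "\<And>g. g \<in> carrier G \<Longrightarrow> \<rho> g * Y = Y * \<sigma> g"
    and nz: "Y \<noteq> 0\<^sub>m n m"
  shows "rep_equivalent G \<rho> \<sigma>"
proof -
  note R = irreducible_matrix_repD[OF \<rho>] and S = irreducible_matrix_repD[OF \<sigma>]
  let ?K = "{v \<in> carrier_vec m. Y *\<^sub>v v = 0\<^sub>v n}" and ?I = "(\<lambda>v. Y *\<^sub>v v) ` carrier_vec m"
  obtain v where v: "v \<in> carrier_vec m" "Y *\<^sub>v v \<noteq> 0\<^sub>v n"
    using mat_eq_zero_if_mult_vec_zero[OF Y] nz by blast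
  have K: "?K = {0\<^sub>v m}"
    using S(3)[OF intertwiner_kernel_invariant[OF R(1) S(1) Y c]] v by blast
  have "?I \<noteq> {0\<^sub>v n}" using v by blast
  hence I: "?I = carrier_vec n"
    using R(3)[OF intertwiner_image_invariant[OF R(1) S(1) Y c]] by blast
  obtain Q where Q: "n = m" "Q \<in> carrier_mat n n" "Y * Q = 1\<^sub>m n" "Q * Y = 1\<^sub>m n"
  proof (rule bij_mat_imp_inverse[OF Y])
    fix w :: "complex vec" assume "w \<in> carrier_vec n"
    hence "w \<in> ?I" using I by simp
    thus "\<exists>v\<in>carrier_vec m. Y *\<^sub>v v = w" by blast
  qed (use K in blast)+
  have "similar_mat_wit (\<rho> g) (\<sigma> g) Y Q" if g: "g \<in> carrier G" for g
  proof (rule similar_mat_witI)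
    note r = matrix_repD(1)[OF R(1) g] matrix_repD(1)[OF S(1) g]
    have "Y * \<sigma> g * Q = \<rho> g * (Y * Q)"
      using c[OF g] assoc_mult_mat[OF r(1) Y] Q by metis
    thus "\<rho> g = Y * \<sigma> g * Q" using Q r by simp
    show "\<rho> g \<in> carrier_mat n n" "\<sigma> g \<in> carrier_mat n n" using r Q by auto
  qed (use Q Y in auto)
  thus ?thesis unfolding rep_equivalent_def by blast
qed

text \<open>For an eigenvalue \<open>k\<close> of \<open>Y\<close> the kernel of
  \<open>Y - k \<cdot>\<^sub>m 1\<^sub>m n\<close> is invariant and nonzero, so it is the whole
  space. Writing the scalar by means of the trace makes it computable for sums over the
  group.\<close>

lemma schur_scalar:
  assumes \<rho>: "irreducible_matrix_rep n \<rho>" and Y: "Y \<in> carrier_mat n n"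
    and c: "\<And>g. g \<in> carrier G \<Longrightarrow> \<rho> g * Y = Y * \<rho> g"
  shows "Y = (mat_trace Y / of_nat n) \<cdot>\<^sub>m 1\<^sub>m n"
proof -
  note R = irreducible_matrix_repD[OF \<rho>]
  obtain k where "eigenvalue Y k"
    using spectrum_non_empty[OF Y R(2)] by (auto simp: spectrum_def)
  then obtain v where v: "v \<in> carrier_vec n" "v \<noteq> 0\<^sub>v n" "Y *\<^sub>v v = k \<cdot>\<^sub>v v"
    using Y by (auto simp: eigenvalue_def eigenvector_def)
  define Z where "Z = Y - k \<cdot>\<^sub>m 1\<^sub>m n"
  have Z: "Z \<in> carrier_mat n n" unfolding Z_def by (rule minus_carrier_mat) simp
  have Zv: "Z *\<^sub>v w = Y *\<^sub>v w - k \<cdot>\<^sub>v w" if "w \<in> carrier_vec n" for w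
    using that Y by (simp add: Z_def minus_mult_distrib_mat_vec[of _ n n] smult_one_mat_mult_vec)
  have "\<rho> g * Z = Z * \<rho> g" if g: "g \<in> carrier G" for g
  proof -
    note r = matrix_repD(1)[OF R(1) g]
    have I: "k \<cdot>\<^sub>m 1\<^sub>m n \<in> carrier_mat n n" by simp
    show ?thesis unfolding Z_def
      unfolding mult_minus_distrib_mat[OF r Y I] minus_mult_distrib_mat[OF Y I r] using r c[OF g]
      by (simp add: mult_smult_distrib[OF r one_carrier_mat] mult_smult_assoc_mat[OF one_carrier_mat r])
  qed
  note K = intertwiner_kernel_invariant[OF R(1) R(1) Z this]
  have "v \<in> {v \<in> carrier_vec n. Z *\<^sub>v v = 0\<^sub>v n}" using v Zv by simp
  hence "{v \<in> carrier_vec n. Z *\<^sub>v v = 0\<^sub>v n} = carrier_vec n"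
    using R(3)[OF K] v by blast
  hence "Z = 0\<^sub>m n n" by (intro mat_eq_zero_if_mult_vec_zero[OF Z]) blast
  have Yk: "Y = k \<cdot>\<^sub>m 1\<^sub>m n"
  proof (rule eq_matI)
    fix i j assume "i < dim_row (k \<cdot>\<^sub>m 1\<^sub>m n)" "j < dim_col (k \<cdot>\<^sub>m 1\<^sub>m n)"
    moreover from this have "Z $$ (i, j) = 0" using \<open>Z = 0\<^sub>m n n\<close> by simp
    ultimately show "Y $$ (i, j) = (k \<cdot>\<^sub>m 1\<^sub>m n) $$ (i, j)" using Y by (simp add: Z_def)
  qed (use Y in auto)
  have "mat_trace Y = k * of_nat n" unfolding Yk by (simp add: mat_trace_smult[of _ n] mat_trace_one)
  thus ?thesis using Yk R(2) by simp
qed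

text \<open>Despite the name the sum is not divided by the group order. With
  \<open>\<sigma> (inv g)\<close> on the right it turns an arbitrary \<open>X\<close> into an
  intertwiner from \<open>\<sigma>\<close> to \<open>\<rho>\<close>.\<close>

definition average :: "nat \<Rightarrow> nat \<Rightarrow> ('a \<Rightarrow> complex mat) \<Rightarrow> ('a \<Rightarrow> complex mat) \<Rightarrow> complex mat \<Rightarrow> complex mat" where
  "average n m \<rho> \<sigma> X = mat_sum n m (\<lambda>g. \<rho> g * X * \<sigma> (inv g)) (carrier G)"

lemma bij_betw_mult_left: "h \<in> carrier G \<Longrightarrow> bij_betw (\<lambda>g. h \<otimes> g) (carrier G) (carrier G)"
  by (rule bij_betw_byWitness[of _ "\<lambda>g. inv h \<otimes> g"]) (auto simp: m_assoc[symmetric])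

lemma average_commute:
  assumes \<rho>: "matrix_rep n \<rho>" and \<sigma>: "matrix_rep m \<sigma>" and X: "X \<in> carrier_mat n m"
    and h: "h \<in> carrier G"
  shows "\<rho> h * average n m \<rho> \<sigma> X = average n m \<rho> \<sigma> X * \<sigma> h"
proof -
  note R = matrix_repD[OF \<rho>] and S = matrix_repD[OF \<sigma>]
  have cl: "\<rho> g * X * \<sigma> (inv g) \<in> carrier_mat n m" if "g \<in> carrier G" for g
    using that R S X by (meson inv_closed mult_carrier_mat)
  have "average n m \<rho> \<sigma> X * \<sigma> h = mat_sum n m (\<lambda>g. \<rho> g * X * \<sigma> (inv g) * \<sigma> h) (carrier G)"
    unfolding average_def by (rule mat_sum_mult) (use h S cl in auto)
  \<comment> \<open>Replacing \<open>g\<close> by \<open>h \<otimes> g\<close> makes the trailing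
    \<open>\<sigma> h\<close> cancel and brings out \<open>\<rho> h\<close> on the left.\<close>
  also have "\<dots> = mat_sum n m (\<lambda>g. \<rho> (h \<otimes> g) * X * \<sigma> (inv (h \<otimes> g)) * \<sigma> h) (carrier G)"
    by (rule mat_sum_reindex[OF bij_betw_mult_left[OF h]])
  also have "\<dots> = mat_sum n m (\<lambda>g. \<rho> h * (\<rho> g * X * \<sigma> (inv g))) (carrier G)"
  proof (rule mat_sum_cong)
    fix g assume g: "g \<in> carrier G"
    note c = R(1)[OF h] R(1)[OF g] S(1)[OF h] S(1)[OF g] S(1)[OF inv_closed[OF g]] S(1)[OF inv_closed[OF h]]
    have "\<sigma> (inv (h \<otimes> g)) * \<sigma> h = \<sigma> (inv g)"
      using g h by (subst S(3)[symmetric]) (auto simp: inv_mult_group m_assoc)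
    moreover have "\<rho> (h \<otimes> g) * X * \<sigma> (inv (h \<otimes> g)) * \<sigma> h = \<rho> (h \<otimes> g) * X * (\<sigma> (inv (h \<otimes> g)) * \<sigma> h)"
      by (rule assoc_mult_mat[of _ n m _ m _ m])
        (use R(1) S(1) X g h in \<open>meson m_closed inv_closed mult_carrier_mat\<close>)+
    moreover have "\<rho> h * \<rho> g * X * \<sigma> (inv g) = \<rho> h * (\<rho> g * X * \<sigma> (inv g))"
      using assoc_mult_mat[OF c(1,2) X] assoc_mult_mat[OF c(1) mult_carrier_mat[OF c(2) X] c(5)] by simp
    ultimately show "\<rho> (h \<otimes> g) * X * \<sigma> (inv (h \<otimes> g)) * \<sigma> h = \<rho> h * (\<rho> g * X * \<sigma> (inv g))"
      using R(3)[OF h g] by simp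
  qed
  also have "\<dots> = \<rho> h * average n m \<rho> \<sigma> X"
    unfolding average_def by (rule mult_mat_sum[symmetric]) (use h R cl in auto)
  finally show ?thesis ..
qed

lemma average_eq_zero:
  assumes "irreducible_matrix_rep n \<rho>" "irreducible_matrix_rep m \<sigma>" "X \<in> carrier_mat n m"
    and "\<not> rep_equivalent G \<rho> \<sigma>"
  shows "average n m \<rho> \<sigma> X = 0\<^sub>m n m"
proof (rule ccontr)
  assume "average n m \<rho> \<sigma> X \<noteq> 0\<^sub>m n m"
  from schur_intertwiner[OF assms(1,2) _ _ this] have "rep_equivalent G \<rho> \<sigma>"
    using average_commute[OF irreducible_matrix_repD(1)[OF assms(1)] irreducible_matrix_repD(1)[OF assms(2)] assms(3)]
    by (simp add: average_def)
  with assms(4) show False by simp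
qed

text \<open>Every summand is similar to \<open>X\<close>, so the trace of the average is the group
  order times the trace of \<open>X\<close>; this fixes the scalar in Schur's lemma.\<close>

lemma average_self:
  assumes \<rho>: "irreducible_matrix_rep n \<rho>" and X: "X \<in> carrier_mat n n"
  shows "average n n \<rho> \<rho> X = (of_nat (Coset.order G) * mat_trace X / of_nat n) \<cdot>\<^sub>m 1\<^sub>m n"
proof -
  note R = irreducible_matrix_repD[OF \<rho>] note r = matrix_repD[OF R(1)]
  have "mat_trace (average n n \<rho> \<rho> X) = (\<Sum>g\<in>carrier G. mat_trace (\<rho> g * X * \<rho> (inv g)))"
    unfolding average_def by (rule mat_trace_mat_sum) (use r X in \<open>meson inv_closed mult_carrier_mat\<close>)
  also have "\<dots> = (\<Sum>g\<in>carrier G. mat_trace X)"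
  proof (rule sum.cong[OF refl])
    fix g assume g: "g \<in> carrier G"
    note c = r(1)[OF g] r(1)[OF inv_closed[OF g]]
    have "similar_mat_wit (\<rho> g * X * \<rho> (inv g)) X (\<rho> g) (\<rho> (inv g))"
      by (rule similar_mat_witI[of _ _ n]) (use matrix_rep_inv[OF R(1) g] X c in auto)
    thus "mat_trace (\<rho> g * X * \<rho> (inv g)) = mat_trace X" by (rule mat_trace_similar)
  qed
  also have "\<dots> = of_nat (Coset.order G) * mat_trace X" by (simp add: Coset.order_def)
  finally show ?thesis
    using schur_scalar[OF \<rho>, of "average n n \<rho> \<rho> X"] average_commute[OF R(1) R(1) X]
    by (simp add: average_def)
qed

end

section \<open>Matrices of finite order and adapted bases\<close>

lemma upper_triangular_mult:
  fixes A B :: "complex mat"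
  assumes A: "A \<in> carrier_mat n n" and B: "B \<in> carrier_mat n n"
    and uA: "upper_triangular A" and uB: "upper_triangular B"
  shows "upper_triangular (A * B)" "\<And>i. i < n \<Longrightarrow> (A * B) $$ (i, i) = A $$ (i, i) * B $$ (i, i)"
proof -
  have A0: "A $$ (i, j) = 0" if "j < i" "i < n" for i j using uA A that by auto
  have B0: "B $$ (i, j) = 0" if "j < i" "i < n" for i j using uB B that by auto
  show "upper_triangular (A * B)"
  proof (rule upper_triangularI)
    fix i j assume ij: "j < i" "i < dim_row (A * B)"
    hence i: "i < n" "j < n" using A by auto
    have "A $$ (i, l) * B $$ (l, j) = 0" if "l < n" for l
      using A0[of l i] B0[of j l] i ij that by (cases "l < i") auto
    thus "(A * B) $$ (i, j) = 0" unfolding index_mult_mat_sum[OF A B i] by (intro sum.neutral) auto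
  qed
  fix i assume i: "i < n"
  have "A $$ (i, l) * B $$ (l, i) = (if l = i then A $$ (i, i) * B $$ (i, i) else 0)" if "l < n" for l
    using A0[of l i] B0[of i l] i that by (cases l i rule: linorder_cases) auto
  hence "(\<Sum>l<n. A $$ (i, l) * B $$ (l, i)) = (\<Sum>l<n. if l = i then A $$ (i, i) * B $$ (i, i) else 0)"
    by (intro sum.cong) auto
  thus "(A * B) $$ (i, i) = A $$ (i, i) * B $$ (i, i)"
    unfolding index_mult_mat_sum[OF A B i i] using i by simp
qed

lemma upper_triangular_pow:
  fixes B :: "complex mat"
  assumes B: "B \<in> carrier_mat n n" and uB: "upper_triangular B"
  shows "upper_triangular (B ^\<^sub>m k) \<and> (\<forall>i<n. (B ^\<^sub>m k) $$ (i, i) = B $$ (i, i) ^ k)"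
proof (induction k)
  case 0
  show ?case using B by simp
next
  case (Suc k)
  have "B ^\<^sub>m k \<in> carrier_mat n n" using B by simp
  from upper_triangular_mult[OF this B _ uB] Suc show ?case by (simp add: mult.commute)
qed

text \<open>The eigenvalues of a matrix of finite order are roots of unity, so that inverting and
  conjugating them is the same.\<close>

lemma trace_power_eq_cnj:
  fixes A :: "complex mat"
  assumes A: "A \<in> carrier_mat n n" and k: "A ^\<^sub>m Suc k = 1\<^sub>m n"
  shows "mat_trace (A ^\<^sub>m k) = cnj (mat_trace A)"
proof -
  obtain es where "char_poly A = (\<Prod>a\<leftarrow>es. [:- a, 1:])"
    using char_poly_factorized[OF A] by auto
  from schur_decomposition_exists[OF A this] obtain B P Q where
    B: "B \<in> carrier_mat n n" "upper_triangular B" and s: "similar_mat_wit A B P Q"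
    by (auto simp: similar_mat_def)
  note u = upper_triangular_pow[OF B]
  have s': "similar_mat_wit (A ^\<^sub>m j) (B ^\<^sub>m j) P Q" for j
    by (rule similar_mat_wit_pow[OF s])
  \<comment> \<open>The identity is similar only to itself, so the triangular form inherits the
    finite order, and so does each of its diagonal entries.\<close>
  have "B ^\<^sub>m Suc k = 1\<^sub>m n"
  proof -
    have "B ^\<^sub>m Suc k \<in> carrier_mat n n" using B by (intro pow_carrier_mat)
    note w = similar_mat_witD2[OF this similar_mat_wit_sym[OF s'[of "Suc k"]]]
    show ?thesis using w unfolding k by (simp del: pow_mat.simps)
  qed
  hence e: "B $$ (i, i) ^ Suc k = 1" if "i < n" for i
    using u[of "Suc k"] that by simp
  have c: "B $$ (i, i) ^ k = cnj (B $$ (i, i))" if "i < n" for i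
  proof -
    let ?z = "B $$ (i, i)"
    have "norm ?z ^ Suc k = 1" using e[OF that] by (metis norm_one norm_power)
    hence "norm ?z = 1" using power_eq_imp_eq_base[of "norm ?z" "Suc k" 1] by simp
    hence "?z * cnj ?z = 1" by (simp add: complex_norm_square[symmetric])
    moreover have "?z * ?z ^ k = 1" using e[OF that] by simp
    ultimately show ?thesis by (metis mult_left_cancel mult_zero_left zero_neq_one)
  qed
  have "mat_trace (A ^\<^sub>m k) = mat_trace (B ^\<^sub>m k)" by (rule mat_trace_similar[OF s'])
  also have "\<dots> = cnj (mat_trace B)"
    using u[of k] c B by (simp add: mat_trace_def)
  also have "mat_trace B = mat_trace A" by (rule mat_trace_similar[OF s, symmetric])
  finally show ?thesis .
qed

text \<open>Independent sets have at most \<open>dim\<close> elements, so a maximal one exists, and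
  a vector outside its span could still be added. Below this is applied twice: to find a basis of a
  subspace and to extend it to the whole space.\<close>

lemma (in vec_space) maximal_indpt_extension:
  assumes W: "W \<subseteq> carrier_vec n" and A: "A \<subseteq> W" "lin_indpt A"
  obtains B where "A \<subseteq> B" "B \<subseteq> W" "lin_indpt B" "finite B" "W \<subseteq> span B"
proof -
  let ?P = "\<lambda>S. A \<subseteq> S \<and> S \<subseteq> W \<and> lin_indpt S"
  have "\<exists>B. finite B \<and> maximal B ?P"
  proof (rule maximal_exists)
    show "?P A" using A by simp
    show "finite S \<and> card S \<le> dim" if "?P S" for S
      using li_le_dim[OF fin_dim, of S] that W by auto
  qed
  then obtain B where fB: "finite B" and m: "maximal B ?P" by auto
  hence B: "A \<subseteq> B" "B \<subseteq> W" "lin_indpt B" by (auto simp: maximal_def)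
  have "W \<subseteq> span B"
  proof
    fix w assume w: "w \<in> W"
    show "w \<in> span B"
    proof (rule ccontr)
      assume n: "w \<notin> span B"
      hence wB: "w \<notin> B" using in_own_span B W by blast
      have "lin_indpt (B \<union> {w})"
        using lin_dep_iff_in_span[of B w] B W w wB n by auto
      hence "?P (B \<union> {w})" using B w by auto
      hence "B \<union> {w} = B" using m unfolding maximal_def by blast
      thus False using wB by auto
    qed
  qed
  with that B fB show ?thesis by blast
qed

text \<open>The columns of \<open>P\<close> are a basis of \<open>W\<close> followed by vectors
  completing it, and \<open>Q\<close> computes coordinates. That \<open>k\<close> lies strictly
  between 0 and \<open>n\<close> reflects that \<open>W\<close> is nonzero and proper; it makes both
  diagonal blocks smaller in the induction on the degree.\<close>

lemma subspace_adapted_basis: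
  fixes W :: "complex vec set"
  assumes W: "VectorSpace.subspace class_ring W (module_vec TYPE(complex) n)"
    and ne: "W \<noteq> {0\<^sub>v n}" "W \<noteq> carrier_vec n"
  obtains k P Q where "0 < k" "k < n" "P \<in> carrier_mat n n" "Q \<in> carrier_mat n n"
    "P * Q = 1\<^sub>m n" "Q * P = 1\<^sub>m n" "\<forall>j<k. col P j \<in> W"
    "\<forall>w\<in>W. \<forall>i. k \<le> i \<and> i < n \<longrightarrow> (Q *\<^sub>v w) $ i = 0"
proof -
  interpret vec_space "TYPE(complex)" n .
  note W' = subspace_vecD[OF W]
  have sub: "submodule class_ring W V" using W by (simp add: VectorSpace.subspace_def)
  have "lin_indpt {}" by (simp add: lin_dep_def)
  from maximal_indpt_extension[OF W'(1) empty_subsetI this]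
  obtain A where A: "A \<subseteq> W" "lin_indpt A" "finite A" "W \<subseteq> span A" .
  have "A \<subseteq> carrier_vec n" using A W' by simp
  from maximal_indpt_extension[OF order_refl this A(2)]
  obtain B where B: "A \<subseteq> B" "B \<subseteq> carrier_vec n" "lin_indpt B" "finite B" "carrier_vec n \<subseteq> span B" .
  have "basis B" using B span_closed[of B] by (auto simp: basis_def)
  hence cB: "card B = n" using dim_basis[OF B(4)] dim_is_n by simp
  obtain as where as: "set as = A" "distinct as" using finite_distinct_list[OF A(3)] by blast
  obtain bs where bs: "set bs = B - A" "distinct bs" using finite_distinct_list[of "B - A"] B by auto
  define xs where "xs = as @ bs"
  have xs: "set xs = B" "distinct xs" using as bs B by (auto simp: xs_def)
  have lxs: "length xs = n" using distinct_card[OF xs(2)] xs cB by simp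
  define k where "k = length as"
  define P where "P = mat_of_cols n xs"
  have P: "P \<in> carrier_mat n n" using mat_of_cols_carrier(1)[of n xs] lxs by (simp add: P_def)
  have lc: "lincomb a B = P *\<^sub>v vec n (\<lambda>i. a (xs ! i))" for a
  proof -
    have "lincomb a B = lincomb_list (\<lambda>i. a (xs ! i)) xs"
      using lincomb_as_lincomb_list_distinct[of xs a] xs B by simp
    also have "\<dots> = P *\<^sub>v vec n (\<lambda>i. a (xs ! i))"
      unfolding P_def using lincomb_list_as_mat_mult[of xs] xs B lxs by (auto dest: carrier_vecD)
    finally show ?thesis .
  qed
  have surj: "\<exists>v\<in>carrier_vec n. P *\<^sub>v v = w" if "w \<in> carrier_vec n" for w
  proof -
    have "w \<in> span B" using that B by blast
    then obtain a where "w = lincomb a B" using finite_in_span[OF B(4)] B(2) by auto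
    thus ?thesis using lc[of a] by (intro bexI[of _ "vec n (\<lambda>i. a (xs ! i))"]) auto
  qed
  obtain Q where Q: "Q \<in> carrier_mat n n" and PQ: "P * Q = 1\<^sub>m n"
    using surj_mat_right_inverse[OF P surj] by blast
  have QP: "Q * P = 1\<^sub>m n" by (rule mat_mult_left_right_inverse[OF P Q PQ])
  have "(Q *\<^sub>v w) $ i = 0" if w: "w \<in> W" and i: "k \<le> i" "i < n" for w i
  proof -
    obtain a where a: "w = lincomb a A" using finite_in_span[OF A(3), of w] A(1,4) w W'(1) by auto
    \<comment> \<open>Extending the coefficients by zero from \<open>A\<close> to \<open>B\<close>
      makes the coordinates of \<open>w\<close> at the added vectors vanish.\<close>
    define b where "b = (\<lambda>x. if x \<in> A then a x else 0)"
    have "lincomb b B = lincomb b (A \<union> (B - A))" using B by (simp add: Un_absorb1)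
    also have "\<dots> = lincomb b A"
      by (rule lincomb_clean) (use A B W' in \<open>auto simp: b_def\<close>)
    also have "\<dots> = lincomb a A"
      by (rule lincomb_restrict) (use A W' in \<open>auto simp: b_def restrict_def\<close>)
    finally have wb: "w = P *\<^sub>v vec n (\<lambda>i. b (xs ! i))" using a lc by simp
    have "Q *\<^sub>v w = (Q * P) *\<^sub>v vec n (\<lambda>i. b (xs ! i))"
      unfolding wb by (rule assoc_mult_mat_vec[symmetric, OF Q P]) simp
    hence "(Q *\<^sub>v w) $ i = b (xs ! i)" using i by (simp add: QP)
    moreover have "xs ! i \<in> set bs"
      using i lxs by (simp add: xs_def nth_append k_def)
    ultimately show ?thesis using bs by (simp add: b_def)
  qed
  moreover have "col P j \<in> W" if "j < k" for j
  proof -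
    have j: "j < length xs" using that by (simp add: k_def xs_def)
    moreover have "xs ! j \<in> carrier_vec n" using nth_mem[OF j] xs B by blast
    ultimately have "col P j = xs ! j" unfolding P_def by (rule col_mat_of_cols)
    also have "\<dots> \<in> W" using that A as nth_mem[of j as] by (auto simp: xs_def nth_append k_def)
    finally show ?thesis .
  qed
  moreover have "0 < k"
  proof (rule ccontr)
    assume "\<not> 0 < k"
    hence "A = {}" using as by (simp add: k_def)
    hence "W \<subseteq> {0\<^sub>v n}" using A(4) span_empty by simp
    thus False using W'(2) ne by blast
  qed
  moreover have "k < n"
  proof (rule ccontr)
    assume nk: "\<not> k < n"
    have "k + length bs = n" using lxs by (simp add: k_def xs_def)
    hence "length bs = 0" using nk by linarith
    hence "A = B" using bs(1) B(1) by auto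
    hence "carrier_vec n \<subseteq> W" using B(5) span_is_subset[OF _ sub, of A] A by simp
    thus False using W'(1) ne by blast
  qed
  ultimately show ?thesis using that P Q PQ QP by blast
qed

section \<open>Orthogonality and decomposition of characters\<close>

lemma sum_lessThan_add:
  fixes f :: "nat \<Rightarrow> 'b::comm_monoid_add"
  shows "(\<Sum>l<k + r. f l) = (\<Sum>l<k. f l) + (\<Sum>l<r. f (l + k))"
  by (induction r) (simp_all add: ac_simps)

context fin_group begin

lemma rep_equivalent_trace:
  assumes "rep_equivalent G \<rho> \<sigma>" "g \<in> carrier G"
  shows "mat_trace (\<rho> g) = mat_trace (\<sigma> g)"
  using assms mat_trace_similar unfolding rep_equivalent_def by blast

lemma rep_equivalent_refl:
  assumes "matrix_rep n \<rho>"
  shows "rep_equivalent G \<rho> \<rho>"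
  using similar_mat_wit_refl[OF matrix_repD(1)[OF assms]] unfolding rep_equivalent_def by blast

lemma rep_equivalent_sym: "rep_equivalent G \<rho> \<sigma> \<Longrightarrow> rep_equivalent G \<sigma> \<rho>"
  unfolding rep_equivalent_def using similar_mat_wit_sym by blast

lemma rep_equivalent_trans:
  "rep_equivalent G \<rho> \<sigma> \<Longrightarrow> rep_equivalent G \<sigma> \<tau> \<Longrightarrow> rep_equivalent G \<rho> \<tau>"
  unfolding rep_equivalent_def using similar_mat_wit_trans by blast

text \<open>A matrix unit isolates a single product of diagonal entries. Summed over all positions
  these products give the product of two traces.\<close>

lemma average_index_unit:
  assumes \<rho>: "matrix_rep n \<rho>" and \<sigma>: "matrix_rep m \<sigma>" and jk: "j < n" "k < m"
  shows "average n m \<rho> \<sigma> (mat n m (\<lambda>(a, b). if a = j \<and> b = k then 1 else 0)) $$ (j, k) =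
    (\<Sum>g\<in>carrier G. \<rho> g $$ (j, j) * \<sigma> (inv g) $$ (k, k))"
proof -
  let ?E = "mat n m (\<lambda>(a, b). if a = j \<and> b = k then 1 else 0) :: complex mat"
  have E: "?E \<in> carrier_mat n m" by simp
  have "(\<rho> g * ?E * \<sigma> (inv g)) $$ (j, k) = \<rho> g $$ (j, j) * \<sigma> (inv g) $$ (k, k)"
    if g: "g \<in> carrier G" for g
  proof -
    note r = matrix_repD(1)[OF \<rho> g] and s = matrix_repD(1)[OF \<sigma> inv_closed[OF g]]
    have 1: "(\<rho> g * ?E) $$ (j, l) = (if l = k then \<rho> g $$ (j, j) else 0)" if l: "l < m" for l
    proof -
      have "(\<rho> g * ?E) $$ (j, l) = (\<Sum>i<n. if i = j then if l = k then \<rho> g $$ (j, j) else 0 else 0)"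
        unfolding index_mult_mat_sum[OF r E jk(1) l] by (rule sum.cong) (use l in auto)
      thus ?thesis using jk by simp
    qed
    have "(\<rho> g * ?E * \<sigma> (inv g)) $$ (j, k) = (\<Sum>l<m. if l = k then \<rho> g $$ (j, j) * \<sigma> (inv g) $$ (k, k) else 0)"
      unfolding index_mult_mat_sum[OF mult_carrier_mat[OF r E] s jk] by (rule sum.cong) (auto simp: 1)
    thus ?thesis using jk by simp
  qed
  thus ?thesis using jk by (simp add: average_def)
qed

lemma sum_character_products:
  assumes \<rho>: "matrix_rep n \<rho>" and \<sigma>: "matrix_rep m \<sigma>"
  shows "(\<Sum>g\<in>carrier G. mat_trace (\<rho> g) * mat_trace (\<sigma> (inv g))) =
    (\<Sum>j<n. \<Sum>k<m. average n m \<rho> \<sigma> (mat n m (\<lambda>(a, b). if a = j \<and> b = k then 1 else 0)) $$ (j, k))"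
proof -
  have t: "mat_trace (\<rho> g) = (\<Sum>j<n. \<rho> g $$ (j, j))" "mat_trace (\<sigma> g) = (\<Sum>j<m. \<sigma> g $$ (j, j))"
    if "g \<in> carrier G" for g
    using matrix_repD(1)[OF \<rho> that] matrix_repD(1)[OF \<sigma> that] by (auto simp: mat_trace_def)
  have "(\<Sum>g\<in>carrier G. mat_trace (\<rho> g) * mat_trace (\<sigma> (inv g))) =
    (\<Sum>g\<in>carrier G. \<Sum>j<n. \<Sum>k<m. \<rho> g $$ (j, j) * \<sigma> (inv g) $$ (k, k))"
    by (rule sum.cong) (simp_all add: t sum_product)
  also have "\<dots> = (\<Sum>j<n. \<Sum>g\<in>carrier G. \<Sum>k<m. \<rho> g $$ (j, j) * \<sigma> (inv g) $$ (k, k))"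
    by (rule sum.swap)
  also have "\<dots> = (\<Sum>j<n. \<Sum>k<m. \<Sum>g\<in>carrier G. \<rho> g $$ (j, j) * \<sigma> (inv g) $$ (k, k))"
    by (intro sum.cong refl sum.swap)
  finally show ?thesis using average_index_unit[OF \<rho> \<sigma>] by simp
qed

text \<open>With \<open>inv g\<close> in place of a complex conjugate the relation is purely
  algebraic; \<open>character_inv\<close> makes the exchange later. Both cases are Schur's lemma for
  averages of matrix units.\<close>

lemma character_orthogonality:
  assumes \<rho>: "irreducible_matrix_rep n \<rho>" and \<sigma>: "irreducible_matrix_rep m \<sigma>"
  shows "(\<Sum>g\<in>carrier G. mat_trace (\<rho> g) * mat_trace (\<sigma> (inv g))) =
    (if rep_equivalent G \<rho> \<sigma> then of_nat (Coset.order G) else 0)"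
proof (cases "rep_equivalent G \<rho> \<sigma>")
  case True
  note R = irreducible_matrix_repD[OF \<rho>]
  let ?E = "\<lambda>j k. mat n n (\<lambda>(a, b). if a = j \<and> b = k then 1 else 0) :: complex mat"
  have "(\<Sum>g\<in>carrier G. mat_trace (\<rho> g) * mat_trace (\<sigma> (inv g))) =
    (\<Sum>g\<in>carrier G. mat_trace (\<rho> g) * mat_trace (\<rho> (inv g)))"
    using rep_equivalent_trace[OF True] by simp
  also have "\<dots> = (\<Sum>j<n. \<Sum>k<n. average n n \<rho> \<rho> (?E j k) $$ (j, k))"
    by (rule sum_character_products[OF R(1) R(1)])
  \<comment> \<open>Only the \<open>n\<close> diagonal matrix units have nonzero trace, and each
    contributes the group order divided by \<open>n\<close>.\<close>
  also have "\<dots> = (\<Sum>j<n. \<Sum>k<n. if k = j then of_nat (Coset.order G) / of_nat n else 0)"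
  proof (intro sum.cong refl)
    fix j k assume "j \<in> {..<n}" "k \<in> {..<n}"
    hence jk: "j < n" "k < n" by auto
    have "mat_trace (?E j k) = (\<Sum>i<n. if i = j then if j = k then 1 else 0 else 0)"
      unfolding mat_trace_def by (auto intro!: sum.cong)
    hence "mat_trace (?E j k) = (if j = k then 1 else 0)" using jk by simp
    thus "average n n \<rho> \<rho> (?E j k) $$ (j, k) = (if k = j then of_nat (Coset.order G) / of_nat n else 0)"
      using jk by (simp add: average_self[OF \<rho>])
  qed
  also have "\<dots> = of_nat (Coset.order G)" using R(2) by simp
  finally show ?thesis using True by simp
next
  case False
  thus ?thesis
    unfolding sum_character_products[OF irreducible_matrix_repD(1)[OF \<rho>] irreducible_matrix_repD(1)[OF \<sigma>]]
    by (simp add: average_eq_zero[OF \<rho> \<sigma>])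
qed

section \<open>Splitting characters into irreducible ones\<close>

lemma matrix_rep_conjugate:
  assumes \<rho>: "matrix_rep n \<rho>" and P: "P \<in> carrier_mat n n" and Q: "Q \<in> carrier_mat n n"
    and PQ: "P * Q = 1\<^sub>m n" and QP: "Q * P = 1\<^sub>m n"
  shows "matrix_rep n (\<lambda>g. Q * \<rho> g * P)"
  unfolding matrix_rep_def
proof (intro conjI ballI)
  note r = matrix_repD[OF \<rho>]
  show "Q * \<rho> \<one> * P = 1\<^sub>m n" using r(2) Q QP by simp
  fix g assume g: "g \<in> carrier G"
  show "Q * \<rho> g * P \<in> carrier_mat n n" using P Q r(1)[OF g] by simp
  fix h assume h: "h \<in> carrier G"
  note c = r(1)[OF g] r(1)[OF h]
  have "Q * \<rho> g * P * (Q * \<rho> h * P) = Q * \<rho> g * (P * (Q * \<rho> h * P))"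
    by (rule assoc_mult_mat[of _ n n _ n]) (use P Q c in auto)
  also have "P * (Q * \<rho> h * P) = P * (Q * (\<rho> h * P))"
    using assoc_mult_mat[OF Q c(2) P] by simp
  also have "\<dots> = P * Q * (\<rho> h * P)"
    by (rule assoc_mult_mat[symmetric, of _ n n _ n]) (use P Q c in auto)
  also have "\<dots> = \<rho> h * P" using PQ c P by simp
  also have "Q * \<rho> g * (\<rho> h * P) = Q * \<rho> g * \<rho> h * P"
    by (rule assoc_mult_mat[symmetric, of _ n n _ n]) (use P Q c in auto)
  also have "Q * \<rho> g * \<rho> h = Q * (\<rho> g * \<rho> h)" by (rule assoc_mult_mat[OF Q c])
  finally show "Q * \<rho> (g \<otimes> h) * P = Q * \<rho> g * P * (Q * \<rho> h * P)" using r(3)[OF g h] by simp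
qed

text \<open>The blocks are the subrepresentation on the first \<open>k\<close> coordinates and the
  quotient by it; the zero block at the lower left removes the cross terms of a product.\<close>

lemma matrix_rep_diagonal_blocks:
  assumes A: "matrix_rep (k + r) A"
    and z: "\<And>g i j. g \<in> carrier G \<Longrightarrow> k \<le> i \<Longrightarrow> i < k + r \<Longrightarrow> j < k \<Longrightarrow> A g $$ (i, j) = 0"
  shows "matrix_rep k (\<lambda>g. mat k k (\<lambda>(i, j). A g $$ (i, j)))"
    "matrix_rep r (\<lambda>g. mat r r (\<lambda>(i, j). A g $$ (i + k, j + k)))"
proof -
  note a = matrix_repD[OF A]
  show "matrix_rep k (\<lambda>g. mat k k (\<lambda>(i, j). A g $$ (i, j)))"
    unfolding matrix_rep_def
  proof (intro conjI ballI)
    show "mat k k (\<lambda>(i, j). A \<one> $$ (i, j)) = 1\<^sub>m k" unfolding a(2) by (rule eq_matI) auto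
    fix g h assume g: "g \<in> carrier G" and h: "h \<in> carrier G"
    show "mat k k (\<lambda>(i, j). A (g \<otimes> h) $$ (i, j)) =
      mat k k (\<lambda>(i, j). A g $$ (i, j)) * mat k k (\<lambda>(i, j). A h $$ (i, j))" (is "?L = ?M * ?N")
    proof (rule eq_matI)
      fix i j assume "i < dim_row (?M * ?N)" "j < dim_col (?M * ?N)"
      hence ij: "i < k" "j < k" by auto
      hence ij': "i < k + r" "j < k + r" by auto
      have "?L $$ (i, j) = (\<Sum>l<k + r. A g $$ (i, l) * A h $$ (l, j))"
        using ij index_mult_mat_sum[OF a(1)[OF g] a(1)[OF h] ij'] a(3)[OF g h] by simp
      also have "\<dots> = (\<Sum>l<k. A g $$ (i, l) * A h $$ (l, j))"
        unfolding sum_lessThan_add using ij z[OF h] by simp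
      also have "\<dots> = (?M * ?N) $$ (i, j)"
        using ij by (subst index_mult_mat_sum[of _ k k _ k]) auto
      finally show "?L $$ (i, j) = (?M * ?N) $$ (i, j)" .
    qed auto
  qed auto
  show "matrix_rep r (\<lambda>g. mat r r (\<lambda>(i, j). A g $$ (i + k, j + k)))"
    unfolding matrix_rep_def
  proof (intro conjI ballI)
    show "mat r r (\<lambda>(i, j). A \<one> $$ (i + k, j + k)) = 1\<^sub>m r" unfolding a(2) by (rule eq_matI) auto
    fix g h assume g: "g \<in> carrier G" and h: "h \<in> carrier G"
    show "mat r r (\<lambda>(i, j). A (g \<otimes> h) $$ (i + k, j + k)) =
      mat r r (\<lambda>(i, j). A g $$ (i + k, j + k)) * mat r r (\<lambda>(i, j). A h $$ (i + k, j + k))" (is "?L = ?M * ?N")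
    proof (rule eq_matI)
      fix i j assume "i < dim_row (?M * ?N)" "j < dim_col (?M * ?N)"
      hence ij: "i < r" "j < r" by auto
      hence ij': "i + k < k + r" "j + k < k + r" by auto
      have "?L $$ (i, j) = (\<Sum>l<k + r. A g $$ (i + k, l) * A h $$ (l, j + k))"
        using ij index_mult_mat_sum[OF a(1)[OF g] a(1)[OF h] ij'] a(3)[OF g h] by simp
      also have "\<dots> = (\<Sum>l<r. A g $$ (i + k, l + k) * A h $$ (l + k, j + k))"
        unfolding sum_lessThan_add using ij z[OF g] by simp
      also have "\<dots> = (?M * ?N) $$ (i, j)"
        using ij by (subst index_mult_mat_sum[of _ r r _ r]) auto
      finally show "?L $$ (i, j) = (?M * ?N) $$ (i, j)" .
    qed auto
  qed auto
qed

text \<open>Complements are not needed: a block triangular form already splits the trace.\<close>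

lemma character_decomposition:
  assumes "matrix_rep n \<rho>"
  shows "\<exists>rs. (\<forall>\<sigma>\<in>set rs. \<exists>m. irreducible_matrix_rep m \<sigma>) \<and>
    (\<forall>g\<in>carrier G. mat_trace (\<rho> g) = (\<Sum>\<sigma>\<leftarrow>rs. mat_trace (\<sigma> g)))"
  using assms
proof (induction n arbitrary: \<rho> rule: less_induct)
  case (less n)
  note r = matrix_repD[OF less.prems]
  consider "n = 0" | "irreducible_matrix_rep n \<rho>" |
    W where "invariant_subspace n \<rho> W" "W \<noteq> {0\<^sub>v n}" "W \<noteq> carrier_vec n"
    using less.prems unfolding irreducible_matrix_rep_def by blast
  then show ?case
  proof cases
    case 1
    have "mat_trace (\<rho> g) = 0" if "g \<in> carrier G" for g
      using r(1)[OF that] 1 by (simp add: mat_trace_def)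
    thus ?thesis by (intro exI[of _ "[]"]) simp
  next
    case 2
    thus ?thesis by (intro exI[of _ "[\<rho>]"]) auto
  next
    case (3 W)
    have W: "VectorSpace.subspace class_ring W (module_vec TYPE(complex) n)"
      and inv: "\<And>g w. g \<in> carrier G \<Longrightarrow> w \<in> W \<Longrightarrow> \<rho> g *\<^sub>v w \<in> W"
      using 3(1) by (auto simp: invariant_subspace_def)
    from subspace_adapted_basis[OF W 3(2,3)]
    obtain k P Q where k: "0 < k" "k < n" and PQ: "P \<in> carrier_mat n n" "Q \<in> carrier_mat n n"
      "P * Q = 1\<^sub>m n" "Q * P = 1\<^sub>m n" and colP: "\<forall>j<k. col P j \<in> W"
      and Q0: "\<forall>w\<in>W. \<forall>i. k \<le> i \<and> i < n \<longrightarrow> (Q *\<^sub>v w) $ i = 0" .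
    define A where "A = (\<lambda>g. Q * \<rho> g * P)"
    have A: "matrix_rep n A" unfolding A_def by (rule matrix_rep_conjugate[OF less.prems PQ])
    obtain s where s: "n = k + s" using k less_imp_add_positive by blast
    \<comment> \<open>Column \<open>j\<close> of \<open>P\<close> lies in \<open>W\<close>,
      invariance keeps it there, and \<open>Q\<close> kills the coordinates from \<open>k\<close>
      on.\<close>
    have z: "A g $$ (i, j) = 0" if g: "g \<in> carrier G" and i: "k \<le> i" "i < k + s" and j: "j < k" for g i j
    proof -
      note c = r(1)[OF g]
      have jn: "j < n" and i_n: "i < n" using i j s by auto
      have "A g = Q * (\<rho> g * P)" unfolding A_def by (rule assoc_mult_mat[OF PQ(2) c PQ(1)])
      hence "col (A g) j = Q *\<^sub>v (\<rho> g *\<^sub>v col P j)"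
        using col_mult2[OF PQ(2) mult_carrier_mat[OF c PQ(1)] jn] col_mult2[OF c PQ(1) jn] by simp
      hence "col (A g) j $ i = 0" using Q0 inv[OF g] colP i(1) i_n j by simp
      thus ?thesis using matrix_repD(1)[OF A g] i_n jn by simp
    qed
    let ?B = "\<lambda>g. mat k k (\<lambda>(i, j). A g $$ (i, j))" and ?C = "\<lambda>g. mat s s (\<lambda>(i, j). A g $$ (i + k, j + k))"
    note blocks = matrix_rep_diagonal_blocks[OF A[unfolded s] z]
    obtain bs where bs: "\<forall>\<sigma>\<in>set bs. \<exists>m. irreducible_matrix_rep m \<sigma>"
      "\<forall>g\<in>carrier G. mat_trace (?B g) = (\<Sum>\<sigma>\<leftarrow>bs. mat_trace (\<sigma> g))"
      using less.IH[OF k(2) blocks(1)] by auto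
    obtain cs where cs: "\<forall>\<sigma>\<in>set cs. \<exists>m. irreducible_matrix_rep m \<sigma>"
      "\<forall>g\<in>carrier G. mat_trace (?C g) = (\<Sum>\<sigma>\<leftarrow>cs. mat_trace (\<sigma> g))"
      using less.IH[OF _ blocks(2)] k s by auto
    have "mat_trace (\<rho> g) = mat_trace (?B g) + mat_trace (?C g)" if g: "g \<in> carrier G" for g
    proof -
      have "similar_mat_wit (A g) (\<rho> g) Q P"
        by (rule similar_mat_witI[of _ _ n]) (use PQ r(1)[OF g] in \<open>auto simp: A_def\<close>)
      hence "mat_trace (\<rho> g) = mat_trace (A g)" using mat_trace_similar by metis
      also have "\<dots> = (\<Sum>i<k + s. A g $$ (i, i))"
        using matrix_repD(1)[OF A g] s by (simp add: mat_trace_def)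
      also have "\<dots> = mat_trace (?B g) + mat_trace (?C g)"
        unfolding sum_lessThan_add by (simp add: mat_trace_def)
      finally show ?thesis .
    qed
    thus ?thesis using bs cs by (intro exI[of _ "bs @ cs"]) auto
  qed
qed

text \<open>The matrices of left translation, with rows indexed by a list of the group elements,
  form a representation. Its trace counts the \<open>x\<close> with
  \<open>x = g \<otimes> x\<close>, and these exist only for \<open>g = \<one>\<close>.\<close>

lemma regular_character_decomposition:
  "\<exists>rs. (\<forall>\<sigma>\<in>set rs. \<exists>m. irreducible_matrix_rep m \<sigma>) \<and>
    (\<forall>g\<in>carrier G. (\<Sum>\<sigma>\<leftarrow>rs. mat_trace (\<sigma> g)) = (if g = \<one> then of_nat (Coset.order G) else 0))"
proof -
  obtain gs where gs: "set gs = carrier G" "distinct gs"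
    using finite_distinct_list[OF finite_carrier] by blast
  let ?N = "length gs"
  have N: "?N = Coset.order G" using distinct_card[OF gs(2)] gs(1) by (simp add: Coset.order_def)
  have b: "bij_betw (\<lambda>i. gs ! i) {..<?N} (carrier G)"
    using bij_betw_nth[OF gs(2) refl gs(1)[symmetric]] by simp
  have reindex: "(\<Sum>i<?N. F (gs ! i)) = (\<Sum>x\<in>carrier G. F x)" for F :: "'a \<Rightarrow> complex"
    by (rule sum.reindex_bij_betw[OF b])
  have gsc: "gs ! i \<in> carrier G" if "i < ?N" for i using that gs nth_mem by blast
  define reg where "reg = (\<lambda>g. mat ?N ?N (\<lambda>(i, j). if gs ! i = g \<otimes> gs ! j then 1 else 0 :: complex))"
  have "matrix_rep ?N reg"
    unfolding matrix_rep_def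
  proof (intro conjI ballI)
    show "reg \<one> = 1\<^sub>m ?N"
      by (rule eq_matI) (use gsc nth_eq_iff_index_eq[OF gs(2)] in \<open>auto simp: reg_def\<close>)
    fix g h assume g: "g \<in> carrier G" and h: "h \<in> carrier G"
    show "reg (g \<otimes> h) = reg g * reg h"
    proof (rule eq_matI)
      fix i j assume "i < dim_row (reg g * reg h)" "j < dim_col (reg g * reg h)"
      hence ij: "i < ?N" "j < ?N" by (auto simp: reg_def)
      have "(reg g * reg h) $$ (i, j) = (\<Sum>l<?N. reg g $$ (i, l) * reg h $$ (l, j))"
        by (rule index_mult_mat_sum[of _ ?N ?N _ ?N]) (use ij in \<open>auto simp: reg_def\<close>)
      also have "\<dots> = (\<Sum>l<?N. (\<lambda>x. if x = h \<otimes> gs ! j then if gs ! i = g \<otimes> x then 1 else 0 else 0) (gs ! l))"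
        by (rule sum.cong) (use ij in \<open>auto simp: reg_def\<close>)
      also have "\<dots> = (\<Sum>x\<in>carrier G. if x = h \<otimes> gs ! j then if gs ! i = g \<otimes> x then 1 else 0 else 0)"
        by (rule reindex)
      also have "\<dots> = (if gs ! i = g \<otimes> (h \<otimes> gs ! j) then 1 else 0)"
        using g h gsc ij by simp
      also have "\<dots> = reg (g \<otimes> h) $$ (i, j)"
        using ij g h gsc by (simp add: reg_def m_assoc)
      finally show "reg (g \<otimes> h) $$ (i, j) = (reg g * reg h) $$ (i, j)" ..
    qed (auto simp: reg_def)
  qed (auto simp: reg_def)
  from character_decomposition[OF this] obtain rs where rs: "\<forall>\<sigma>\<in>set rs. \<exists>m. irreducible_matrix_rep m \<sigma>"
    "\<forall>g\<in>carrier G. mat_trace (reg g) = (\<Sum>\<sigma>\<leftarrow>rs. mat_trace (\<sigma> g))" by auto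
  have "mat_trace (reg g) = (if g = \<one> then of_nat (Coset.order G) else 0)" if g: "g \<in> carrier G" for g
  proof -
    have "mat_trace (reg g) = (\<Sum>l<?N. (\<lambda>x. if x = g \<otimes> x then 1 else 0) (gs ! l))"
      by (simp add: mat_trace_def reg_def)
    also have "\<dots> = (\<Sum>x\<in>carrier G. if x = g \<otimes> x then 1 else 0)" by (rule reindex)
    also have "\<dots> = (\<Sum>x\<in>carrier G. if g = \<one> then 1 else 0)"
      by (rule sum.cong) (use g in auto)
    finally show ?thesis by (simp add: Coset.order_def)
  qed
  with rs show ?thesis by (intro exI[of _ rs]) auto
qed

end

section \<open>Column orthogonality\<close>

context fin_group begin

text \<open>Pairing the regular character with that of \<open>\<rho>\<close> leaves only the term at
  \<open>\<one>\<close>, so the multiplicity of \<open>\<rho>\<close> is its degree. The degree is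
  positive, so every member of \<open>T\<close> is equivalent to an entry of the finite list
  \<open>rs\<close>.\<close>

lemma transversal_regular_character:
  assumes T: "representatives {\<rho>. irreducible_rep G \<rho>} (rep_equivalent G) T"
  shows "finite T"
    and "g \<in> carrier G \<Longrightarrow> (\<Sum>\<rho>\<in>T. of_nat (rep_degree G \<rho>) * mat_trace (\<rho> g)) =
      (if g = \<one> then of_nat (Coset.order G) else 0)"
proof -
  obtain rs where rs: "\<And>\<sigma>. \<sigma> \<in> set rs \<Longrightarrow> \<exists>m. irreducible_matrix_rep m \<sigma>"
    and reg: "\<And>g. g \<in> carrier G \<Longrightarrow>
      (\<Sum>\<sigma>\<leftarrow>rs. mat_trace (\<sigma> g)) = (if g = \<one> then of_nat (Coset.order G) else 0)"
    using regular_character_decomposition by blast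
  have Tirr: "irreducible_matrix_rep (rep_degree G \<rho>) \<rho>" if "\<rho> \<in> T" for \<rho>
    using T that by (auto simp: representatives_def irreducible_rep_iff)
  \<comment> \<open>The multiplicity of \<open>\<rho>\<close> in the regular representation.\<close>
  define c where "c = (\<lambda>\<rho>. \<Sum>\<sigma>\<leftarrow>rs. if rep_equivalent G \<sigma> \<rho> then 1 else 0 :: complex)"
  have order: "(of_nat (Coset.order G) :: complex) \<noteq> 0" by (simp add: order_gt_0_iff_finite)
  have c: "c \<rho> = of_nat (rep_degree G \<rho>)" if \<rho>: "\<rho> \<in> T" for \<rho>
  proof -
    note r = Tirr[OF \<rho>] note r' = irreducible_matrix_repD(1)[OF r]
    have "of_nat (Coset.order G) * of_nat (rep_degree G \<rho>) =
      (\<Sum>g\<in>carrier G. (if g = \<one> then of_nat (Coset.order G) else 0) * mat_trace (\<rho> (inv g)))"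
      using matrix_repD(2)[OF r'] by (simp add: if_distrib[of "\<lambda>z. z * _"] mat_trace_one cong: if_cong)
    also have "\<dots> = (\<Sum>g\<in>carrier G. (\<Sum>\<sigma>\<leftarrow>rs. mat_trace (\<sigma> g)) * mat_trace (\<rho> (inv g)))"
      by (simp add: reg)
    also have "\<dots> = (\<Sum>g\<in>carrier G. \<Sum>\<sigma>\<leftarrow>rs. mat_trace (\<sigma> g) * mat_trace (\<rho> (inv g)))"
      by (simp add: sum_list_mult_const)
    also have "\<dots> = (\<Sum>\<sigma>\<leftarrow>rs. \<Sum>g\<in>carrier G. mat_trace (\<sigma> g) * mat_trace (\<rho> (inv g)))"
      by (induction rs) (simp_all add: sum.distrib)
    also have "\<dots> = (\<Sum>\<sigma>\<leftarrow>rs. of_nat (Coset.order G) * (if rep_equivalent G \<sigma> \<rho> then 1 else 0))"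
    proof (intro arg_cong[of _ _ sum_list] map_cong refl)
      fix \<sigma> assume "\<sigma> \<in> set rs"
      then obtain m where "irreducible_matrix_rep m \<sigma>" using rs by blast
      from character_orthogonality[OF this r]
      show "(\<Sum>g\<in>carrier G. mat_trace (\<sigma> g) * mat_trace (\<rho> (inv g))) =
        of_nat (Coset.order G) * (if rep_equivalent G \<sigma> \<rho> then 1 else 0)" by simp
    qed
    also have "\<dots> = of_nat (Coset.order G) * c \<rho>" by (simp add: c_def sum_list_const_mult)
    finally show ?thesis using order by simp
  qed
  have ex1: "\<exists>!\<rho>. \<rho> \<in> T \<and> rep_equivalent G \<rho> \<sigma>" if "\<sigma> \<in> set rs" for \<sigma>
  proof -
    have "irreducible_rep G \<sigma>" using rs[OF that] irreducible_repI by blast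
    thus ?thesis using T unfolding representatives_def by blast
  qed
  define t where "t = (\<lambda>\<sigma>. THE \<rho>. \<rho> \<in> T \<and> rep_equivalent G \<rho> \<sigma>)"
  have t: "\<rho> = t \<sigma>" if "\<rho> \<in> T" "rep_equivalent G \<rho> \<sigma>" "\<sigma> \<in> set rs" for \<rho> \<sigma>
    unfolding t_def using the1_equality[OF ex1[OF that(3)]] that by auto
  have t': "t \<sigma> \<in> T" "rep_equivalent G (t \<sigma>) \<sigma>" if "\<sigma> \<in> set rs" for \<sigma>
    unfolding t_def using theI'[OF ex1[OF that]] by auto
  have "T \<subseteq> t ` set rs"
  proof
    fix \<rho> assume \<rho>: "\<rho> \<in> T"
    hence "c \<rho> \<noteq> 0" using c irreducible_matrix_repD(2)[OF Tirr] by auto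
    have "\<exists>\<sigma>\<in>set rs. rep_equivalent G \<sigma> \<rho>"
    proof (rule ccontr)
      assume "\<not> ?thesis"
      hence "map (\<lambda>\<sigma>. if rep_equivalent G \<sigma> \<rho> then 1 else 0 :: complex) rs = map (\<lambda>_. 0) rs"
        by (intro map_cong) auto
      hence "c \<rho> = sum_list (map (\<lambda>_. 0) rs)" unfolding c_def by (rule arg_cong)
      hence "c \<rho> = 0" by simp
      thus False using \<open>c \<rho> \<noteq> 0\<close> by simp
    qed
    then obtain \<sigma> where "\<sigma> \<in> set rs" "rep_equivalent G \<sigma> \<rho>" by blast
    thus "\<rho> \<in> t ` set rs" using t[OF \<rho>] rep_equivalent_sym by blast
  qed
  thus fin: "finite T" by (rule finite_subset) simp
  show "(\<Sum>\<rho>\<in>T. of_nat (rep_degree G \<rho>) * mat_trace (\<rho> g)) = (if g = \<one> then of_nat (Coset.order G) else 0)"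
    if g: "g \<in> carrier G"
  proof -
    \<comment> \<open>Each constituent is replaced by the unique member of \<open>T\<close>
      equivalent to it; exchanging the sums then collects the multiplicities.\<close>
    have eq: "mat_trace (\<sigma> g) = (\<Sum>\<rho>\<in>T. (if rep_equivalent G \<sigma> \<rho> then 1 else 0) * mat_trace (\<rho> g))"
      if \<sigma>: "\<sigma> \<in> set rs" for \<sigma>
    proof -
      have "rep_equivalent G \<sigma> \<rho> \<longleftrightarrow> \<rho> = t \<sigma>" if "\<rho> \<in> T" for \<rho>
        using t[OF that _ \<sigma>] t'(2)[OF \<sigma>] rep_equivalent_sym by blast
      hence "(\<Sum>\<rho>\<in>T. (if rep_equivalent G \<sigma> \<rho> then 1 else 0) * mat_trace (\<rho> g)) =
        (\<Sum>\<rho>\<in>T. if \<rho> = t \<sigma> then mat_trace (\<rho> g) else 0)"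
        by (intro sum.cong refl) simp
      also have "\<dots> = mat_trace (t \<sigma> g)" using t'(1)[OF \<sigma>] fin by simp
      finally show ?thesis using rep_equivalent_trace[OF t'(2)[OF \<sigma>] g] by simp
    qed
    have "(\<Sum>\<sigma>\<leftarrow>rs. mat_trace (\<sigma> g)) =
      (\<Sum>\<sigma>\<leftarrow>rs. \<Sum>\<rho>\<in>T. (if rep_equivalent G \<sigma> \<rho> then 1 else 0) * mat_trace (\<rho> g))"
      by (intro arg_cong[of _ _ sum_list] map_cong refl eq)
    also have "\<dots> = (\<Sum>\<rho>\<in>T. \<Sum>\<sigma>\<leftarrow>rs. (if rep_equivalent G \<sigma> \<rho> then 1 else 0) * mat_trace (\<rho> g))"
      by (induction rs) (simp_all add: sum.distrib)
    also have "\<dots> = (\<Sum>\<rho>\<in>T. c \<rho> * mat_trace (\<rho> g))"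
      unfolding c_def by (simp only: sum_list_mult_const)
    finally show ?thesis using c reg[OF g] by simp
  qed
qed

text \<open>The sum of the conjugates of \<open>\<rho> y\<close> is an average in the sense above,
  hence a scalar determined by the trace of \<open>\<rho> y\<close>; multiplying it by
  \<open>\<rho> x\<close> leaves the product of the two characters.\<close>

lemma sum_trace_conjugates:
  assumes \<rho>: "irreducible_matrix_rep n \<rho>" and x: "x \<in> carrier G" and y: "y \<in> carrier G"
  shows "of_nat n * (\<Sum>g\<in>carrier G. mat_trace (\<rho> (x \<otimes> g \<otimes> y \<otimes> inv g))) =
    of_nat (Coset.order G) * (mat_trace (\<rho> x) * mat_trace (\<rho> y))"
proof -
  note R = irreducible_matrix_repD[OF \<rho>] note r = matrix_repD[OF R(1)]
  have cl: "\<rho> g * \<rho> y * \<rho> (inv g) \<in> carrier_mat n n" if "g \<in> carrier G" for g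
    using r(1)[OF that] r(1)[OF y] r(1)[OF inv_closed[OF that]] by simp
  have "(\<Sum>g\<in>carrier G. mat_trace (\<rho> (x \<otimes> g \<otimes> y \<otimes> inv g))) =
    (\<Sum>g\<in>carrier G. mat_trace (\<rho> x * (\<rho> g * \<rho> y * \<rho> (inv g))))"
  proof (rule sum.cong[OF refl])
    fix g assume g: "g \<in> carrier G"
    have "x \<otimes> g \<otimes> y \<otimes> inv g = x \<otimes> (g \<otimes> y \<otimes> inv g)" using x y g by (simp add: m_assoc)
    thus "mat_trace (\<rho> (x \<otimes> g \<otimes> y \<otimes> inv g)) = mat_trace (\<rho> x * (\<rho> g * \<rho> y * \<rho> (inv g)))"
      using r(3) x y g by simp
  qed
  also have "\<dots> = mat_trace (mat_sum n n (\<lambda>g. \<rho> x * (\<rho> g * \<rho> y * \<rho> (inv g))) (carrier G))"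
    by (rule mat_trace_mat_sum[symmetric]) (use r(1)[OF x] cl in auto)
  also have "mat_sum n n (\<lambda>g. \<rho> x * (\<rho> g * \<rho> y * \<rho> (inv g))) (carrier G) = \<rho> x * average n n \<rho> \<rho> (\<rho> y)"
    unfolding average_def by (rule mult_mat_sum[symmetric]) (use r(1)[OF x] cl in auto)
  also have "\<dots> = (of_nat (Coset.order G) * mat_trace (\<rho> y) / of_nat n) \<cdot>\<^sub>m \<rho> x"
    unfolding average_self[OF \<rho> r(1)[OF y]] using r(1)[OF x]
    by (simp add: mult_smult_distrib[OF r(1)[OF x] one_carrier_mat])
  also have "mat_trace \<dots> = of_nat (Coset.order G) * mat_trace (\<rho> y) / of_nat n * mat_trace (\<rho> x)"
    by (rule mat_trace_smult[OF r(1)[OF x]])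
  finally show ?thesis using R(2) by simp
qed

text \<open>The inverse of \<open>g\<close> is its power with exponent one less than the group
  order, so \<open>trace_power_eq_cnj\<close> applies.\<close>

lemma character_inv:
  assumes \<rho>: "matrix_rep n \<rho>" and g: "g \<in> carrier G"
  shows "mat_trace (\<rho> (inv g)) = cnj (mat_trace (\<rho> g))"
proof -
  note r = matrix_repD[OF \<rho>]
  have pow: "\<rho> (g [^] k) = \<rho> g ^\<^sub>m k" for k :: nat
  proof (induction k)
    case 0
    show ?case using r(1)[OF g] r(2) by simp
  next
    case (Suc k)
    thus ?case using r(3)[of "g [^] k" g] g by simp
  qed
  obtain k where k: "Coset.order G = Suc k" using order_gt_0_iff_finite not0_implies_Suc by fastforce
  have e: "g [^] Suc k = \<one>" using pow_order_eq_1[OF g] k by (simp del: nat_pow_Suc)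
  hence "inv g = g [^] k" using g by (intro inv_equality) (auto simp: nat_pow_Suc)
  moreover have "\<rho> g ^\<^sub>m Suc k = 1\<^sub>m n" using pow[of "Suc k"] e r(2) by simp
  ultimately show ?thesis using trace_power_eq_cnj[OF r(1)[OF g]] pow by simp
qed

text \<open>The regular character at \<open>x \<otimes> g \<otimes> inv y \<otimes> inv g\<close>
  detects \<open>x \<otimes> g = g \<otimes> y\<close>. Summing over \<open>g\<close> and using
  \<open>sum_trace_conjugates\<close> for every member of \<open>T\<close> gives the two sides.
  Counting solutions treats conjugate and non-conjugate elements alike.\<close>

lemma column_orthogonality:
  assumes T: "representatives {\<rho>. irreducible_rep G \<rho>} (rep_equivalent G) T"
    and x: "x \<in> carrier G" and y: "y \<in> carrier G"
  shows "(\<Sum>\<rho>\<in>T. mat_trace (\<rho> x) * cnj (mat_trace (\<rho> y))) = of_nat (card {g \<in> carrier G. x \<otimes> g = g \<otimes> y})"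
proof -
  have Tirr: "irreducible_matrix_rep (rep_degree G \<rho>) \<rho>" if "\<rho> \<in> T" for \<rho>
    using T that by (auto simp: representatives_def irreducible_rep_iff)
  have order: "(of_nat (Coset.order G) :: complex) \<noteq> 0" by (simp add: order_gt_0_iff_finite)
  have iff: "x \<otimes> g \<otimes> inv y \<otimes> inv g = \<one> \<longleftrightarrow> x \<otimes> g = g \<otimes> y" if g: "g \<in> carrier G" for g
  proof -
    have "x \<otimes> g \<otimes> inv y \<otimes> inv g = (x \<otimes> g) \<otimes> inv (g \<otimes> y)"
      using x y g by (simp add: m_assoc inv_mult_group)
    thus ?thesis using x y g inv_solve_right'[of \<one> "x \<otimes> g" "g \<otimes> y"] by simp
  qed
  have "of_nat (Coset.order G) * (\<Sum>\<rho>\<in>T. mat_trace (\<rho> x) * cnj (mat_trace (\<rho> y))) =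
    (\<Sum>\<rho>\<in>T. of_nat (Coset.order G) * (mat_trace (\<rho> x) * mat_trace (\<rho> (inv y))))"
    unfolding sum_distrib_left
    by (rule sum.cong) (use character_inv[OF irreducible_matrix_repD(1)[OF Tirr] y] in auto)
  also have "\<dots> = (\<Sum>\<rho>\<in>T. of_nat (rep_degree G \<rho>) * (\<Sum>g\<in>carrier G. mat_trace (\<rho> (x \<otimes> g \<otimes> inv y \<otimes> inv g))))"
    by (rule sum.cong) (use sum_trace_conjugates[OF Tirr x inv_closed[OF y]] in auto)
  also have "\<dots> = (\<Sum>g\<in>carrier G. \<Sum>\<rho>\<in>T. of_nat (rep_degree G \<rho>) * mat_trace (\<rho> (x \<otimes> g \<otimes> inv y \<otimes> inv g)))"
    unfolding sum_distrib_left by (rule sum.swap)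
  also have "\<dots> = (\<Sum>g\<in>carrier G. of_nat (Coset.order G) * (if x \<otimes> g = g \<otimes> y then 1 else 0))"
    by (rule sum.cong) (use transversal_regular_character(2)[OF T] x y iff in auto)
  also have "\<dots> = of_nat (Coset.order G) * of_nat (card {g \<in> carrier G. x \<otimes> g = g \<otimes> y})"
    by (simp add: sum_distrib_left[symmetric] sum.If_cases Int_def)
  finally show ?thesis using order by simp
qed

section \<open>Averages over normal subgroups\<close>

lemma bij_betw_conj_normal:
  assumes N: "N \<lhd> G" and g: "g \<in> carrier G"
  shows "bij_betw (\<lambda>m. g \<otimes> m \<otimes> inv g) N N"
proof -
  interpret N: normal N G by fact
  have "inv g \<otimes> (g \<otimes> m \<otimes> inv g) \<otimes> g = m" "g \<otimes> (inv g \<otimes> m \<otimes> g) \<otimes> inv g = m"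
    if "m \<in> N" for m
  proof -
    have m: "m \<in> carrier G" using that by (rule N.mem_carrier)
    have "inv g \<otimes> (g \<otimes> m \<otimes> inv g) = m \<otimes> inv g"
      using g m by (simp add: m_assoc inv_solve_left')
    thus "inv g \<otimes> (g \<otimes> m \<otimes> inv g) \<otimes> g = m" using g m by (simp add: m_assoc)
    have "g \<otimes> (inv g \<otimes> m \<otimes> g) = m \<otimes> g"
      using g m by (simp add: m_assoc[symmetric])
    thus "g \<otimes> (inv g \<otimes> m \<otimes> g) \<otimes> inv g = m" using g m by (simp add: m_assoc)
  qed
  thus ?thesis
    using N.inv_op_closed1[OF g] N.inv_op_closed2[OF g]
    by (intro bij_betw_byWitness[of _ "\<lambda>m. inv g \<otimes> m \<otimes> g"]) auto
qed

text \<open>This is the overview's e(N), multiplied by \<open>card N\<close>, inside a character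
  value. The sum \<open>P\<close> of the matrices over \<open>N\<close> is a scalar, and its value
  depends only on whether \<open>N\<close> acts trivially.\<close>

lemma sum_normal_subgroup:
  assumes \<rho>: "irreducible_matrix_rep n \<rho>" and N: "N \<lhd> G" and x: "x \<in> carrier G"
  shows "(\<Sum>m\<in>N. mat_trace (\<rho> (x \<otimes> m))) =
    (if \<forall>m\<in>N. \<rho> m = \<rho> \<one> then of_nat (card N) * mat_trace (\<rho> x) else 0)"
proof -
  interpret N: normal N G by fact
  note R = irreducible_matrix_repD[OF \<rho>] note r = matrix_repD[OF R(1)]
  have rN: "\<rho> m \<in> carrier_mat n n" if "m \<in> N" for m using r(1) N.mem_carrier that by blast
  define P where "P = mat_sum n n \<rho> N"
  have P: "P \<in> carrier_mat n n" by (simp add: P_def)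
  have comm: "\<rho> g * P = P * \<rho> g" if g: "g \<in> carrier G" for g
  proof -
    \<comment> \<open>Conjugation by \<open>g\<close> permutes \<open>N\<close>, so \<open>P\<close>
      commutes with the representation.\<close>
    have "P * \<rho> g = mat_sum n n (\<lambda>m. \<rho> (g \<otimes> m \<otimes> inv g)) N * \<rho> g"
      unfolding P_def by (subst mat_sum_reindex[OF bij_betw_conj_normal[OF N g]]) simp
    also have "\<dots> = mat_sum n n (\<lambda>m. \<rho> (g \<otimes> m \<otimes> inv g) * \<rho> g) N"
      by (rule mat_sum_mult) (use r(1) g N.mem_carrier in auto)
    also have "\<dots> = mat_sum n n (\<lambda>m. \<rho> g * \<rho> m) N"
    proof (rule mat_sum_cong)
      fix m assume m: "m \<in> N"
      hence mc: "m \<in> carrier G" by (rule N.mem_carrier)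
      have "g \<otimes> m \<otimes> inv g \<otimes> g = g \<otimes> m" using g mc by (simp add: m_assoc)
      thus "\<rho> (g \<otimes> m \<otimes> inv g) * \<rho> g = \<rho> g * \<rho> m"
        using r(3)[of "g \<otimes> m \<otimes> inv g" g] r(3)[of g m] g mc by simp
    qed
    also have "\<dots> = \<rho> g * P" unfolding P_def by (rule mult_mat_sum[symmetric]) (use r(1) g rN in auto)
    finally show ?thesis ..
  qed
  define c where "c = mat_trace P / of_nat n"
  have Pc: "P = c \<cdot>\<^sub>m 1\<^sub>m n" unfolding c_def by (rule schur_scalar[OF \<rho> P comm])
  have "(\<Sum>m\<in>N. mat_trace (\<rho> (x \<otimes> m))) = (\<Sum>m\<in>N. mat_trace (\<rho> x * \<rho> m))"
    by (rule sum.cong) (use r(3) x N.mem_carrier in auto)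
  also have "\<dots> = mat_trace (mat_sum n n (\<lambda>m. \<rho> x * \<rho> m) N)"
    by (rule mat_trace_mat_sum[symmetric]) (use r(1)[OF x] rN in auto)
  also have "mat_sum n n (\<lambda>m. \<rho> x * \<rho> m) N = \<rho> x * P"
    unfolding P_def by (rule mult_mat_sum[symmetric]) (use r(1)[OF x] rN in auto)
  also have "\<rho> x * P = c \<cdot>\<^sub>m \<rho> x"
    unfolding Pc using r(1)[OF x] by (simp add: mult_smult_distrib[OF r(1)[OF x] one_carrier_mat])
  also have "mat_trace \<dots> = c * mat_trace (\<rho> x)" by (rule mat_trace_smult[OF r(1)[OF x]])
  finally have sum: "(\<Sum>m\<in>N. mat_trace (\<rho> (x \<otimes> m))) = c * mat_trace (\<rho> x)" .
  show ?thesis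
  proof (cases "\<forall>m\<in>N. \<rho> m = \<rho> \<one>")
    case True
    have "mat_trace P = (\<Sum>m\<in>N. mat_trace (\<rho> m))"
      unfolding P_def by (rule mat_trace_mat_sum) (rule rN)
    also have "\<dots> = of_nat (card N) * of_nat n" using True r(2) by (simp add: mat_trace_one)
    finally have "c = of_nat (card N)" using R(2) by (simp add: c_def)
    thus ?thesis unfolding if_P[OF True] sum by simp
  next
    case False
    then obtain k where k: "k \<in> N" "\<rho> k \<noteq> 1\<^sub>m n" using r(2) by auto
    have kc: "k \<in> carrier G" using k N.mem_carrier by blast
    \<comment> \<open>Translation by \<open>k\<close> permutes \<open>N\<close>, so
      \<open>\<rho> k * P = P\<close>. With \<open>P\<close> a scalar and \<open>\<rho> k\<close>
      not the identity, the scalar must be 0.\<close>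
    have b: "bij_betw (\<lambda>m. k \<otimes> m) N N"
      by (rule bij_betw_byWitness[of _ "\<lambda>m. inv k \<otimes> m"])
        (use k kc N.mem_carrier in \<open>auto simp flip: m_assoc\<close>)
    have "\<rho> k * P = mat_sum n n (\<lambda>m. \<rho> k * \<rho> m) N"
      unfolding P_def by (rule mult_mat_sum) (use r(1)[OF kc] rN in auto)
    also have "\<dots> = mat_sum n n (\<lambda>m. \<rho> (k \<otimes> m)) N"
      by (rule mat_sum_cong) (use r(3)[OF kc] N.mem_carrier in auto)
    also have "\<dots> = P" unfolding P_def by (rule mat_sum_reindex[OF b, symmetric])
    finally have "c \<cdot>\<^sub>m \<rho> k = c \<cdot>\<^sub>m 1\<^sub>m n"
      unfolding Pc using r(1)[OF kc] by (simp add: mult_smult_distrib[OF r(1)[OF kc] one_carrier_mat])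
    have "c = 0"
    proof (rule ccontr)
      assume "c \<noteq> 0"
      have "\<rho> k = 1\<^sub>m n"
      proof (rule eq_matI)
        fix i j assume "i < dim_row (1\<^sub>m n :: complex mat)" "j < dim_col (1\<^sub>m n :: complex mat)"
        moreover have "(c \<cdot>\<^sub>m \<rho> k) $$ (i, j) = (c \<cdot>\<^sub>m 1\<^sub>m n) $$ (i, j)"
          using \<open>c \<cdot>\<^sub>m \<rho> k = c \<cdot>\<^sub>m 1\<^sub>m n\<close> by simp
        ultimately show "\<rho> k $$ (i, j) = 1\<^sub>m n $$ (i, j)" using \<open>c \<noteq> 0\<close> r(1)[OF kc] by simp
      qed (use r(1)[OF kc] in auto)
      thus False using k by simp
    qed
    thus ?thesis unfolding if_not_P[OF False] sum by simp
  qed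
qed

text \<open>This takes the place of column orthogonality in the quotient by \<open>N\<close>:
  averaging over the elements \<open>x \<otimes> m\<close> removes exactly the representations on
  which \<open>N\<close> acts nontrivially.\<close>

lemma sum_characters_trivial_on:
  assumes T: "representatives {\<rho>. irreducible_rep G \<rho>} (rep_equivalent G) T"
    and N: "N \<lhd> G" and x: "x \<in> carrier G" and y: "y \<in> carrier G"
  shows "(\<Sum>\<rho>\<in>T. if \<forall>m\<in>N. \<rho> m = \<rho> \<one> then mat_trace (\<rho> x) * cnj (mat_trace (\<rho> y)) else 0) =
    (\<Sum>m\<in>N. of_nat (card {g \<in> carrier G. x \<otimes> m \<otimes> g = g \<otimes> y})) / of_nat (card N)"
proof -
  interpret N: normal N G by fact
  have Tirr: "irreducible_matrix_rep (rep_degree G \<rho>) \<rho>" if "\<rho> \<in> T" for \<rho>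
    using T that by (auto simp: representatives_def irreducible_rep_iff)
  have "finite N" using finite_subset[OF N.subset finite_carrier] .
  hence cN: "(of_nat (card N) :: complex) \<noteq> 0" using N.subgroup_axioms subgroup.one_closed by fastforce
  have "(\<Sum>m\<in>N. of_nat (card {g \<in> carrier G. x \<otimes> m \<otimes> g = g \<otimes> y})) =
    (\<Sum>m\<in>N. \<Sum>\<rho>\<in>T. mat_trace (\<rho> (x \<otimes> m)) * cnj (mat_trace (\<rho> y)))"
    by (rule sum.cong) (use column_orthogonality[OF T _ y] x N.mem_carrier in auto)
  also have "\<dots> = (\<Sum>\<rho>\<in>T. \<Sum>m\<in>N. mat_trace (\<rho> (x \<otimes> m)) * cnj (mat_trace (\<rho> y)))"
    by (rule sum.swap)
  also have "\<dots> = (\<Sum>\<rho>\<in>T. (\<Sum>m\<in>N. mat_trace (\<rho> (x \<otimes> m))) * cnj (mat_trace (\<rho> y)))"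
    by (simp only: sum_distrib_right)
  also have "\<dots> = (\<Sum>\<rho>\<in>T. of_nat (card N) *
      (if \<forall>m\<in>N. \<rho> m = \<rho> \<one> then mat_trace (\<rho> x) * cnj (mat_trace (\<rho> y)) else 0))"
  proof (rule sum.cong[OF refl])
    fix \<rho> assume "\<rho> \<in> T"
    have "(if P then n * a else 0) * b = n * (if P then a * b else 0)" for P and n a b :: complex by simp
    thus "(\<Sum>m\<in>N. mat_trace (\<rho> (x \<otimes> m))) * cnj (mat_trace (\<rho> y)) = of_nat (card N) *
      (if \<forall>m\<in>N. \<rho> m = \<rho> \<one> then mat_trace (\<rho> x) * cnj (mat_trace (\<rho> y)) else 0)"
      unfolding sum_normal_subgroup[OF Tirr[OF \<open>\<rho> \<in> T\<close>] N x] .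
  qed
  also have "\<dots> = of_nat (card N) * (\<Sum>\<rho>\<in>T. if \<forall>m\<in>N. \<rho> m = \<rho> \<one> then mat_trace (\<rho> x) * cnj (mat_trace (\<rho> y)) else 0)"
    by (simp only: sum_distrib_left)
  finally show ?thesis using cN by simp
qed

end

section \<open>Minimal normal subgroups\<close>

lemma mem_set_mult_iff: "x \<in> A <#>\<^bsub>G\<^esub> B \<longleftrightarrow> (\<exists>a\<in>A. \<exists>b\<in>B. x = a \<otimes>\<^bsub>G\<^esub> b)"
  by (auto simp: set_mult_def)

context fin_group begin

lemma normalD:
  assumes "N \<lhd> G"
  shows "N \<subseteq> carrier G" "\<And>x. x \<in> N \<Longrightarrow> x \<in> carrier G" "\<one> \<in> N"
    "\<And>x y. x \<in> N \<Longrightarrow> y \<in> N \<Longrightarrow> x \<otimes> y \<in> N" "\<And>x. x \<in> N \<Longrightarrow> inv x \<in> N"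
    "\<And>x g. x \<in> N \<Longrightarrow> g \<in> carrier G \<Longrightarrow> g \<otimes> x \<otimes> inv g \<in> N"
    "\<And>x g. x \<in> N \<Longrightarrow> g \<in> carrier G \<Longrightarrow> inv g \<otimes> x \<otimes> g \<in> N"
    "finite N" "subgroup N G"
proof -
  interpret normal N G by fact
  show "N \<subseteq> carrier G" "\<And>x. x \<in> N \<Longrightarrow> x \<in> carrier G" "\<one> \<in> N"
    "\<And>x y. x \<in> N \<Longrightarrow> y \<in> N \<Longrightarrow> x \<otimes> y \<in> N" "\<And>x. x \<in> N \<Longrightarrow> inv x \<in> N"
    "\<And>x g. x \<in> N \<Longrightarrow> g \<in> carrier G \<Longrightarrow> g \<otimes> x \<otimes> inv g \<in> N"
    "\<And>x g. x \<in> N \<Longrightarrow> g \<in> carrier G \<Longrightarrow> inv g \<otimes> x \<otimes> g \<in> N" "subgroup N G"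
    using subset mem_carrier subgroup_axioms subgroup.one_closed[OF subgroup_axioms] inv_op_closed1 inv_op_closed2 by auto
  show "finite N" using finite_subset[OF subset finite_carrier] .
qed

lemma normalI_closed:
  assumes "N \<subseteq> carrier G" "\<one> \<in> N" "\<And>x y. x \<in> N \<Longrightarrow> y \<in> N \<Longrightarrow> x \<otimes> y \<in> N"
    "\<And>x. x \<in> N \<Longrightarrow> inv x \<in> N" "\<And>x g. x \<in> N \<Longrightarrow> g \<in> carrier G \<Longrightarrow> g \<otimes> x \<otimes> inv g \<in> N"
  shows "N \<lhd> G"
  unfolding normal_inv_iff using assms by (auto intro!: subgroup.intro)

lemma card_normal_pos: "N \<lhd> G \<Longrightarrow> card N > 0"
  using normalD(3,8) card_gt_0_iff by blast

lemma conj_mult: "x \<in> carrier G \<Longrightarrow> y \<in> carrier G \<Longrightarrow> g \<in> carrier G \<Longrightarrow>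
    g \<otimes> (x \<otimes> y) \<otimes> inv g = (g \<otimes> x \<otimes> inv g) \<otimes> (g \<otimes> y \<otimes> inv g)"
  by (simp add: m_assoc inv_solve_left' r_inv flip: m_assoc) (simp add: m_assoc)

lemma conj_mult': "x \<in> carrier G \<Longrightarrow> y \<in> carrier G \<Longrightarrow> g \<in> carrier G \<Longrightarrow>
    inv g \<otimes> (x \<otimes> y) \<otimes> g = (inv g \<otimes> x \<otimes> g) \<otimes> (inv g \<otimes> y \<otimes> g)"
  using conj_mult[of x y "inv g"] by simp

text \<open>The commutator of \<open>a\<close> and \<open>b\<close> lies in both subgroups.\<close>

lemma normal_commute:
  assumes A: "A \<lhd> G" and B: "B \<lhd> G" and AB: "A \<inter> B = {\<one>}" and a: "a \<in> A" and b: "b \<in> B"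
  shows "a \<otimes> b = b \<otimes> a"
proof -
  note nA = normalD[OF A] and nB = normalD[OF B]
  have c: "a \<in> carrier G" "b \<in> carrier G" using a b nA nB by auto
  have "a \<otimes> b \<otimes> inv a \<otimes> inv b \<in> B" using nB(4)[OF nB(6)[OF b c(1)] nB(5)[OF b]] .
  moreover have "a \<otimes> (b \<otimes> inv a \<otimes> inv b) \<in> A" using nA(4)[OF a nA(6)[OF nA(5)[OF a] c(2)]] .
  moreover have "a \<otimes> (b \<otimes> inv a \<otimes> inv b) = a \<otimes> b \<otimes> inv a \<otimes> inv b" using c by (simp add: m_assoc)
  ultimately have "a \<otimes> b \<otimes> inv a \<otimes> inv b = \<one>" using AB by auto
  moreover have "a \<otimes> b \<otimes> inv a \<otimes> inv b = (a \<otimes> b) \<otimes> inv (b \<otimes> a)"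
    using c by (simp add: m_assoc inv_mult_group)
  ultimately show ?thesis using inv_solve_right'[of \<one> "a \<otimes> b" "b \<otimes> a"] c by simp
qed

lemma normal_set_mult:
  assumes A: "A \<lhd> G" and B: "B \<lhd> G"
  shows "A <#> B \<lhd> G"
proof (rule normalI_closed)
  note nA = normalD[OF A] and nB = normalD[OF B]
  show "A <#> B \<subseteq> carrier G" using nA(2) nB(2) by (auto simp: mem_set_mult_iff)
  show "\<one> \<in> A <#> B" unfolding mem_set_mult_iff using nA(3) nB(3) by (intro bexI[of _ \<one>]) auto
  fix x assume "x \<in> A <#> B"
  then obtain a b where x: "x = a \<otimes> b" and ab: "a \<in> A" "b \<in> B" by (auto simp: mem_set_mult_iff)
  have c: "a \<in> carrier G" "b \<in> carrier G" using ab nA nB by auto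
  have "inv x = (inv b \<otimes> inv a \<otimes> b) \<otimes> inv b" using c by (simp add: x m_assoc inv_mult_group)
  thus "inv x \<in> A <#> B"
    unfolding mem_set_mult_iff using nA(7)[OF nA(5)[OF ab(1)] c(2)] nB(5)[OF ab(2)] by blast
  {
    fix g assume g: "g \<in> carrier G"
    have "g \<otimes> x \<otimes> inv g = (g \<otimes> a \<otimes> inv g) \<otimes> (g \<otimes> b \<otimes> inv g)"
      unfolding x by (rule conj_mult[OF c g])
    thus "g \<otimes> x \<otimes> inv g \<in> A <#> B"
      unfolding mem_set_mult_iff using nA(6)[OF ab(1) g] nB(6)[OF ab(2) g] by blast
  }
  fix y assume "y \<in> A <#> B"
  then obtain a' b' where y: "y = a' \<otimes> b'" and ab': "a' \<in> A" "b' \<in> B" by (auto simp: mem_set_mult_iff)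
  have c': "a' \<in> carrier G" "b' \<in> carrier G" using ab' nA nB by auto
  have "b \<otimes> a' = (b \<otimes> a' \<otimes> inv b) \<otimes> b" using c c' by (simp add: m_assoc)
  hence "x \<otimes> y = (a \<otimes> (b \<otimes> a' \<otimes> inv b)) \<otimes> (b \<otimes> b')"
    unfolding x y using c c' by (metis m_assoc m_closed inv_closed)
  thus "x \<otimes> y \<in> A <#> B"
    unfolding mem_set_mult_iff
    using nA(4)[OF ab(1) nA(6)[OF ab'(1) c(2)]] nB(4)[OF ab(2) ab'(2)] by blast
qed

lemma set_mult_upper:
  assumes A: "A \<lhd> G" and B: "B \<lhd> G"
  shows "A \<subseteq> A <#> B" "B \<subseteq> A <#> B"
proof -
  note nA = normalD[OF A] and nB = normalD[OF B]
  show "A \<subseteq> A <#> B" "B \<subseteq> A <#> B"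
    using nA(2,3) nB(2,3) r_one l_one by (force simp: mem_set_mult_iff)+
qed

lemma set_mult_least:
  assumes "C \<lhd> G" "A \<subseteq> C" "B \<subseteq> C"
  shows "A <#> B \<subseteq> C"
  using normalD(4)[OF assms(1)] assms(2,3) unfolding mem_set_mult_iff subset_iff by blast

lemma disjoint_normal_factors_unique:
  assumes A: "A \<lhd> G" and B: "B \<lhd> G" and AB: "A \<inter> B = {\<one>}"
    and h: "a \<in> A" "a' \<in> A" "b \<in> B" "b' \<in> B" and e: "a \<otimes> b = a' \<otimes> b'"
  shows "a = a' \<and> b = b'"
proof -
  note c = normalD(2)[OF A h(1)] normalD(2)[OF A h(2)] normalD(2)[OF B h(3)] normalD(2)[OF B h(4)]
  have "inv a' \<otimes> (a \<otimes> b) = b'" using e c by (simp flip: m_assoc)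
  hence "inv a' \<otimes> a = b' \<otimes> inv b" using c by (simp add: inv_solve_right m_assoc)
  hence "inv a' \<otimes> a \<in> A \<inter> B"
    using normalD(4)[OF A normalD(5)[OF A h(2)] h(1)] normalD(4)[OF B h(4) normalD(5)[OF B h(3)]] by simp
  hence "inv a' \<otimes> a = \<one>" using AB by auto
  hence "a = a'" using c inv_solve_left'[of \<one> a' a] by simp
  thus ?thesis using e c by simp
qed

lemma card_set_mult:
  assumes A: "A \<lhd> G" and B: "B \<lhd> G" and AB: "A \<inter> B = {\<one>}"
  shows "card (A <#> B) = card A * card B"
proof -
  have "inj_on (\<lambda>(a, b). a \<otimes> b) (A \<times> B)"
  proof (rule inj_onI, clarify)
    fix a b a' b' assume "a \<in> A" "b \<in> B" "a' \<in> A" "b' \<in> B" "a \<otimes> b = a' \<otimes> b'"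
    thus "a = a' \<and> b = b'" using disjoint_normal_factors_unique[OF A B AB] by blast
  qed
  moreover have "(\<lambda>(a, b). a \<otimes> b) ` (A \<times> B) = A <#> B" by (auto simp: set_mult_def)
  ultimately show ?thesis by (metis card_image card_cartesian_product)
qed

lemma min_normalD:
  assumes "min_normal G N"
  shows "N \<lhd> G" "N \<noteq> {\<one>}" "\<And>K. K \<lhd> G \<Longrightarrow> K \<subseteq> N \<Longrightarrow> K \<noteq> {\<one>} \<Longrightarrow> K = N"
  using assms by (auto simp: min_normal_def)

lemma card_min_normal_gt_one:
  assumes "min_normal G A"
  shows "card A > 1"
proof -
  note nA = normalD[OF min_normalD(1)[OF assms]]
  obtain x where x: "x \<in> A" "x \<noteq> \<one>" using min_normalD(2)[OF assms] nA(3) by blast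
  have "card {x, \<one>} \<le> card A" using nA(3,8) x by (intro card_mono) auto
  thus ?thesis using x by simp
qed

text \<open>This dichotomy makes the product with a minimal normal subgroup outside \<open>L\<close>
  direct, which is why orders multiply whenever one is adjoined.\<close>

lemma min_normal_inter:
  assumes N: "min_normal G N" and L: "L \<lhd> G" and "\<not> N \<subseteq> L"
  shows "N \<inter> L = {\<one>}" "L \<inter> N = {\<one>}"
proof -
  have "N \<inter> L \<lhd> G" by (rule normal_subgroup_intersect[OF min_normalD(1)[OF N] L])
  thus "N \<inter> L = {\<one>}" using min_normalD(3)[OF N, of "N \<inter> L"] assms(3) by blast
  thus "L \<inter> N = {\<one>}" by blast
qed

lemma exists_min_normal:
  assumes "K \<lhd> G" "K \<noteq> {\<one>}"
  shows "\<exists>N. min_normal G N \<and> N \<subseteq> K"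
  using assms
proof (induction "card K" arbitrary: K rule: less_induct)
  case less
  show ?case
  proof (cases "min_normal G K")
    case False
    then obtain K' where K': "K' \<lhd> G" "K' \<subseteq> K" "K' \<noteq> {\<one>}" "K' \<noteq> K"
      using less.prems by (auto simp: min_normal_def)
    hence "card K' < card K" using normalD(8)[OF less.prems(1)] by (intro psubset_card_mono) auto
    thus ?thesis using less.hyps[OF _ K'(1,3)] K'(2) by blast
  qed auto
qed

section \<open>Joins of minimal normal subgroups\<close>

definition mins :: "'a set \<Rightarrow> 'a set set" where
  "mins L = {N. min_normal G N \<and> N \<subseteq> L}"

definition join :: "'a set set \<Rightarrow> 'a set" where
  "join T = generate G (\<Union>T)"

lemma finite_mins: "finite (mins L)"
proof (rule finite_subset)
  show "mins L \<subseteq> Pow (carrier G)" using normalD(1) min_normalD(1) by (auto simp: mins_def)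
qed simp

lemma normal_join:
  assumes "\<And>N. N \<in> T \<Longrightarrow> N \<lhd> G"
  shows "join T \<lhd> G"
  unfolding join_def by (rule normal_generateI) (use assms normalD(2,6) in blast)+

lemma join_least:
  assumes "C \<lhd> G" "\<And>N. N \<in> T \<Longrightarrow> N \<subseteq> C"
  shows "join T \<subseteq> C"
  unfolding join_def by (rule generate_subgroup_incl) (use assms normalD(9) in auto)

lemma join_upper: "N \<in> T \<Longrightarrow> N \<subseteq> join T"
  unfolding join_def using generate.incl[of _ "\<Union>T" G] by blast

lemma join_empty: "join {} = {\<one>}"
  by (simp add: join_def generate_empty)

lemma join_Un:
  assumes T: "\<And>N. N \<in> T \<Longrightarrow> N \<lhd> G" and U: "\<And>N. N \<in> U \<Longrightarrow> N \<lhd> G"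
  shows "join (T \<union> U) = join T <#> join U"
proof
  have n: "join T \<lhd> G" "join U \<lhd> G" using normal_join T U by blast+
  note set_mult_upper[OF n]
  thus "join (T \<union> U) \<subseteq> join T <#> join U"
    using join_upper[of _ T] join_upper[of _ U] by (intro join_least normal_set_mult n) blast
  have TU: "join (T \<union> U) \<lhd> G" by (rule normal_join) (use T U in auto)
  show "join T <#> join U \<subseteq> join (T \<union> U)"
    using join_upper[of _ "T \<union> U"] by (intro set_mult_least TU join_least) blast+
qed

lemma join_singleton:
  assumes "N \<lhd> G"
  shows "join {N} = N"
  using join_least[OF assms, of "{N}"] join_upper[of N "{N}"] by auto

text \<open>A member already contained in the join of the previous ones changes nothing, so the step
  has to treat only direct products \<open>L <#> A\<close>. It serves both for the socle and for
  homogeneous components.\<close>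

lemma join_induct:
  assumes fin: "finite T" and T: "\<And>N. N \<in> T \<Longrightarrow> min_normal G N"
    and P1: "P {\<one>}"
    and PS: "\<And>L A. P L \<Longrightarrow> L \<lhd> G \<Longrightarrow> A \<in> T \<Longrightarrow> \<not> A \<subseteq> L \<Longrightarrow> P (L <#> A)"
  shows "P (join T)"
proof -
  have "P (join U)" if "finite U" "U \<subseteq> T" for U
    using that
  proof (induction U rule: finite_induct)
    case empty
    thus ?case using P1 by (simp add: join_empty)
  next
    case (insert A U)
    have U: "\<And>N. N \<in> U \<Longrightarrow> N \<lhd> G" and A: "A \<lhd> G" "A \<in> T" using insert.prems T min_normalD(1) by auto
    have "join (U \<union> {A}) = join U <#> join {A}" by (rule join_Un[OF U]) (use A in auto)
    hence j: "join (insert A U) = join U <#> A" using join_singleton[OF A(1)] by simp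
    show ?case
    proof (cases "A \<subseteq> join U")
      case True
      hence "join U <#> A = join U"
        using set_mult_least[OF normal_join[OF U] order_refl True] set_mult_upper[OF normal_join[OF U] A(1)] by blast
      thus ?thesis using j insert by simp
    next
      case False
      thus ?thesis using j PS[OF _ normal_join[OF U] A(2) False] insert by simp
    qed
  qed
  thus ?thesis using fin by blast
qed

end

section \<open>The alternating sum over sets of minimal normal subgroups\<close>

lemma sum_Pow_Un:
  fixes F :: "'b set \<Rightarrow> 'c::comm_monoid_add"
  assumes "finite X" "finite Y" "X \<inter> Y = {}"
  shows "(\<Sum>T\<in>Pow (X \<union> Y). F T) = (\<Sum>U\<in>Pow Y. \<Sum>T\<in>Pow X. F (T \<union> U))"
proof -
  have "bij_betw (\<lambda>(U, T). T \<union> U) (Pow Y \<times> Pow X) (Pow (X \<union> Y))"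
    by (rule bij_betw_byWitness[of _ "\<lambda>Z. (Z \<inter> Y, Z \<inter> X)"]) (use assms(3) in auto)
  hence "(\<Sum>T\<in>Pow (X \<union> Y). F T) = (\<Sum>p\<in>Pow Y \<times> Pow X. F (case p of (U, T) \<Rightarrow> T \<union> U))"
    using sum.reindex_bij_betw[of "\<lambda>(U, T). T \<union> U" _ _ F] by simp
  also have "\<dots> = (\<Sum>U\<in>Pow Y. \<Sum>T\<in>Pow X. F (T \<union> U))"
    by (simp add: sum.cartesian_product split_def)
  finally show ?thesis .
qed

text \<open>Inserting or removing \<open>x\<close> is a sign-reversing involution on the subsets of
  \<open>X\<close>.\<close>

lemma alternating_sum_Pow_eq_zero:
  fixes g :: "'b set \<Rightarrow> 'c::comm_ring_1"
  assumes X: "finite X" "x \<in> X" and g: "\<And>T. T \<subseteq> X \<Longrightarrow> x \<notin> T \<Longrightarrow> g (insert x T) = g T"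
  shows "(\<Sum>T\<in>Pow X. (-1) ^ card T * g T) = 0"
proof -
  define Y where "Y = X - {x}"
  have XY: "X = insert x Y" "x \<notin> Y" "finite Y" using X by (auto simp: Y_def)
  have "(\<Sum>T\<in>Pow X. (-1) ^ card T * g T) =
    (\<Sum>T\<in>Pow Y. (-1) ^ card T * g T) + (\<Sum>T\<in>insert x ` Pow Y. (-1) ^ card T * g T)"
    unfolding XY(1) Pow_insert by (rule sum.union_disjoint) (use XY in auto)
  also have "(\<Sum>T\<in>insert x ` Pow Y. (-1) ^ card T * g T) = (\<Sum>T\<in>Pow Y. (-1) ^ card (insert x T) * g (insert x T))"
    using XY by (subst sum.reindex) (auto simp: inj_on_def)
  also have "\<dots> = (\<Sum>T\<in>Pow Y. - ((-1) ^ card T * g T))"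
  proof (rule sum.cong[OF refl])
    fix T assume "T \<in> Pow Y"
    hence "x \<notin> T" "finite T" "T \<subseteq> X" using XY finite_subset by auto
    thus "(-1) ^ card (insert x T) * g (insert x T) = - ((-1) ^ card T * g T)" using g by simp
  qed
  finally show ?thesis by (simp add: sum_negf)
qed

context fin_group begin

text \<open>The overview's f. For normal \<open>L\<close>, grouping the sets by their join shows
  that it is the sum of mu(1, K) / |K| over the normal subgroups K of the whole group inside
  \<open>L\<close>, where mu is the Moebius function of the lattice of normal subgroups.\<close>

definition alt_sum :: "'a set \<Rightarrow> complex" where
  "alt_sum L = (\<Sum>T\<in>Pow (mins L). (-1) ^ card T / of_nat (card (join T)))"

text \<open>If \<open>L <#> N\<close> did not contain \<open>A\<close>, then
  \<open>(L <#> N) <#> A\<close> would be a direct product inside \<open>L <#> A\<close> of order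
  \<open>card L * card N * card A\<close>, which forces \<open>N\<close> to be trivial.\<close>

lemma complement_min_normal:
  assumes L: "L \<lhd> G" and A: "min_normal G A" "\<not> A \<subseteq> L"
    and N: "min_normal G N" "N \<subseteq> L <#> A" "\<not> N \<subseteq> L"
  shows "L <#> N = L <#> A" "card N = card A"
proof -
  note nA = min_normalD[OF A(1)] and nN = min_normalD[OF N(1)]
  have H: "L <#> A \<lhd> G" by (rule normal_set_mult[OF L nA(1)])
  have LN: "L <#> N \<lhd> G" by (rule normal_set_mult[OF L nN(1)])
  have LNH: "L <#> N \<subseteq> L <#> A" by (rule set_mult_least[OF H set_mult_upper(1)[OF L nA(1)] N(2)])
  have cA: "card (L <#> A) = card L * card A"
    by (rule card_set_mult[OF L nA(1) min_normal_inter(2)[OF A(1) L A(2)]])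
  have cN: "card (L <#> N) = card L * card N"
    by (rule card_set_mult[OF L nN(1) min_normal_inter(2)[OF N(1) L N(3)]])
  have "A \<subseteq> L <#> N"
  proof (rule ccontr)
    assume n: "\<not> A \<subseteq> L <#> N"
    have "card ((L <#> N) <#> A) = card (L <#> N) * card A"
      by (rule card_set_mult[OF LN nA(1) min_normal_inter(2)[OF A(1) LN n]])
    moreover have "(L <#> N) <#> A \<subseteq> L <#> A"
      by (rule set_mult_least[OF H LNH set_mult_upper(2)[OF L nA(1)]])
    hence "card ((L <#> N) <#> A) \<le> card (L <#> A)" by (rule card_mono[OF normalD(8)[OF H]])
    ultimately have "card L * card A * card N \<le> card L * card A" using cA cN by (simp add: ac_simps)
    hence "card N \<le> 1" using card_normal_pos[OF L] card_normal_pos[OF nA(1)] by simp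
    hence "card N = 1" using card_normal_pos[OF nN(1)] by simp
    hence "N = {\<one>}" using normalD(3)[OF nN(1)] by (auto simp: card_1_singleton_iff)
    thus False using nN(2) by simp
  qed
  hence "L <#> A \<subseteq> L <#> N" by (rule set_mult_least[OF LN set_mult_upper(1)[OF L nN(1)]])
  thus "L <#> N = L <#> A" using LNH by blast
  thus "card N = card A" using cA cN card_normal_pos[OF L] by simp
qed

text \<open>Pick \<open>x\<close> in \<open>N\<close> but not in \<open>N'\<close> and factor it as
  \<open>l \<otimes> y\<close> with \<open>l\<close> in \<open>L\<close> and \<open>y\<close> in
  \<open>N'\<close>. Then \<open>l = x \<otimes> inv y\<close> is a nontrivial element of the normal
  subgroup \<open>L \<inter> (N <#> N')\<close>.\<close>

lemma min_normal_in_join_of_two: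
  assumes L: "L \<lhd> G" and A: "min_normal G A" "\<not> A \<subseteq> L"
    and N: "min_normal G N" "N \<subseteq> L <#> A" "\<not> N \<subseteq> L"
    and N': "min_normal G N'" "N' \<subseteq> L <#> A" "\<not> N' \<subseteq> L" "N \<noteq> N'"
  shows "\<exists>N0\<in>mins L. N0 \<subseteq> N <#> N'"
proof -
  note nN = min_normalD[OF N(1)] and nN' = min_normalD[OF N'(1)]
  have "\<not> N \<subseteq> N'" using nN'(3)[OF nN(1) _ nN(2)] N'(4) by blast
  then obtain x where x: "x \<in> N" "x \<notin> N'" by blast
  have "x \<in> L <#> N'" using x N(2) complement_min_normal(1)[OF L A N'(1-3)] by blast
  then obtain l y where ly: "l \<in> L" "y \<in> N'" "x = l \<otimes> y" by (auto simp: mem_set_mult_iff)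
  have c: "l \<in> carrier G" "y \<in> carrier G" using ly normalD(2) L nN'(1) by auto
  have "l = x \<otimes> inv y" using ly(3) c by (simp add: m_assoc)
  hence l: "l \<in> L \<inter> (N <#> N')"
    using ly(1) x(1) normalD(5)[OF nN'(1) ly(2)] by (auto simp: mem_set_mult_iff)
  have "l \<noteq> \<one>" using x(2) ly c by auto
  hence "L \<inter> (N <#> N') \<noteq> {\<one>}" using l by blast
  moreover have "L \<inter> (N <#> N') \<lhd> G"
    by (rule normal_subgroup_intersect[OF L normal_set_mult[OF nN(1) nN'(1)]])
  ultimately obtain N0 where "min_normal G N0" "N0 \<subseteq> L \<inter> (N <#> N')" using exists_min_normal by blast
  thus ?thesis by (auto simp: mins_def)
qed

text \<open>Among the subsets of the minimal normal subgroups of \<open>L <#> A\<close>, those containing two members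
  outside \<open>L\<close> cancel in pairs: their join contains a fixed minimal normal subgroup of \<open>L\<close>,
  which may be added or removed.\<close>

lemma alt_sum_step:
  assumes L: "L \<lhd> G" and A: "min_normal G A" "\<not> A \<subseteq> L"
  shows "alt_sum (L <#> A) =
    alt_sum L * (1 - of_nat (card (mins (L <#> A) - mins L)) / of_nat (card A))"
proof -
  note nA = min_normalD[OF A(1)]
  define K where "K = mins (L <#> A) - mins L"
  have KI: "min_normal G N" "N \<subseteq> L <#> A" "\<not> N \<subseteq> L" if "N \<in> K" for N
    using that by (auto simp: K_def mins_def)
  have fK: "finite K" by (simp add: K_def finite_mins)
  have un: "mins (L <#> A) = mins L \<union> K" "mins L \<inter> K = {}"
    using set_mult_upper(1)[OF L nA(1)] by (auto simp: K_def mins_def)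
  have normL: "N \<lhd> G" if "N \<in> mins L" for N using that min_normalD(1) by (auto simp: mins_def)
  \<comment> \<open>The contribution of the sets whose members outside \<open>L\<close> are exactly
    those of \<open>U\<close>.\<close>
  define h where "h = (\<lambda>U. \<Sum>T\<in>Pow (mins L). (-1) ^ card (T \<union> U) / of_nat (card (join (T \<union> U))) :: complex)"
  have h0: "h {} = alt_sum L" by (simp add: h_def alt_sum_def)
  \<comment> \<open>One member \<open>N\<close> outside \<open>L\<close> changes the sign and
    multiplies the order of the join by \<open>card A\<close>: \<open>N\<close> has the order of
    \<open>A\<close> and meets \<open>join T\<close>, a subgroup of \<open>L\<close>,
    trivially.\<close>
  have h1: "h {N} = - alt_sum L / of_nat (card A)" if N: "N \<in> K" for N
  proof -
    note nN = min_normalD[OF KI(1)[OF N]]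
    have "(-1) ^ card (T \<union> {N}) / of_nat (card (join (T \<union> {N}))) =
      - ((-1) ^ card T / of_nat (card (join T))) / (of_nat (card A) :: complex)" if T: "T \<in> Pow (mins L)" for T
    proof -
      have nT: "M \<lhd> G" if "M \<in> T" for M using that T normL by blast
      have jT: "join T \<lhd> G" by (rule normal_join[OF nT])
      have jL: "join T \<subseteq> L" by (rule join_least[OF L]) (use T in \<open>auto simp: mins_def\<close>)
      have "join (T \<union> {N}) = join T <#> N" using join_Un[of T "{N}", OF nT] nN(1) join_singleton[OF nN(1)] by simp
      moreover have "\<not> N \<subseteq> join T" using jL KI(3)[OF N] by blast
      ultimately have "card (join (T \<union> {N})) = card (join T) * card A"
        using card_set_mult[OF jT nN(1) min_normal_inter(2)[OF KI(1)[OF N] jT]]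
          complement_min_normal(2)[OF L A KI[OF N]] by simp
      moreover have "card (T \<union> {N}) = Suc (card T)"
        using T KI(3)[OF N] finite_subset[OF _ finite_mins] by (subst card_Un_disjoint) (auto simp: mins_def)
      ultimately show ?thesis by simp
    qed
    thus ?thesis by (simp add: h_def alt_sum_def sum_negf sum_divide_distrib)
  qed
  have h2: "h U = 0" if U: "U \<subseteq> K" and ne: "U \<noteq> {}" "\<not> (\<exists>N\<in>K. U = {N})" for U
  proof -
    obtain N where N: "N \<in> U" using ne by blast
    then obtain N' where N': "N' \<in> U" "N \<noteq> N'" using ne U by blast
    obtain N0 where N0: "N0 \<in> mins L" "N0 \<subseteq> N <#> N'"
      using min_normal_in_join_of_two[OF L A KI[of N] KI[of N'] N'(2)] N N' U by blast
    have nU: "M \<lhd> G" if "M \<in> U" for M using that U KI(1) min_normalD(1) by blast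
    have "N0 \<subseteq> join U"
      using N0(2) set_mult_least[OF normal_join[OF nU] join_upper[OF N] join_upper[OF N'(1)]] by blast
    have fU: "finite U" using U fK finite_subset by blast
    have "h U = (\<Sum>T\<in>Pow (mins L). (-1) ^ card T * ((-1) ^ card U / of_nat (card (join (T \<union> U)))))"
      unfolding h_def
    proof (rule sum.cong[OF refl])
      fix T assume T: "T \<in> Pow (mins L)"
      have "card (T \<union> U) = card T + card U"
        using T U fU un(2) finite_subset[OF _ finite_mins] by (intro card_Un_disjoint) auto
      thus "(-1) ^ card (T \<union> U) / of_nat (card (join (T \<union> U))) =
        (-1) ^ card T * ((-1) ^ card U / of_nat (card (join (T \<union> U))) :: complex)" by (simp add: power_add)
    qed
    also have "\<dots> = 0"
    proof (rule alternating_sum_Pow_eq_zero[OF finite_mins N0(1)])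
      fix T assume T: "T \<subseteq> mins L"
      have nTU: "M \<lhd> G" if "M \<in> insert N0 T \<union> U" for M using that T normL nU N0(1) by blast
      have "join (insert N0 T \<union> U) \<subseteq> join (T \<union> U)"
      proof (rule join_least)
        show "join (T \<union> U) \<lhd> G" by (rule normal_join) (use nTU in blast)
        have "N0 \<subseteq> join (T \<union> U)" using \<open>N0 \<subseteq> join U\<close> mono_generate[of "\<Union>U" "\<Union>(T \<union> U)"] by (auto simp: join_def)
        thus "M \<subseteq> join (T \<union> U)" if "M \<in> insert N0 T \<union> U" for M
          using that join_upper[of M "T \<union> U"] by blast
      qed
      moreover have "join (T \<union> U) \<subseteq> join (insert N0 T \<union> U)"
        unfolding join_def by (rule mono_generate) blast
      ultimately show "(-1) ^ card U / of_nat (card (join (insert N0 T \<union> U))) =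
        ((-1) ^ card U / of_nat (card (join (T \<union> U))) :: complex)" by (metis subset_antisym)
    qed
    finally show ?thesis .
  qed
  have "alt_sum (L <#> A) = (\<Sum>U\<in>Pow K. h U)"
    unfolding alt_sum_def un(1) h_def by (rule sum_Pow_Un[OF finite_mins fK un(2)])
  also have "\<dots> = (\<Sum>U\<in>insert {} ((\<lambda>N. {N}) ` K). h U)"
    by (rule sum.mono_neutral_right) (use fK h2 in auto)
  also have "\<dots> = h {} + (\<Sum>U\<in>(\<lambda>N. {N}) ` K. h U)"
    by (rule sum.insert) (use fK in auto)
  also have "(\<Sum>U\<in>(\<lambda>N. {N}) ` K. h U) = (\<Sum>N\<in>K. h {N})"
    by (subst sum.reindex) (auto simp: inj_on_def)
  also have "\<dots> = of_nat (card K) * (- alt_sum L / of_nat (card A))" using h1 by simp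
  finally show ?thesis unfolding h0 K_def[symmetric] by (simp add: algebra_simps)
qed

lemma alt_sum_one: "alt_sum {\<one>} = 1"
proof -
  have "mins {\<one>} = {}"
  proof (rule ccontr)
    assume "mins {\<one>} \<noteq> {}"
    then obtain N where "min_normal G N" "N \<subseteq> {\<one>}" by (auto simp: mins_def)
    moreover from this have "\<one> \<in> N" using normalD(3) min_normalD(1) by blast
    ultimately show False using min_normalD(2)[of N] by blast
  qed
  thus ?thesis by (simp add: alt_sum_def join_empty)
qed

end

section \<open>Counting equivariant homomorphisms\<close>

context fin_group begin

lemma G_hom_iff:
  "\<phi> \<in> G_hom G A L \<longleftrightarrow> \<phi> \<in> extensional A \<and> (\<forall>a\<in>A. \<phi> a \<in> L) \<and>
    (\<forall>a\<in>A. \<forall>b\<in>A. \<phi> (a \<otimes> b) = \<phi> a \<otimes> \<phi> b) \<and>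
    (\<forall>g\<in>carrier G. \<forall>a\<in>A. \<phi> (inv g \<otimes> a \<otimes> g) = inv g \<otimes> \<phi> a \<otimes> g)"
  by (auto simp: G_hom_def hom_def G_equivariant_def)

lemma G_homI:
  assumes "\<phi> \<in> extensional A" "\<And>a. a \<in> A \<Longrightarrow> \<phi> a \<in> L"
    "\<And>a b. a \<in> A \<Longrightarrow> b \<in> A \<Longrightarrow> \<phi> (a \<otimes> b) = \<phi> a \<otimes> \<phi> b"
    "\<And>g a. g \<in> carrier G \<Longrightarrow> a \<in> A \<Longrightarrow> \<phi> (inv g \<otimes> a \<otimes> g) = inv g \<otimes> \<phi> a \<otimes> g"
  shows "\<phi> \<in> G_hom G A L"
  using assms by (simp add: G_hom_iff)

lemma G_homD:
  assumes "\<phi> \<in> G_hom G A L"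
  shows "\<phi> \<in> extensional A" "\<And>a. a \<in> A \<Longrightarrow> \<phi> a \<in> L"
    "\<And>a b. a \<in> A \<Longrightarrow> b \<in> A \<Longrightarrow> \<phi> (a \<otimes> b) = \<phi> a \<otimes> \<phi> b"
    "\<And>g a. g \<in> carrier G \<Longrightarrow> a \<in> A \<Longrightarrow> \<phi> (inv g \<otimes> a \<otimes> g) = inv g \<otimes> \<phi> a \<otimes> g"
  using assms by (auto simp: G_hom_iff)

lemma G_hom_facts:
  assumes A: "A \<lhd> G" and L: "L \<lhd> G" and \<phi>: "\<phi> \<in> G_hom G A L"
  shows "\<phi> \<one> = \<one>" "\<And>a. a \<in> A \<Longrightarrow> \<phi> (inv a) = inv (\<phi> a)"
    "\<And>g a. g \<in> carrier G \<Longrightarrow> a \<in> A \<Longrightarrow> \<phi> (g \<otimes> a \<otimes> inv g) = g \<otimes> \<phi> a \<otimes> inv g"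
proof -
  note h = G_homD[OF \<phi>] and nA = normalD[OF A] and nL = normalD[OF L]
  have c: "\<phi> a \<in> carrier G" if "a \<in> A" for a using h(2)[OF that] nL(2) by blast
  have "\<phi> \<one> = \<phi> \<one> \<otimes> \<phi> \<one>" using h(3)[OF nA(3) nA(3)] by simp
  thus one: "\<phi> \<one> = \<one>" using c[OF nA(3)] by simp
  show "\<phi> (inv a) = inv (\<phi> a)" if a: "a \<in> A" for a
  proof -
    have "\<phi> (inv a) \<otimes> \<phi> a = \<one>" using h(3)[OF nA(5)[OF a] a] nA(2)[OF a] one by simp
    thus ?thesis using inv_equality[of "\<phi> (inv a)" "\<phi> a"] c[OF a] c[OF nA(5)[OF a]] by simp
  qed
  show "\<phi> (g \<otimes> a \<otimes> inv g) = g \<otimes> \<phi> a \<otimes> inv g" if "g \<in> carrier G" "a \<in> A" for g a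
    using h(4)[of "inv g" a] that by simp
qed

text \<open>Extensionality places these maps among the finitely many functions from \<open>A\<close>
  to \<open>L\<close>.\<close>

lemma finite_G_hom:
  assumes "A \<lhd> G" "L \<lhd> G"
  shows "finite (G_hom G A L)"
proof (rule finite_subset)
  show "G_hom G A L \<subseteq> (\<Pi>\<^sub>E a\<in>A. L)" by (auto simp: PiE_iff G_hom_iff extensional_def)
  show "finite (\<Pi>\<^sub>E a\<in>A. L)" using normalD(8) assms by (intro finite_PiE) auto
qed

lemma trivial_G_hom: "L \<lhd> G \<Longrightarrow> A \<lhd> G \<Longrightarrow> (\<lambda>a\<in>A. \<one>) \<in> G_hom G A L"
  by (rule G_homI) (use normalD(3,4,7) in auto)

text \<open>Since \<open>A\<close> and \<open>L\<close> commute elementwise,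
  \<open>a \<otimes> \<phi> a\<close> is multiplicative in \<open>a\<close>; equivariance makes its
  image normal. An element of the graph lying in \<open>L\<close> has its \<open>A\<close>-part in
  \<open>A \<inter> L\<close>, so it is \<open>\<one>\<close>.\<close>

lemma G_hom_graph_normal:
  assumes A: "A \<lhd> G" and L: "L \<lhd> G" and AL: "A \<inter> L = {\<one>}" and \<phi>: "\<phi> \<in> G_hom G A L"
  shows "(\<lambda>a. a \<otimes> \<phi> a) ` A \<lhd> G" "inj_on (\<lambda>a. a \<otimes> \<phi> a) A"
    "(\<lambda>a. a \<otimes> \<phi> a) ` A \<subseteq> L <#> A" "(\<lambda>a. a \<otimes> \<phi> a) ` A \<inter> L = {\<one>}"
proof -
  note h = G_homD[OF \<phi>] and f = G_hom_facts[OF A L \<phi>] and nA = normalD[OF A] and nL = normalD[OF L]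
  note com = normal_commute[OF A L AL]
  have c: "\<phi> a \<in> carrier G" if "a \<in> A" for a using h(2)[OF that] nL(2) by blast
  show "(\<lambda>a. a \<otimes> \<phi> a) ` A \<lhd> G"
  proof (rule normalI_closed)
    show "(\<lambda>a. a \<otimes> \<phi> a) ` A \<subseteq> carrier G" using nA(2) c by auto
    show "\<one> \<in> (\<lambda>a. a \<otimes> \<phi> a) ` A" by (rule image_eqI[of _ _ \<one>]) (use f(1) nA(3) in auto)
    fix x assume "x \<in> (\<lambda>a. a \<otimes> \<phi> a) ` A"
    then obtain a where a: "a \<in> A" "x = a \<otimes> \<phi> a" by blast
    note ac = nA(2)[OF a(1)] c[OF a(1)]
    have "inv x = inv (\<phi> a \<otimes> a)" using com[OF a(1) h(2)[OF a(1)]] a(2) by simp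
    hence "inv x = inv a \<otimes> \<phi> (inv a)" using ac f(2)[OF a(1)] by (simp add: inv_mult_group)
    thus "inv x \<in> (\<lambda>a. a \<otimes> \<phi> a) ` A" using nA(5)[OF a(1)] by blast
    {
      fix g assume g: "g \<in> carrier G"
      have "g \<otimes> x \<otimes> inv g = (g \<otimes> a \<otimes> inv g) \<otimes> (g \<otimes> \<phi> a \<otimes> inv g)"
        unfolding a(2) by (rule conj_mult[OF ac g])
      hence "g \<otimes> x \<otimes> inv g = (g \<otimes> a \<otimes> inv g) \<otimes> \<phi> (g \<otimes> a \<otimes> inv g)" using f(3)[OF g a(1)] by simp
      thus "g \<otimes> x \<otimes> inv g \<in> (\<lambda>a. a \<otimes> \<phi> a) ` A" using nA(6)[OF a(1) g] by blast
    }
    fix y assume "y \<in> (\<lambda>a. a \<otimes> \<phi> a) ` A"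
    then obtain b where b: "b \<in> A" "y = b \<otimes> \<phi> b" by blast
    note bc = nA(2)[OF b(1)] c[OF b(1)]
    have "x \<otimes> y = a \<otimes> (\<phi> a \<otimes> b) \<otimes> \<phi> b" using a b ac bc by (simp add: m_assoc)
    also have "\<phi> a \<otimes> b = b \<otimes> \<phi> a" using com[OF b(1) h(2)[OF a(1)]] by simp
    finally have "x \<otimes> y = (a \<otimes> b) \<otimes> \<phi> (a \<otimes> b)" using h(3)[OF a(1) b(1)] ac bc by (simp add: m_assoc)
    thus "x \<otimes> y \<in> (\<lambda>a. a \<otimes> \<phi> a) ` A" using nA(4)[OF a(1) b(1)] by blast
  qed
  show "inj_on (\<lambda>a. a \<otimes> \<phi> a) A"
  proof (rule inj_onI)
    fix a b assume a: "a \<in> A" and b: "b \<in> A" and "a \<otimes> \<phi> a = b \<otimes> \<phi> b"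
    thus "a = b" using disjoint_normal_factors_unique[OF A L AL a b h(2)[OF a] h(2)[OF b]] by blast
  qed
  show "(\<lambda>a. a \<otimes> \<phi> a) ` A \<subseteq> L <#> A"
  proof
    fix x assume "x \<in> (\<lambda>a. a \<otimes> \<phi> a) ` A"
    then obtain a where a: "a \<in> A" "x = a \<otimes> \<phi> a" by blast
    hence "x = \<phi> a \<otimes> a" using com[OF a(1) h(2)[OF a(1)]] by simp
    thus "x \<in> L <#> A" using a(1) h(2)[OF a(1)] by (auto simp: mem_set_mult_iff)
  qed
  show "(\<lambda>a. a \<otimes> \<phi> a) ` A \<inter> L = {\<one>}"
  proof -
    have "a \<otimes> \<phi> a = \<one>" if a: "a \<in> A" and l: "a \<otimes> \<phi> a \<in> L" for a
    proof -
      have "a \<otimes> \<phi> a \<otimes> inv (\<phi> a) \<in> L" by (rule nL(4)[OF l nL(5)[OF h(2)[OF a]]])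
      hence "a \<in> L" using nA(2)[OF a] c[OF a] by (simp add: m_assoc)
      hence "a = \<one>" using a AL by blast
      thus ?thesis using f(1) by simp
    qed
    moreover have "\<one> \<in> (\<lambda>a. a \<otimes> \<phi> a) ` A" by (rule image_eqI[of _ _ \<one>]) (use f(1) nA(3) in auto)
    ultimately show ?thesis using nL(3) by blast
  qed
qed

text \<open>A graph is minimal normal because any minimal normal subgroup inside it lies outside
  \<open>L\<close> and so already has order \<open>card A\<close>. Conversely \<open>N\<close> meets
  \<open>L\<close> trivially and \<open>L <#> N = L <#> A\<close>, so each \<open>a\<close> has
  exactly one \<open>l\<close> in \<open>L\<close> with \<open>a \<otimes> l\<close> in
  \<open>N\<close>; uniqueness makes this assignment an equivariant homomorphism with graph
  \<open>N\<close>.\<close>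

lemma card_new_min_normals:
  assumes L: "L \<lhd> G" and A: "min_normal G A" "\<not> A \<subseteq> L"
  shows "card (mins (L <#> A) - mins L) = card (G_hom G A L)"
proof -
  let ?K = "mins (L <#> A) - mins L" and ?g = "\<lambda>\<phi>. (\<lambda>a. a \<otimes> \<phi> a) ` A"
  have KI: "min_normal G N" "N \<subseteq> L <#> A" "\<not> N \<subseteq> L" if "N \<in> ?K" for N
    using that by (auto simp: mins_def)
  note nA' = min_normalD[OF A(1)] and nA = normalD[OF min_normalD(1)[OF A(1)]] and nL = normalD[OF L]
  have AL: "A \<inter> L = {\<one>}" by (rule min_normal_inter(1)[OF A(1) L A(2)])
  note com = normal_commute[OF nA'(1) L AL]
  note gr = G_hom_graph_normal[OF nA'(1) L AL]
  have A2: "card A > 1" by (rule card_min_normal_gt_one[OF A(1)])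
  have "bij_betw ?g (G_hom G A L) ?K"
    unfolding bij_betw_def
  proof (intro conjI inj_onI subset_antisym subsetI)
    fix \<phi> \<psi> assume \<phi>: "\<phi> \<in> G_hom G A L" and \<psi>: "\<psi> \<in> G_hom G A L" and e: "?g \<phi> = ?g \<psi>"
    show "\<phi> = \<psi>"
    proof (rule extensionalityI[OF G_homD(1)[OF \<phi>] G_homD(1)[OF \<psi>]])
      fix a assume a: "a \<in> A"
      then obtain b where b: "b \<in> A" "a \<otimes> \<phi> a = b \<otimes> \<psi> b" using e by blast
      thus "\<phi> a = \<psi> a"
        using disjoint_normal_factors_unique[OF nA'(1) L AL a b(1) G_homD(2)[OF \<phi> a] G_homD(2)[OF \<psi> b(1)] b(2)]
        by metis
    qed
  next
    fix N assume "N \<in> ?g ` G_hom G A L"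
    then obtain \<phi> where \<phi>: "\<phi> \<in> G_hom G A L" and N: "N = ?g \<phi>" by blast
    note g = gr[OF \<phi>, folded N]
    have cN: "card N = card A" unfolding N by (rule card_image[OF gr(2)[OF \<phi>]])
    have N1: "N \<noteq> {\<one>}" using cN A2 by auto
    obtain N' where N': "min_normal G N'" "N' \<subseteq> N" using exists_min_normal[OF g(1) N1] by blast
    have N'L: "\<not> N' \<subseteq> L" using N' g(4) min_normalD(2)[OF N'(1)] normalD(3)[OF min_normalD(1)[OF N'(1)]] by blast
    have "card N' = card A" using complement_min_normal(2)[OF L A N'(1) _ N'L] N'(2) g(3) by blast
    hence "N' = N" using card_subset_eq[OF normalD(8)[OF g(1)] N'(2)] cN by simp
    thus "N \<in> ?K" using N' N'L g(3) by (simp add: mins_def)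
  next
    fix N assume N: "N \<in> ?K"
    note nN = normalD[OF min_normalD(1)[OF KI(1)[OF N]]]
    note comp = complement_min_normal[OF L A KI[OF N]]
    have NL: "N \<inter> L = {\<one>}" by (rule min_normal_inter(1)[OF KI(1)[OF N] L KI(3)[OF N]])
    have ex: "\<exists>l. l \<in> L \<and> a \<otimes> l \<in> N" if a: "a \<in> A" for a
    proof -
      have "a \<in> L <#> N" using a comp(1) set_mult_upper(2)[OF L nA'(1)] by blast
      then obtain l n where ln: "l \<in> L" "n \<in> N" "a = l \<otimes> n" by (auto simp: mem_set_mult_iff)
      note c = nA(2)[OF a] nL(2)[OF ln(1)] nN(2)[OF ln(2)]
      have "a \<otimes> inv l = inv l \<otimes> a" by (rule com[OF a nL(5)[OF ln(1)]])
      also have "\<dots> = n" using ln(3) c by (simp flip: m_assoc)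
      finally have "a \<otimes> inv l \<in> N" using ln(2) by simp
      thus ?thesis using nL(5)[OF ln(1)] by blast
    qed
    have uniq: "l = l'" if "l \<in> L" "l' \<in> L" "a \<in> A" "a \<otimes> l \<in> N" "a \<otimes> l' \<in> N" for a l l'
    proof -
      note c = nL(2)[OF that(1)] nL(2)[OF that(2)] nA(2)[OF that(3)]
      have "inv (a \<otimes> l) \<otimes> (a \<otimes> l') \<in> N" by (rule nN(4)[OF nN(5)[OF that(4)] that(5)])
      moreover have "inv (a \<otimes> l) \<otimes> (a \<otimes> l') = inv l \<otimes> (inv a \<otimes> (a \<otimes> l'))"
        using c by (simp add: inv_mult_group m_assoc)
      moreover have "inv a \<otimes> (a \<otimes> l') = l'" using c by (simp flip: m_assoc)
      ultimately have "inv l \<otimes> l' \<in> N \<inter> L" using nL(4)[OF nL(5)[OF that(1)] that(2)] by simp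
      hence "inv l \<otimes> l' = \<one>" using NL by auto
      thus ?thesis using c inv_solve_left'[of \<one> l l'] by simp
    qed
    define \<phi> where "\<phi> = (\<lambda>a\<in>A. SOME l. l \<in> L \<and> a \<otimes> l \<in> N)"
    have \<phi>: "\<phi> a \<in> L" "a \<otimes> \<phi> a \<in> N" if "a \<in> A" for a
      using someI_ex[OF ex[OF that]] that by (auto simp: \<phi>_def)
    have "\<phi> \<in> G_hom G A L"
    proof (rule G_homI)
      show "\<phi> \<in> extensional A" by (simp add: \<phi>_def)
      show "\<phi> a \<in> L" if "a \<in> A" for a by (rule \<phi>(1)[OF that])
      fix a assume a: "a \<in> A"
      note ac = nA(2)[OF a] nL(2)[OF \<phi>(1)[OF a]]
      {
        fix b assume b: "b \<in> A"
        note bc = nA(2)[OF b] nL(2)[OF \<phi>(1)[OF b]]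
        have "(a \<otimes> \<phi> a) \<otimes> (b \<otimes> \<phi> b) = a \<otimes> (\<phi> a \<otimes> b) \<otimes> \<phi> b" using ac bc by (simp add: m_assoc)
        also have "\<phi> a \<otimes> b = b \<otimes> \<phi> a" using com[OF b \<phi>(1)[OF a]] by simp
        also have "a \<otimes> (b \<otimes> \<phi> a) \<otimes> \<phi> b = (a \<otimes> b) \<otimes> (\<phi> a \<otimes> \<phi> b)" using ac bc by (simp add: m_assoc)
        finally have "(a \<otimes> b) \<otimes> (\<phi> a \<otimes> \<phi> b) \<in> N" using nN(4)[OF \<phi>(2)[OF a] \<phi>(2)[OF b]] by simp
        thus "\<phi> (a \<otimes> b) = \<phi> a \<otimes> \<phi> b"
          using uniq[OF \<phi>(1)[OF nA(4)[OF a b]] nL(4)[OF \<phi>(1)[OF a] \<phi>(1)[OF b]] nA(4)[OF a b] \<phi>(2)[OF nA(4)[OF a b]]]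
          by blast
      }
      fix g assume g: "g \<in> carrier G"
      note ag = nA(7)[OF a g]
      have "inv g \<otimes> (a \<otimes> \<phi> a) \<otimes> g \<in> N" by (rule nN(7)[OF \<phi>(2)[OF a] g])
      hence "(inv g \<otimes> a \<otimes> g) \<otimes> (inv g \<otimes> \<phi> a \<otimes> g) \<in> N" using conj_mult'[OF ac g] by simp
      thus "\<phi> (inv g \<otimes> a \<otimes> g) = inv g \<otimes> \<phi> a \<otimes> g"
        using uniq[OF \<phi>(1)[OF ag] nL(7)[OF \<phi>(1)[OF a] g] ag \<phi>(2)[OF ag]] by blast
    qed
    moreover have "?g \<phi> = N"
    proof (rule card_subset_eq[OF nN(8)])
      show "?g \<phi> \<subseteq> N" using \<phi>(2) by blast
      show "card (?g \<phi>) = card N" using card_image[OF gr(2)[OF \<open>\<phi> \<in> G_hom G A L\<close>]] comp(2) by simp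
    qed
    ultimately show "N \<in> ?g ` G_hom G A L" by blast
  qed
  thus ?thesis by (simp add: bij_betw_same_card)
qed

lemma abelian_subgroup_iff:
  assumes "N \<lhd> G"
  shows "Defs.abelian_subgroup G N \<longleftrightarrow> (\<forall>x\<in>N. \<forall>y\<in>N. x \<otimes> y = y \<otimes> x)"
proof
  assume "Defs.abelian_subgroup G N"
  then interpret N: comm_group "G\<lparr>carrier := N\<rparr>" by (simp add: Defs.abelian_subgroup_def)
  show "\<forall>x\<in>N. \<forall>y\<in>N. x \<otimes> y = y \<otimes> x" using N.m_comm by simp
next
  assume "\<forall>x\<in>N. \<forall>y\<in>N. x \<otimes> y = y \<otimes> x"
  thus "Defs.abelian_subgroup G N"
    unfolding Defs.abelian_subgroup_def
    by (intro group.group_comm_groupI subgroup_imp_group normalD(9)[OF assms]) simp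
qed

text \<open>If \<open>N\<close> differs from \<open>A\<close>, then \<open>A\<close> meets both
  \<open>L\<close> and \<open>N\<close> trivially and centralizes \<open>L <#> N\<close>. This
  product equals \<open>L <#> A\<close> and contains \<open>A\<close>, so \<open>A\<close> is
  abelian.\<close>

lemma new_min_normal_nonabelian:
  assumes L: "L \<lhd> G" and A: "min_normal G A" "\<not> A \<subseteq> L" and na: "\<not> Defs.abelian_subgroup G A"
    and N: "min_normal G N" "N \<subseteq> L <#> A" "\<not> N \<subseteq> L"
  shows "N = A"
proof (rule ccontr)
  assume ne: "N \<noteq> A"
  note nA = min_normalD[OF A(1)] and nN = min_normalD[OF N(1)]
  have "\<not> N \<subseteq> A" using nA(3)[OF nN(1) _ nN(2)] ne by blast
  hence NA: "A \<inter> N = {\<one>}" by (rule min_normal_inter(2)[OF N(1) nA(1)])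
  have AL: "A \<inter> L = {\<one>}" by (rule min_normal_inter(1)[OF A(1) L A(2)])
  have "x \<otimes> y = y \<otimes> x" if x: "x \<in> A" and y: "y \<in> A" for x y
  proof -
    have "y \<in> L <#> N" using y complement_min_normal(1)[OF L A N] set_mult_upper(2)[OF L nA(1)] by blast
    then obtain l n where ln: "l \<in> L" "n \<in> N" "y = l \<otimes> n" by (auto simp: mem_set_mult_iff)
    note c = normalD(2)[OF nA(1) x] normalD(2)[OF L ln(1)] normalD(2)[OF nN(1) ln(2)]
    note cm = normal_commute[OF nA(1) L AL x ln(1)] normal_commute[OF nA(1) nN(1) NA x ln(2)]
    have "x \<otimes> y = l \<otimes> x \<otimes> n" using ln(3) cm(1) c by (simp flip: m_assoc)
    also have "\<dots> = y \<otimes> x" using ln(3) cm(2) c by (simp add: m_assoc)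
    finally show ?thesis .
  qed
  thus False using na abelian_subgroup_iff[OF nA(1)] by blast
qed

text \<open>The product is direct and both factors are stable under conjugation, so a homomorphism
  into it is the same as a pair of component homomorphisms.\<close>

lemma card_G_hom_set_mult:
  assumes A: "A \<lhd> G" and L: "L \<lhd> G" and B: "B \<lhd> G" and LB: "L \<inter> B = {\<one>}"
  shows "card (G_hom G A (L <#> B)) = card (G_hom G A L) * card (G_hom G A B)"
proof -
  note nA = normalD[OF A] and nL = normalD[OF L] and nB = normalD[OF B]
  note com = normal_commute[OF L B LB]
  let ?f = "\<lambda>(\<phi>, \<psi>). \<lambda>a\<in>A. \<phi> a \<otimes> \<psi> a"
  note uniq = disjoint_normal_factors_unique[OF L B LB]
  have "bij_betw ?f (G_hom G A L \<times> G_hom G A B) (G_hom G A (L <#> B))"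
    unfolding bij_betw_def
  proof (intro conjI inj_onI subset_antisym subsetI)
    fix p p' assume p: "p \<in> G_hom G A L \<times> G_hom G A B" and p': "p' \<in> G_hom G A L \<times> G_hom G A B"
      and e: "?f p = ?f p'"
    obtain \<phi> \<psi> \<phi>' \<psi>' where pp: "p = (\<phi>, \<psi>)" "p' = (\<phi>', \<psi>')" by (cases p, cases p') blast
    have m: "\<phi> \<in> G_hom G A L" "\<psi> \<in> G_hom G A B" "\<phi>' \<in> G_hom G A L" "\<psi>' \<in> G_hom G A B"
      using p p' pp by auto
    have "\<phi> a = \<phi>' a \<and> \<psi> a = \<psi>' a" if a: "a \<in> A" for a
    proof (rule uniq)
      show "\<phi> a \<otimes> \<psi> a = \<phi>' a \<otimes> \<psi>' a" using fun_cong[OF e, of a] a pp by simp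
    qed (use m a G_homD(2) in blast)+
    hence "\<phi> = \<phi>'" "\<psi> = \<psi>'"
      using extensionalityI[OF G_homD(1)[OF m(1)] G_homD(1)[OF m(3)]]
        extensionalityI[OF G_homD(1)[OF m(2)] G_homD(1)[OF m(4)]] by blast+
    thus "p = p'" using pp by simp
  next
    fix f assume "f \<in> ?f ` (G_hom G A L \<times> G_hom G A B)"
    then obtain \<phi> \<psi> where m: "\<phi> \<in> G_hom G A L" "\<psi> \<in> G_hom G A B" and f: "f = (\<lambda>a\<in>A. \<phi> a \<otimes> \<psi> a)" by auto
    note h = G_homD[OF m(1)] and k = G_homD[OF m(2)]
    show "f \<in> G_hom G A (L <#> B)"
    proof (rule G_homI)
      show "f \<in> extensional A" by (simp add: f)
      fix a assume a: "a \<in> A"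
      note ac = nL(2)[OF h(2)[OF a]] nB(2)[OF k(2)[OF a]]
      show "f a \<in> L <#> B" using a h(2)[OF a] k(2)[OF a] by (auto simp: f mem_set_mult_iff)
      {
        fix b assume b: "b \<in> A"
        note bc = nL(2)[OF h(2)[OF b]] nB(2)[OF k(2)[OF b]]
        have "\<phi> (a \<otimes> b) \<otimes> \<psi> (a \<otimes> b) = \<phi> a \<otimes> (\<phi> b \<otimes> \<psi> a) \<otimes> \<psi> b"
          using h(3)[OF a b] k(3)[OF a b] ac bc by (simp add: m_assoc)
        also have "\<phi> b \<otimes> \<psi> a = \<psi> a \<otimes> \<phi> b" by (rule com[OF h(2)[OF b] k(2)[OF a]])
        also have "\<phi> a \<otimes> (\<psi> a \<otimes> \<phi> b) \<otimes> \<psi> b = (\<phi> a \<otimes> \<psi> a) \<otimes> (\<phi> b \<otimes> \<psi> b)"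
          using ac bc by (simp add: m_assoc)
        finally show "f (a \<otimes> b) = f a \<otimes> f b" using a b nA(4)[OF a b] by (simp add: f)
      }
      fix g assume g: "g \<in> carrier G"
      show "f (inv g \<otimes> a \<otimes> g) = inv g \<otimes> f a \<otimes> g"
        using a nA(7)[OF a g] h(4)[OF g a] k(4)[OF g a] conj_mult'[OF ac g] by (simp add: f)
    qed
  next
    fix f assume f: "f \<in> G_hom G A (L <#> B)"
    note h = G_homD[OF f]
    have "\<exists>p. a \<in> A \<longrightarrow> fst p \<in> L \<and> snd p \<in> B \<and> f a = fst p \<otimes> snd p" for a
    proof (cases "a \<in> A")
      case True
      then obtain l b where "l \<in> L" "b \<in> B" "f a = l \<otimes> b" using h(2)[of a] by (auto simp: mem_set_mult_iff)
      thus ?thesis by (intro exI[of _ "(l, b)"]) simp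
    qed simp
    then obtain p where p: "\<And>a. a \<in> A \<Longrightarrow> fst (p a) \<in> L \<and> snd (p a) \<in> B \<and> f a = fst (p a) \<otimes> snd (p a)"
      by metis
    \<comment> \<open>The components are chosen pointwise; uniqueness of the factorization makes
      them multiplicative and equivariant.\<close>
    define \<phi> \<psi> where "\<phi> = (\<lambda>a\<in>A. fst (p a))" and "\<psi> = (\<lambda>a\<in>A. snd (p a))"
    have pp: "\<phi> a \<in> L" "\<psi> a \<in> B" "f a = \<phi> a \<otimes> \<psi> a" if "a \<in> A" for a
      using p[OF that] that by (auto simp: \<phi>_def \<psi>_def)
    have mult: "\<phi> (a \<otimes> b) = \<phi> a \<otimes> \<phi> b \<and> \<psi> (a \<otimes> b) = \<psi> a \<otimes> \<psi> b" if a: "a \<in> A" and b: "b \<in> A" for a b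
    proof (rule uniq)
      note ab = nA(4)[OF a b]
      note c = nL(2)[OF pp(1)[OF a]] nB(2)[OF pp(2)[OF a]] nL(2)[OF pp(1)[OF b]] nB(2)[OF pp(2)[OF b]]
      have "\<phi> (a \<otimes> b) \<otimes> \<psi> (a \<otimes> b) = \<phi> a \<otimes> (\<psi> a \<otimes> \<phi> b) \<otimes> \<psi> b"
        using pp(3)[OF ab] pp(3)[OF a] pp(3)[OF b] h(3)[OF a b] c by (simp add: m_assoc)
      also have "\<psi> a \<otimes> \<phi> b = \<phi> b \<otimes> \<psi> a" using com[OF pp(1)[OF b] pp(2)[OF a]] by simp
      finally show "\<phi> (a \<otimes> b) \<otimes> \<psi> (a \<otimes> b) = \<phi> a \<otimes> \<phi> b \<otimes> (\<psi> a \<otimes> \<psi> b)" using c by (simp add: m_assoc)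
    qed (use pp(1,2) a b nA(4) nL(4) nB(4) in auto)
    have equiv: "\<phi> (inv g \<otimes> a \<otimes> g) = inv g \<otimes> \<phi> a \<otimes> g \<and> \<psi> (inv g \<otimes> a \<otimes> g) = inv g \<otimes> \<psi> a \<otimes> g"
      if g: "g \<in> carrier G" and a: "a \<in> A" for g a
    proof (rule uniq)
      note c = nL(2)[OF pp(1)[OF a]] nB(2)[OF pp(2)[OF a]]
      show "\<phi> (inv g \<otimes> a \<otimes> g) \<otimes> \<psi> (inv g \<otimes> a \<otimes> g) = inv g \<otimes> \<phi> a \<otimes> g \<otimes> (inv g \<otimes> \<psi> a \<otimes> g)"
        using pp(3)[OF nA(7)[OF a g]] pp(3)[OF a] h(4)[OF g a] conj_mult'[OF c g] by simp
    qed (use pp(1,2) a g nA(7) nL(7) nB(7) in auto)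
    have "\<phi> \<in> G_hom G A L" by (rule G_homI) (use pp mult equiv in \<open>auto simp: \<phi>_def\<close>)
    moreover have "\<psi> \<in> G_hom G A B" by (rule G_homI) (use pp mult equiv in \<open>auto simp: \<psi>_def\<close>)
    moreover have "f = (\<lambda>a\<in>A. \<phi> a \<otimes> \<psi> a)"
      by (rule extensionalityI[OF h(1)]) (use pp(3) in auto)
    ultimately show "f \<in> ?f ` (G_hom G A L \<times> G_hom G A B)" by (intro image_eqI[of _ _ "(\<phi>, \<psi>)"]) auto
  qed
  thus ?thesis using bij_betw_same_card by (fastforce simp: card_cartesian_product)
qed

lemma card_G_hom_one:
  assumes "A \<lhd> G"
  shows "card (G_hom G A {\<one>}) = 1"
proof -
  have "G_hom G A {\<one>} = {\<lambda>a\<in>A. \<one>}"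
    using trivial_G_hom[OF one_is_normal assms] by (auto simp: G_hom_iff intro!: extensionalityI[of _ A])
  thus ?thesis by simp
qed

section \<open>G-isomorphism of minimal normal subgroups\<close>

lemma G_isomorphic_iff:
  "G_isomorphic G A B \<longleftrightarrow> (\<exists>\<theta>. bij_betw \<theta> A B \<and> (\<forall>a\<in>A. \<forall>b\<in>A. \<theta> (a \<otimes> b) = \<theta> a \<otimes> \<theta> b) \<and>
    (\<forall>g\<in>carrier G. \<forall>a\<in>A. \<theta> (inv g \<otimes> a \<otimes> g) = inv g \<otimes> \<theta> a \<otimes> g))"
proof -
  have "\<theta> \<in> iso (G\<lparr>carrier := A\<rparr>) (G\<lparr>carrier := B\<rparr>) \<longleftrightarrow>
    bij_betw \<theta> A B \<and> (\<forall>a\<in>A. \<forall>b\<in>A. \<theta> (a \<otimes> b) = \<theta> a \<otimes> \<theta> b)" for \<theta>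
    by (auto simp: iso_def hom_def dest: bij_betw_apply)
  thus ?thesis by (auto simp: G_isomorphic_def G_equivariant_def)
qed

lemma G_isomorphic_card: "G_isomorphic G A B \<Longrightarrow> card A = card B"
  using bij_betw_same_card by (auto simp: G_isomorphic_iff)

lemma G_isomorphic_sym:
  assumes A: "A \<lhd> G" and AB: "G_isomorphic G A B"
  shows "G_isomorphic G B A"
proof -
  note nA = normalD[OF A]
  obtain \<theta> where b: "bij_betw \<theta> A B" and m: "\<And>a b. a \<in> A \<Longrightarrow> b \<in> A \<Longrightarrow> \<theta> (a \<otimes> b) = \<theta> a \<otimes> \<theta> b"
    and e: "\<And>g a. g \<in> carrier G \<Longrightarrow> a \<in> A \<Longrightarrow> \<theta> (inv g \<otimes> a \<otimes> g) = inv g \<otimes> \<theta> a \<otimes> g"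
    using AB by (auto simp: G_isomorphic_iff)
  let ?i = "inv_into A \<theta>"
  have i: "?i (\<theta> a) = a" if "a \<in> A" for a using bij_betw_inv_into_left[OF b that] .
  have s: "\<exists>a\<in>A. x = \<theta> a" if "x \<in> B" for x using b that by (auto simp: bij_betw_def)
  show ?thesis unfolding G_isomorphic_iff
  proof (intro exI[of _ ?i] conjI ballI)
    show "bij_betw ?i B A" by (rule bij_betw_inv_into[OF b])
    fix x assume "x \<in> B"
    then obtain a where a: "a \<in> A" "x = \<theta> a" using s by blast
    {
      fix y assume "y \<in> B"
      then obtain c where c: "c \<in> A" "y = \<theta> c" using s by blast
      show "?i (x \<otimes> y) = ?i x \<otimes> ?i y" using m[OF a(1) c(1)] i a c nA(4)[OF a(1) c(1)] by metis
    }
    fix g assume g: "g \<in> carrier G"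
    show "?i (inv g \<otimes> x \<otimes> g) = inv g \<otimes> ?i x \<otimes> g"
      using e[OF g a(1)] i[OF nA(7)[OF a(1) g]] i[OF a(1)] a(2) by metis
  qed
qed

lemma G_isomorphic_abelian:
  assumes A: "A \<lhd> G" and B: "B \<lhd> G" and AB: "G_isomorphic G A B" and ab: "Defs.abelian_subgroup G A"
  shows "Defs.abelian_subgroup G B"
proof -
  obtain \<theta> where b: "bij_betw \<theta> A B" and m: "\<And>a b. a \<in> A \<Longrightarrow> b \<in> A \<Longrightarrow> \<theta> (a \<otimes> b) = \<theta> a \<otimes> \<theta> b"
    using AB by (auto simp: G_isomorphic_iff)
  have "x \<otimes> y = y \<otimes> x" if "x \<in> B" "y \<in> B" for x y
  proof -
    have "x \<in> \<theta> ` A" "y \<in> \<theta> ` A" using b that by (auto simp: bij_betw_def)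
    then obtain a c where "a \<in> A" "x = \<theta> a" "c \<in> A" "y = \<theta> c" by blast
    thus ?thesis using m[of a c] m[of c a] ab abelian_subgroup_iff[OF A] by simp
  qed
  thus ?thesis using abelian_subgroup_iff[OF B] by blast
qed

text \<open>Precomposition with the isomorphism is injective. One inequality suffices, since
  \<open>G_isomorphic_sym\<close> supplies the opposite one; \<open>card_G_hom_target_le\<close> is
  used in the same way.\<close>

lemma card_G_hom_source_le:
  assumes A: "A \<lhd> G" and L: "L \<lhd> G" and AB: "G_isomorphic G A B"
  shows "card (G_hom G B L) \<le> card (G_hom G A L)"
proof -
  note nA = normalD[OF A]
  obtain \<theta> where b: "bij_betw \<theta> A B" and m: "\<And>a b. a \<in> A \<Longrightarrow> b \<in> A \<Longrightarrow> \<theta> (a \<otimes> b) = \<theta> a \<otimes> \<theta> b"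
    and e: "\<And>g a. g \<in> carrier G \<Longrightarrow> a \<in> A \<Longrightarrow> \<theta> (inv g \<otimes> a \<otimes> g) = inv g \<otimes> \<theta> a \<otimes> g"
    using AB by (auto simp: G_isomorphic_iff)
  have B: "\<theta> a \<in> B" if "a \<in> A" for a using bij_betw_apply[OF b that] .
  show ?thesis
  proof (rule card_inj_on_le[of "\<lambda>\<phi>. \<lambda>a\<in>A. \<phi> (\<theta> a)"])
    show "inj_on (\<lambda>\<phi>. \<lambda>a\<in>A. \<phi> (\<theta> a)) (G_hom G B L)"
    proof (rule inj_onI)
      fix \<phi> \<psi> assume f: "\<phi> \<in> G_hom G B L" "\<psi> \<in> G_hom G B L"
        and eq: "(\<lambda>a\<in>A. \<phi> (\<theta> a)) = (\<lambda>a\<in>A. \<psi> (\<theta> a))"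
      show "\<phi> = \<psi>"
      proof (rule extensionalityI[OF G_homD(1)[OF f(1)] G_homD(1)[OF f(2)]])
        fix x assume "x \<in> B"
        then obtain a where "a \<in> A" "x = \<theta> a" using b by (auto simp: bij_betw_def)
        thus "\<phi> x = \<psi> x" using fun_cong[OF eq, of a] by simp
      qed
    qed
    show "(\<lambda>\<phi>. \<lambda>a\<in>A. \<phi> (\<theta> a)) ` G_hom G B L \<subseteq> G_hom G A L"
    proof (rule image_subsetI)
      fix \<phi> assume "\<phi> \<in> G_hom G B L"
      note h = G_homD[OF this]
      show "(\<lambda>a\<in>A. \<phi> (\<theta> a)) \<in> G_hom G A L"
        by (rule G_homI) (simp_all add: h B m e nA(4,7))
    qed
  qed (rule finite_G_hom[OF A L])
qed

lemma card_G_hom_target_le: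
  assumes A: "A \<lhd> G" and B: "B \<lhd> G" and C: "C \<lhd> G" and BC: "G_isomorphic G B C"
  shows "card (G_hom G A B) \<le> card (G_hom G A C)"
proof -
  note nA = normalD[OF A]
  obtain \<theta> where b: "bij_betw \<theta> B C" and m: "\<And>a b. a \<in> B \<Longrightarrow> b \<in> B \<Longrightarrow> \<theta> (a \<otimes> b) = \<theta> a \<otimes> \<theta> b"
    and e: "\<And>g a. g \<in> carrier G \<Longrightarrow> a \<in> B \<Longrightarrow> \<theta> (inv g \<otimes> a \<otimes> g) = inv g \<otimes> \<theta> a \<otimes> g"
    using BC by (auto simp: G_isomorphic_iff)
  show ?thesis
  proof (rule card_inj_on_le[of "\<lambda>\<phi>. \<lambda>a\<in>A. \<theta> (\<phi> a)"])
    show "inj_on (\<lambda>\<phi>. \<lambda>a\<in>A. \<theta> (\<phi> a)) (G_hom G A B)"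
    proof (rule inj_onI)
      fix \<phi> \<psi> assume f: "\<phi> \<in> G_hom G A B" "\<psi> \<in> G_hom G A B"
        and eq: "(\<lambda>a\<in>A. \<theta> (\<phi> a)) = (\<lambda>a\<in>A. \<theta> (\<psi> a))"
      show "\<phi> = \<psi>"
      proof (rule extensionalityI[OF G_homD(1)[OF f(1)] G_homD(1)[OF f(2)]])
        fix x assume x: "x \<in> A"
        have "\<theta> (\<phi> x) = \<theta> (\<psi> x)" using fun_cong[OF eq, of x] x by simp
        thus "\<phi> x = \<psi> x"
          using bij_betw_imp_inj_on[OF b] G_homD(2)[OF f(1) x] G_homD(2)[OF f(2) x] by (auto dest: inj_onD)
      qed
    qed
    show "(\<lambda>\<phi>. \<lambda>a\<in>A. \<theta> (\<phi> a)) ` G_hom G A B \<subseteq> G_hom G A C"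
    proof (rule image_subsetI)
      fix \<phi> assume "\<phi> \<in> G_hom G A B"
      note h = G_homD[OF this]
      show "(\<lambda>a\<in>A. \<theta> (\<phi> a)) \<in> G_hom G A C"
        by (rule G_homI) (simp_all add: h m e nA(4,7) bij_betw_apply[OF b])
    qed
  qed (rule finite_G_hom[OF A C])
qed

text \<open>Preimages under \<open>\<phi>\<close> of normal subgroups are normal. For the trivial
  subgroup this makes the kernel normal, hence trivial by minimality of \<open>A\<close>; for a
  nontrivial normal subgroup inside the image the preimage is all of \<open>A\<close>, so the image
  is minimal too.\<close>

lemma G_hom_image:
  assumes A: "min_normal G A" and L: "L \<lhd> G" and \<phi>: "\<phi> \<in> G_hom G A L" and x: "x \<in> A" "\<phi> x \<noteq> \<one>"
  shows "min_normal G (\<phi> ` A)" "G_isomorphic G A (\<phi> ` A)" "\<phi> ` A \<subseteq> L"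
proof -
  note mA = min_normalD[OF A] and h = G_homD[OF \<phi>]
  note nA = normalD[OF mA(1)] and nL = normalD[OF L] and f = G_hom_facts[OF mA(1) L \<phi>]
  have c: "\<phi> a \<in> carrier G" if "a \<in> A" for a using h(2)[OF that] nL(2) by blast
  have pre: "{a \<in> A. \<phi> a \<in> K} \<lhd> G" if K: "K \<lhd> G" for K
  proof (rule normalI_closed)
    note nK = normalD[OF K]
    show "{a \<in> A. \<phi> a \<in> K} \<subseteq> carrier G" using nA(1) by blast
    show "\<one> \<in> {a \<in> A. \<phi> a \<in> K}" using nA(3) nK(3) f(1) by simp
    show "y \<otimes> z \<in> {a \<in> A. \<phi> a \<in> K}" if "y \<in> {a \<in> A. \<phi> a \<in> K}" "z \<in> {a \<in> A. \<phi> a \<in> K}" for y z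
      using that nA(4) nK(4) h(3) by simp
    show "inv y \<in> {a \<in> A. \<phi> a \<in> K}" if "y \<in> {a \<in> A. \<phi> a \<in> K}" for y
      using that nA(5) nK(5) f(2) by simp
    show "g \<otimes> y \<otimes> inv g \<in> {a \<in> A. \<phi> a \<in> K}" if "y \<in> {a \<in> A. \<phi> a \<in> K}" "g \<in> carrier G" for y g
      using that nA(6) nK(6) f(3) by simp
  qed
  have "{a \<in> A. \<phi> a \<in> {\<one>}} = {\<one>}"
    using mA(3)[OF pre[OF one_is_normal]] x by blast
  hence ker: "a = \<one>" if "a \<in> A" "\<phi> a = \<one>" for a using that by blast
  have inj: "inj_on \<phi> A"
  proof (rule inj_onI)
    fix a b assume ab: "a \<in> A" "b \<in> A" "\<phi> a = \<phi> b"
    note bi = nA(5)[OF ab(2)]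
    have "\<phi> (inv b \<otimes> a) = \<one>" using h(3)[OF bi ab(1)] f(2)[OF ab(2)] ab(3) c[OF ab(2)] by simp
    hence "inv b \<otimes> a = \<one>" by (rule ker[OF nA(4)[OF bi ab(1)]])
    thus "a = b" using nA(2)[OF ab(1)] nA(2)[OF ab(2)] inv_solve_left'[of \<one> b a] by simp
  qed
  show "\<phi> ` A \<subseteq> L" using h(2) by blast
  show "G_isomorphic G A (\<phi> ` A)"
    unfolding G_isomorphic_iff using inj h(3,4) by (intro exI[of _ \<phi>]) (simp add: bij_betw_def)
  have im: "\<phi> ` A \<lhd> G"
  proof (rule normalI_closed)
    show "\<phi> ` A \<subseteq> carrier G" using c by blast
    show "\<one> \<in> \<phi> ` A" using f(1) nA(3) by (metis imageI)
    fix y assume "y \<in> \<phi> ` A"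
    then obtain a where a: "a \<in> A" "y = \<phi> a" by blast
    show "inv y \<in> \<phi> ` A" using f(2)[OF a(1)] nA(5)[OF a(1)] a(2) by (metis imageI)
    show "g \<otimes> y \<otimes> inv g \<in> \<phi> ` A" if g: "g \<in> carrier G" for g
      using f(3)[OF g a(1)] nA(6)[OF a(1) g] a(2) by (metis imageI)
    fix z assume "z \<in> \<phi> ` A"
    then obtain b where b: "b \<in> A" "z = \<phi> b" by blast
    show "y \<otimes> z \<in> \<phi> ` A" using h(3)[OF a(1) b(1)] nA(4)[OF a(1) b(1)] a(2) b(2) by (metis imageI)
  qed
  show "min_normal G (\<phi> ` A)"
    unfolding min_normal_def
  proof (intro conjI allI impI im)
    show "\<phi> ` A \<noteq> {\<one>}" using x by blast
    fix K assume K: "K \<lhd> G \<and> K \<subseteq> \<phi> ` A \<and> K \<noteq> {\<one>}"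
    then obtain k where k: "k \<in> K" "k \<noteq> \<one>" using normalD(3) by blast
    then obtain a where a: "a \<in> A" "k = \<phi> a" using K by blast
    hence "a \<in> {a \<in> A. \<phi> a \<in> K}" "a \<noteq> \<one>" using k f(1) by auto
    hence "{a \<in> A. \<phi> a \<in> K} \<noteq> {\<one>}" by (metis singletonD)
    moreover have "{a \<in> A. \<phi> a \<in> K} \<lhd> G" using pre K by simp
    ultimately have "{a \<in> A. \<phi> a \<in> K} = A" by (intro mA(3)) auto
    hence "\<phi> ` A \<subseteq> K" by (metis (no_types, lifting) image_subsetI mem_Collect_eq)
    thus "K = \<phi> ` A" using K by (simp add: subset_antisym)
  qed
qed

text \<open>Schur's lemma for minimal normal subgroups: a nontrivial homomorphism would have a
  minimal normal image inside \<open>B\<close>, hence equal to \<open>B\<close>, and would be an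
  isomorphism.\<close>

lemma card_G_hom_not_isomorphic:
  assumes A: "min_normal G A" and B: "min_normal G B" and n: "\<not> G_isomorphic G A B"
  shows "card (G_hom G A B) = 1"
proof -
  note nA = min_normalD[OF A] and nB = min_normalD[OF B]
  have "\<phi> = (\<lambda>a\<in>A. \<one>)" if \<phi>: "\<phi> \<in> G_hom G A B" for \<phi>
  proof (rule extensionalityI[OF G_homD(1)[OF \<phi>]])
    fix a assume a: "a \<in> A"
    have "\<phi> a = \<one>"
    proof (rule ccontr)
      assume "\<phi> a \<noteq> \<one>"
      note im = G_hom_image[OF A nB(1) \<phi> a this]
      have "\<phi> ` A = B" by (rule nB(3)[OF _ im(3)]) (use min_normalD[OF im(1)] in auto)
      thus False using im(2) n by simp
    qed
    thus "\<phi> a = (\<lambda>a\<in>A. \<one>) a" using a by simp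
  qed simp
  hence "G_hom G A B = {\<lambda>a\<in>A. \<one>}" using trivial_G_hom[OF nB(1) nA(1)] by blast
  thus ?thesis by simp
qed

text \<open>The identity and the trivial map differ. Hence a power of this number determines its
  exponent.\<close>

lemma card_G_hom_self_gt_one:
  assumes A: "min_normal G A"
  shows "card (G_hom G A A) > 1"
proof -
  note mA = min_normalD[OF A] note nA = normalD[OF mA(1)]
  have id: "(\<lambda>a\<in>A. a) \<in> G_hom G A A" by (rule G_homI) (use nA(4,7) in auto)
  obtain x where x: "x \<in> A" "x \<noteq> \<one>" using mA(2) nA(3) by blast
  have ne: "(\<lambda>a\<in>A. a) \<noteq> (\<lambda>a\<in>A. \<one>)" using x by (auto simp: fun_eq_iff)
  have "card {\<lambda>a\<in>A. a, \<lambda>a\<in>A. \<one>} \<le> card (G_hom G A A)"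
    using id trivial_G_hom[OF mA(1) mA(1)] by (intro card_mono finite_G_hom mA(1)) auto
  thus ?thesis using ne by simp
qed

lemma conj_pow:
  "x \<in> carrier G \<Longrightarrow> g \<in> carrier G \<Longrightarrow> (g \<otimes> x \<otimes> inv g) [^] (n::nat) = g \<otimes> x [^] n \<otimes> inv g"
  by (induction n) (simp_all add: conj_mult)

text \<open>For a prime \<open>p\<close> dividing the order of some element, the elements of
  \<open>A\<close> with \<open>p\<close>-th power \<open>\<one>\<close> form a nontrivial normal
  subgroup, hence all of \<open>A\<close>. With this every minimal normal subgroup is either
  non-abelian or G-isomorphic to some \<open>M i\<close>.\<close>

lemma abelian_min_normal_elementary:
  assumes A: "min_normal G A" and ab: "Defs.abelian_subgroup G A"
  shows "elementary_abelian_subgroup G A"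
proof -
  note mA = min_normalD[OF A] note nA = normalD[OF mA(1)]
  have com: "x \<otimes> y = y \<otimes> x" if "x \<in> A" "y \<in> A" for x y using ab abelian_subgroup_iff[OF mA(1)] that by blast
  obtain x where x: "x \<in> A" "x \<noteq> \<one>" using mA(2) nA(3) by blast
  note xc = nA(2)[OF x(1)]
  have "ord x \<noteq> 1" using x xc ord_eq_1 by blast
  then obtain p where p: "prime p" "p dvd ord x" using prime_factor_nat by blast
  then obtain k where k: "ord x = p * k" by blast
  have k0: "k \<noteq> 0" using k ord_ge_1[OF finite_carrier xc] by (intro notI) simp
  have pw: "x [^] k \<in> A" by (induction k) (use nA(3,4) x in auto)
  have ne: "x [^] k \<noteq> \<one>"
  proof
    assume "x [^] k = \<one>"
    hence "p * k dvd k" using pow_eq_id[OF xc] k by simp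
    hence "p * k \<le> k" using k0 by (intro dvd_imp_le) auto
    thus False using k0 prime_gt_1_nat[OF p(1)] by simp
  qed
  have "(x [^] k) [^] p = \<one>" using pow_ord_eq_1[OF xc] k xc by (simp add: nat_pow_pow mult.commute)
  define E where "E = {y \<in> A. y [^] p = \<one>}"
  have "E \<lhd> G"
  proof (rule normalI_closed)
    show "E \<subseteq> carrier G" "\<one> \<in> E" using nA by (auto simp: E_def)
    show "y \<otimes> z \<in> E" if "y \<in> E" "z \<in> E" for y z
      using that nA(2,4) com pow_mult_distrib[of y z p] by (simp add: E_def)
    show "inv y \<in> E" if "y \<in> E" for y
      using that nA(2,5) nat_pow_inv[of y p] by (simp add: E_def)
    show "g \<otimes> y \<otimes> inv g \<in> E" if "y \<in> E" "g \<in> carrier G" for y g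
      using that nA(2,6) conj_pow[of y g p] by (simp add: E_def)
  qed
  moreover have "x [^] k \<in> E" using pw \<open>(x [^] k) [^] p = \<one>\<close> by (simp add: E_def)
  ultimately have "E = A" using mA(3)[of E] ne by (auto simp: E_def)
  thus ?thesis unfolding elementary_abelian_subgroup_def using ab p(1) by (auto simp: E_def)
qed

end

section \<open>The alternating sum of the socle\<close>

lemma prod_lessThan_update_Suc:
  fixes F :: "'i \<Rightarrow> nat \<Rightarrow> 'c::comm_monoid_mult"
  assumes "finite I" "i \<in> I"
  shows "(\<Prod>j\<in>I. \<Prod>l<(m(i := Suc (m i))) j. F j l) = (\<Prod>j\<in>I. \<Prod>l<m j. F j l) * F i (m i)"
proof -
  have "(\<Prod>j\<in>I - {i}. \<Prod>l<(m(i := Suc (m i))) j. F j l) = (\<Prod>j\<in>I - {i}. \<Prod>l<m j. F j l)"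
    by (rule prod.cong) auto
  thus ?thesis using assms by (simp add: prod.remove[of I i] ac_simps)
qed

context fin_group begin

lemma socle_eq_join: "socle G = join {N. min_normal G N}"
  by (simp add: socle_def join_def)

lemma finite_min_normals: "finite {N. min_normal G N}"
proof (rule finite_subset)
  show "{N. min_normal G N} \<subseteq> Pow (carrier G)" using normalD(1) min_normalD(1) by auto
qed simp

lemma normal_socle: "socle G \<lhd> G"
  unfolding socle_eq_join by (rule normal_join) (simp add: min_normalD(1))

lemma min_normal_subset_socle: "min_normal G N \<Longrightarrow> N \<subseteq> socle G"
  unfolding socle_eq_join by (rule join_upper) simp

text \<open>Here the prescribed \<open>d\<close> enters the count. Building the component up step by
  step gives one exponent \<open>m\<close> both for its order and for the number of homomorphisms
  into it; the given isomorphism makes the order \<open>card A ^ d\<close>, and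
  \<open>card A > 1\<close> yields \<open>m = d\<close>.\<close>

lemma card_homogeneous_component:
  assumes A: "min_normal G A"
    and iso: "G\<lparr>carrier := homogeneous_component G A\<rparr> \<cong> product_group {..<d} (\<lambda>_. G\<lparr>carrier := A\<rparr>)"
  shows "card (G_hom G A (socle G)) = card (G_hom G A A) ^ d"
proof -
  let ?T = "{N. min_normal G N \<and> G_isomorphic G N A}" and ?H = "homogeneous_component G A"
  note nA = min_normalD(1)[OF A]
  have H: "?H = join ?T" by (simp add: homogeneous_component_def join_def)
  have Hn: "?H \<lhd> G" unfolding H by (rule normal_join) (simp add: min_normalD(1))
  let ?Q = "\<lambda>L. \<exists>m. card L = card A ^ m \<and> card (G_hom G A L) = card (G_hom G A A) ^ m"
  have "?Q (join ?T)"
  proof (rule join_induct[where P = ?Q])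
    show "finite ?T" by (rule finite_subset[OF _ finite_min_normals]) auto
  next
    fix N assume "N \<in> ?T"
    thus "min_normal G N" by simp
  next
    show "?Q {\<one>}" using card_G_hom_one[OF nA] by (intro exI[of _ 0]) simp
  next
    fix L B assume step: "?Q L" "L \<lhd> G" "B \<in> ?T" "\<not> B \<subseteq> L"
    then obtain m where m: "card L = card A ^ m" "card (G_hom G A L) = card (G_hom G A A) ^ m" by blast
    have B: "min_normal G B" "G_isomorphic G B A" using step by auto
    note nB = min_normalD(1)[OF B(1)]
    note LB = min_normal_inter(2)[OF B(1) step(2,4)]
    have "card (G_hom G A B) = card (G_hom G A A)"
      using card_G_hom_target_le[OF nA nB nA B(2)] card_G_hom_target_le[OF nA nA nB G_isomorphic_sym[OF nB B(2)]]
      by simp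
    thus "?Q (L <#> B)"
      using card_set_mult[OF step(2) nB LB] card_G_hom_set_mult[OF nA step(2) nB LB] G_isomorphic_card[OF B(2)] m
      by (intro exI[of _ "Suc m"]) simp
  qed
  then obtain m where m: "card ?H = card A ^ m" "card (G_hom G A ?H) = card (G_hom G A A) ^ m"
    unfolding H by blast
  obtain f where "f \<in> iso (G\<lparr>carrier := ?H\<rparr>) (product_group {..<d} (\<lambda>_. G\<lparr>carrier := A\<rparr>))"
    using iso by (auto simp: is_iso_def)
  hence "bij_betw f ?H (\<Pi>\<^sub>E i\<in>{..<d}. A)" by (simp add: iso_def)
  hence "card ?H = card A ^ d" using bij_betw_same_card by (fastforce simp: card_PiE)
  hence "m = d" using m(1) card_min_normal_gt_one[OF A] by simp
  \<comment> \<open>A nontrivial homomorphism into the socle has as its image a minimal normal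
    subgroup G-isomorphic to \<open>A\<close>, which is one of the generators of the
    component.\<close>
  have "G_hom G A (socle G) = G_hom G A ?H"
  proof (intro subset_antisym subsetI)
    fix \<phi> assume \<phi>: "\<phi> \<in> G_hom G A (socle G)"
    have "\<phi> a \<in> ?H" if a: "a \<in> A" for a
    proof (cases "\<phi> a = \<one>")
      case True
      thus ?thesis using normalD(3)[OF Hn] by simp
    next
      case False
      note im = G_hom_image[OF A normal_socle \<phi> a False]
      have "\<phi> ` A \<subseteq> ?H"
        unfolding H by (rule join_upper) (simp add: im(1) G_isomorphic_sym[OF nA im(2)])
      thus ?thesis using a by blast
    qed
    thus "\<phi> \<in> G_hom G A ?H" using \<phi> by (simp add: G_hom_iff)
  next
    fix \<phi> assume \<phi>: "\<phi> \<in> G_hom G A ?H"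
    have "?H \<subseteq> socle G" unfolding H
      by (rule join_least[OF normal_socle]) (simp add: min_normal_subset_socle)
    thus "\<phi> \<in> G_hom G A (socle G)" using \<phi> by (auto simp: G_hom_iff)
  qed
  thus ?thesis using m(2) \<open>m = d\<close> by simp
qed

text \<open>Different orders of adjoining may pick different subgroups. The exponents recorded along
  the way are tied to \<open>L\<close> by the numbers of homomorphisms from the \<open>M i\<close>,
  and so come out as \<open>d i\<close> in the end.\<close>

lemma alt_sum_socle:
  fixes M N :: "nat \<Rightarrow> 'a set" and d q :: "nat \<Rightarrow> nat"
  assumes injM: "inj_on M {1..a}"
    and reps: "representatives (elem_abelian_min_normals G) (G_isomorphic G) (M ` {1..a})"
    and d: "\<forall>i\<in>{1..a}. G\<lparr>carrier := homogeneous_component G (M i)\<rparr>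
           \<cong> product_group {..<d i} (\<lambda>_. G\<lparr>carrier := M i\<rparr>)"
    and q: "\<forall>i\<in>{1..a}. q i = card (G_hom G (M i) (M i))"
    and N: "bij_betw N {a+1..a+b} (nonabelian_min_normals G)"
  shows "alt_sum (socle G) =
    (\<Prod>i\<in>{1..a}. \<Prod>j<d i. 1 - of_nat (q i) ^ j / of_nat (card (M i))) *
    (\<Prod>k\<in>{a+1..a+b}. 1 - 1 / of_nat (card (N k)))"
proof -
  let ?I = "{1..a}" and ?J = "{a+1..a+b}"
  let ?F = "\<lambda>i j. 1 - of_nat (q i) ^ j / of_nat (card (M i)) :: complex"
  have M: "min_normal G (M i)" "Defs.abelian_subgroup G (M i)" if "i \<in> ?I" for i
  proof -
    have "M i \<in> elem_abelian_min_normals G" using reps that unfolding representatives_def by blast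
    thus "min_normal G (M i)" "Defs.abelian_subgroup G (M i)"
      by (auto simp: elem_abelian_min_normals_def elementary_abelian_subgroup_def)
  qed
  have uniq: "i = j" if "i \<in> ?I" "j \<in> ?I" "A \<in> elem_abelian_min_normals G"
    "G_isomorphic G (M i) A" "G_isomorphic G (M j) A" for i j A
  proof -
    have "M i = M j" using reps that unfolding representatives_def by blast
    thus ?thesis using injM that(1,2) by (auto dest: inj_onD)
  qed
  have Nk: "min_normal G (N k)" "\<not> Defs.abelian_subgroup G (N k)" if "k \<in> ?J" for k
    using bij_betw_apply[OF N that] by (auto simp: nonabelian_min_normals_def)
  \<comment> \<open>\<open>m i\<close> is the number of adjoined factors G-isomorphic to
    \<open>M i\<close>; a non-abelian \<open>N k\<close> is accounted for as soon as
    \<open>L\<close> contains it.\<close>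
  let ?Q = "\<lambda>L. \<exists>m. (\<forall>i\<in>?I. card (G_hom G (M i) L) = q i ^ m i) \<and>
    alt_sum L = (\<Prod>i\<in>?I. \<Prod>j<m i. ?F i j) * (\<Prod>k\<in>{k \<in> ?J. N k \<subseteq> L}. 1 - 1 / of_nat (card (N k)))"
  have "?Q (join {N. min_normal G N})"
  proof (rule join_induct[where P = ?Q])
    show "finite {N. min_normal G N}" by (rule finite_min_normals)
  next
    fix A assume "A \<in> {N. min_normal G N}"
    thus "min_normal G A" by simp
  next
    have e: "{k \<in> ?J. N k \<subseteq> {\<one>}} = {}"
    proof (rule ccontr)
      assume "{k \<in> ?J. N k \<subseteq> {\<one>}} \<noteq> {}"
      then obtain k where k: "k \<in> ?J" "N k \<subseteq> {\<one>}" by blast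
      have "card (N k) \<le> card {\<one>}" by (rule card_mono[OF _ k(2)]) simp
      thus False using card_min_normal_gt_one[OF Nk(1)[OF k(1)]] by simp
    qed
    show "?Q {\<one>}" unfolding e
      using card_G_hom_one[OF min_normalD(1)[OF M(1)]] alt_sum_one by (intro exI[of _ "\<lambda>_. 0"]) simp
  next
    fix L A assume step: "?Q L" "L \<lhd> G" "A \<in> {N. min_normal G N}" "\<not> A \<subseteq> L"
    have A: "min_normal G A" using step by simp
    note L = step(2) and AL = step(4) and mA = min_normalD(1)[OF A]
    obtain m where mq: "\<And>i. i \<in> ?I \<Longrightarrow> card (G_hom G (M i) L) = q i ^ m i"
      and mf: "alt_sum L = (\<Prod>i\<in>?I. \<Prod>j<m i. ?F i j) * (\<Prod>k\<in>{k \<in> ?J. N k \<subseteq> L}. 1 - 1 / of_nat (card (N k)))"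
      using step(1) by blast
    have LA: "L <#> A \<lhd> G" "L \<subseteq> L <#> A" "A \<subseteq> L <#> A"
      using normal_set_mult[OF L mA] set_mult_upper[OF L mA] by auto
    have split: "card (G_hom G (M i) (L <#> A)) = q i ^ m i * card (G_hom G (M i) A)" if "i \<in> ?I" for i
      using card_G_hom_set_mult[OF min_normalD(1)[OF M(1)[OF that]] L mA min_normal_inter(2)[OF A L AL]] mq[OF that]
      by simp
    have astep: "alt_sum (L <#> A) = alt_sum L * (1 - of_nat (card (mins (L <#> A) - mins L)) / of_nat (card A))"
      by (rule alt_sum_step[OF L A AL])
    show "?Q (L <#> A)"
    proof (cases "Defs.abelian_subgroup G A")
      case True
      \<comment> \<open>Some \<open>M i\<close> represents \<open>A\<close>. The step raises
        \<open>m i\<close> by one, keeps the other exponents and brings in no \<open>N k\<close>.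
        The new minimal normal subgroups number \<open>q i ^ m i\<close> with the old exponent, so
        the new factor is the one with index \<open>m i\<close> and the product stays over indices
        below the updated exponent.\<close>
      have Ae: "A \<in> elem_abelian_min_normals G"
        using abelian_min_normal_elementary[OF A True] A by (simp add: elem_abelian_min_normals_def)
      then obtain i where i: "i \<in> ?I" "G_isomorphic G (M i) A"
        using reps unfolding representatives_def by blast
      note mi = min_normalD(1)[OF M(1)[OF i(1)]]
      note i' = G_isomorphic_sym[OF mi i(2)]
      have ci: "card (G_hom G A L) = q i ^ m i"
        using card_G_hom_source_le[OF mi L i(2)] card_G_hom_source_le[OF mA L i'] mq[OF i(1)] by simp
      have "card (G_hom G (M i) A) = q i"
        using card_G_hom_target_le[OF mi mA mi i'] card_G_hom_target_le[OF mi mi mA i(2)] q i(1) by simp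
      hence f1: "card (G_hom G (M j) (L <#> A)) = q j ^ (m(i := Suc (m i))) j" if j: "j \<in> ?I" for j
        using split[OF j] card_G_hom_not_isomorphic[OF M(1)[OF j] A] uniq[OF j i(1) Ae _ i(2)]
        by (cases "j = i") auto
      have f2: "{k \<in> ?J. N k \<subseteq> L <#> A} = {k \<in> ?J. N k \<subseteq> L}"
      proof -
        have "N k \<subseteq> L" if k: "k \<in> ?J" "N k \<subseteq> L <#> A" for k
        proof (rule ccontr)
          assume n: "\<not> N k \<subseteq> L"
          have "L <#> N k = L <#> A" by (rule complement_min_normal(1)[OF L A AL Nk(1)[OF k(1)] k(2) n])
          hence "A \<subseteq> L <#> N k" using LA(3) by simp
          \<comment> \<open>The roles are exchanged: \<open>N k\<close> is the non-abelian subgroup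
            adjoined to \<open>L\<close>, and \<open>A\<close> is the minimal normal subgroup found
            in the product.\<close>
          hence "A = N k" by (rule new_min_normal_nonabelian[OF L Nk(1)[OF k(1)] n Nk(2)[OF k(1)] A _ AL])
          thus False using True Nk(2)[OF k(1)] by simp
        qed
        thus ?thesis using LA(2) by blast
      qed
      have p: "(\<Prod>j\<in>?I. \<Prod>l<(m(i := Suc (m i))) j. ?F j l) = (\<Prod>j\<in>?I. \<Prod>l<m j. ?F j l) * ?F i (m i)"
        by (rule prod_lessThan_update_Suc[OF finite_atLeastAtMost i(1)])
      have "alt_sum (L <#> A) = alt_sum L * ?F i (m i)"
        using astep card_new_min_normals[OF L A AL] ci G_isomorphic_card[OF i(2)] by simp
      hence f3: "alt_sum (L <#> A) = (\<Prod>j\<in>?I. \<Prod>l<(m(i := Suc (m i))) j. ?F j l) *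
        (\<Prod>k\<in>{k \<in> ?J. N k \<subseteq> L}. 1 - 1 / of_nat (card (N k)))"
        unfolding p mf by (simp only: ac_simps)
      show ?thesis unfolding f2
        by (rule exI[of _ "m(i := Suc (m i))"]) (use f1 f3 in blast)
    next
      case False
      hence "A \<in> N ` ?J" using N A by (auto simp: nonabelian_min_normals_def bij_betw_def)
      then obtain k where k: "k \<in> ?J" "A = N k" by blast
      \<comment> \<open>The only new minimal normal subgroup is \<open>A\<close> itself, so the
        factor is \<open>1 - 1 / card A\<close>. The exponents stay, because the abelian
        \<open>M j\<close> are not G-isomorphic to \<open>A\<close>.\<close>
      have K: "mins (L <#> A) - mins L = {A}"
        using new_min_normal_nonabelian[OF L A AL False] A AL LA(3) by (auto simp: mins_def)
      have f1: "card (G_hom G (M j) (L <#> A)) = q j ^ m j" if j: "j \<in> ?I" for j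
      proof -
        have "\<not> G_isomorphic G (M j) A"
          using G_isomorphic_abelian[OF min_normalD(1)[OF M(1)[OF j]] mA _ M(2)[OF j]] False by blast
        thus ?thesis using split[OF j] card_G_hom_not_isomorphic[OF M(1)[OF j] A] by simp
      qed
      have f2: "{k \<in> ?J. N k \<subseteq> L <#> A} = insert k {k \<in> ?J. N k \<subseteq> L}"
      proof -
        have "l = k" if l: "l \<in> ?J" "N l \<subseteq> L <#> A" "\<not> N l \<subseteq> L" for l
        proof -
          have "N l = N k" using new_min_normal_nonabelian[OF L A AL False Nk(1)[OF l(1)] l(2,3)] k(2) by simp
          thus ?thesis using N l(1) k(1) by (auto simp: bij_betw_def dest: inj_onD)
        qed
        thus ?thesis using LA(2,3) k by blast
      qed
      have "k \<notin> {k \<in> ?J. N k \<subseteq> L}" using AL k(2) by simp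
      hence "(\<Prod>k\<in>insert k {k \<in> ?J. N k \<subseteq> L}. 1 - 1 / of_nat (card (N k))) =
        (1 - 1 / of_nat (card A)) * (\<Prod>k\<in>{k \<in> ?J. N k \<subseteq> L}. 1 - 1 / of_nat (card (N k)) :: complex)"
        by (subst prod.insert) (auto simp: k(2))
      moreover have "alt_sum (L <#> A) = alt_sum L * (1 - 1 / of_nat (card A))" using astep K by simp
      ultimately have f3: "alt_sum (L <#> A) = (\<Prod>j\<in>?I. \<Prod>l<m j. ?F j l) *
        (\<Prod>k\<in>insert k {k \<in> ?J. N k \<subseteq> L}. 1 - 1 / of_nat (card (N k)))"
        unfolding mf by (simp only: ac_simps)
      show ?thesis unfolding f2 by (rule exI[of _ m]) (use f1 f3 in blast)
    qed
  qed
  then obtain m where m: "\<And>i. i \<in> ?I \<Longrightarrow> card (G_hom G (M i) (socle G)) = q i ^ m i"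
    and f: "alt_sum (socle G) = (\<Prod>i\<in>?I. \<Prod>j<m i. ?F i j) *
      (\<Prod>k\<in>{k \<in> ?J. N k \<subseteq> socle G}. 1 - 1 / of_nat (card (N k)))"
    unfolding socle_eq_join[symmetric] by blast
  \<comment> \<open>Both are exponents of \<open>q i\<close> in the number of homomorphisms from
    \<open>M i\<close> to the socle, and \<open>q i\<close> exceeds 1.\<close>
  have "m i = d i" if i: "i \<in> ?I" for i
  proof -
    have "q i ^ m i = q i ^ d i"
      using m[OF i] card_homogeneous_component[OF M(1)[OF i], of "d i"] d q i by simp
    thus ?thesis using card_G_hom_self_gt_one[OF M(1)[OF i]] q i by simp
  qed
  hence "(\<Prod>i\<in>?I. \<Prod>j<m i. ?F i j) = (\<Prod>i\<in>?I. \<Prod>j<d i. ?F i j)" by (intro prod.cong) auto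
  moreover have "{k \<in> ?J. N k \<subseteq> socle G} = ?J" using min_normal_subset_socle Nk(1) by blast
  ultimately show ?thesis using f by simp
qed

end

section \<open>Faithful characters\<close>

text \<open>The left side is the expanded product over \<open>X\<close> of 1 minus the indicator of
  \<open>P\<close>.\<close>

lemma alternating_sum_indicator:
  assumes "finite X"
  shows "(\<Sum>U\<in>Pow X. (-1) ^ card U * (if \<forall>N\<in>U. P N then 1 else 0)) =
    (if \<exists>N\<in>X. P N then 0 else 1 :: complex)"
proof (cases "\<exists>N\<in>X. P N")
  case True
  then obtain N where N: "N \<in> X" "P N" by blast
  have "(\<Sum>U\<in>Pow X. (-1) ^ card U * (if \<forall>N\<in>U. P N then 1 else 0 :: complex)) = 0"
    by (rule alternating_sum_Pow_eq_zero[OF assms N(1)]) (use N(2) in simp)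
  thus ?thesis using True by simp
next
  case False
  have "(\<Sum>U\<in>Pow X. (-1) ^ card U * (if \<forall>N\<in>U. P N then 1 else 0 :: complex)) =
    (\<Sum>U\<in>{{}}. (-1) ^ card U * (if \<forall>N\<in>U. P N then 1 else 0))"
    by (rule sum.mono_neutral_right) (use assms False in auto)
  thus ?thesis using False by simp
qed

context fin_group begin

lemma rep_equivalent_faithful:
  assumes "rep_equivalent G \<rho> \<sigma>" "inj_on \<rho> (carrier G)"
  shows "inj_on \<sigma> (carrier G)"
proof -
  obtain P Q where s: "\<And>g. g \<in> carrier G \<Longrightarrow> similar_mat_wit (\<rho> g) (\<sigma> g) P Q"
    using assms(1) by (auto simp: rep_equivalent_def)
  have "\<rho> g = P * \<sigma> g * Q" if "g \<in> carrier G" for g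
    by (rule similar_mat_witD(3)[OF refl s[OF that]])
  hence "\<rho> g = \<rho> h" if "g \<in> carrier G" "h \<in> carrier G" "\<sigma> g = \<sigma> h" for g h using that by metis
  thus ?thesis using assms(2) unfolding inj_on_def by blast
qed

text \<open>Orthogonality speaks of all irreducible representations, while \<open>R\<close>
  represents the faithful ones only. Faithfulness is invariant under equivalence, so
  \<open>R\<close> can be completed by one representative of each remaining class.\<close>

lemma faithful_transversal_extends:
  assumes R: "representatives (faithful_irreps G) (rep_equivalent G) R"
  obtains T where "representatives {\<rho>. irreducible_rep G \<rho>} (rep_equivalent G) T"
    "R = {\<rho> \<in> T. inj_on \<rho> (carrier G)}"
proof -
  \<comment> \<open>The predicate under \<open>SOME\<close> depends on \<open>\<rho>\<close> only up
    to equivalence, so equivalent representations receive the same choice.\<close>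
  define s where "s = (\<lambda>\<rho>. SOME \<sigma>. irreducible_rep G \<sigma> \<and> rep_equivalent G \<sigma> \<rho>)"
  define P where "P = {\<rho>. irreducible_rep G \<rho> \<and> \<not> inj_on \<rho> (carrier G)}"
  define T where "T = R \<union> s ` P"
  have RF: "irreducible_rep G \<rho>" "inj_on \<rho> (carrier G)" if "\<rho> \<in> R" for \<rho>
    using R that by (auto simp: representatives_def faithful_irreps_def)
  have s: "irreducible_rep G (s \<rho>)" "rep_equivalent G (s \<rho>) \<rho>" if "irreducible_rep G \<rho>" for \<rho>
  proof -
    have "rep_equivalent G \<rho> \<rho>"
      using that irreducible_rep_iff irreducible_matrix_repD(1) rep_equivalent_refl by blast
    hence "\<exists>\<sigma>. irreducible_rep G \<sigma> \<and> rep_equivalent G \<sigma> \<rho>" using that by blast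
    from someI_ex[OF this] show "irreducible_rep G (s \<rho>)" "rep_equivalent G (s \<rho>) \<rho>" by (auto simp: s_def)
  qed
  have s_cong: "s \<rho> = s \<sigma>" if "rep_equivalent G \<rho> \<sigma>" for \<rho> \<sigma>
  proof -
    have "rep_equivalent G \<tau> \<rho> \<longleftrightarrow> rep_equivalent G \<tau> \<sigma>" for \<tau>
      using rep_equivalent_trans[OF _ that] rep_equivalent_trans[OF _ rep_equivalent_sym[OF that]] by blast
    thus ?thesis by (simp add: s_def)
  qed
  have sP: "\<not> inj_on (s \<rho>) (carrier G)" if "\<rho> \<in> P" for \<rho>
    using that s rep_equivalent_faithful by (auto simp: P_def)
  have "representatives {\<rho>. irreducible_rep G \<rho>} (rep_equivalent G) T"
    unfolding representatives_def
  proof (intro conjI ballI)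
    show "T \<subseteq> {\<rho>. irreducible_rep G \<rho>}" using RF s by (auto simp: T_def P_def)
    fix \<sigma> assume "\<sigma> \<in> {\<rho>. irreducible_rep G \<rho>}"
    hence \<sigma>: "irreducible_rep G \<sigma>" by simp
    show "\<exists>!r. r \<in> T \<and> rep_equivalent G r \<sigma>"
    proof (cases "inj_on \<sigma> (carrier G)")
      case True
      hence "\<exists>!r. r \<in> R \<and> rep_equivalent G r \<sigma>"
        using R \<sigma> by (auto simp: representatives_def faithful_irreps_def)
      moreover have "r \<in> R" if "r \<in> T" "rep_equivalent G r \<sigma>" for r
        using that True sP rep_equivalent_faithful[OF rep_equivalent_sym] by (auto simp: T_def)
      moreover have "R \<subseteq> T" by (simp add: T_def)
      ultimately show ?thesis by blast
    next
      case False
      hence "\<sigma> \<in> P" using \<sigma> by (simp add: P_def)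
      show ?thesis
      proof (rule ex1I[of _ "s \<sigma>"])
        show "s \<sigma> \<in> T \<and> rep_equivalent G (s \<sigma>) \<sigma>" using s[OF \<sigma>] \<open>\<sigma> \<in> P\<close> by (auto simp: T_def)
        fix r assume r: "r \<in> T \<and> rep_equivalent G r \<sigma>"
        have "r \<notin> R" using r RF(2) False rep_equivalent_faithful by blast
        then obtain \<rho> where \<rho>: "\<rho> \<in> P" "r = s \<rho>" using r by (auto simp: T_def)
        have "rep_equivalent G (s \<rho>) \<rho>" using s \<rho>(1) by (simp add: P_def)
        hence "rep_equivalent G \<rho> r" unfolding \<rho>(2) by (rule rep_equivalent_sym)
        hence "rep_equivalent G \<rho> \<sigma>" by (rule rep_equivalent_trans) (use r in blast)
        thus "r = s \<sigma>" using s_cong \<rho>(2) by simp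
      qed
    qed
  qed
  moreover have "R = {\<rho> \<in> T. inj_on \<rho> (carrier G)}" using RF(2) sP by (auto simp: T_def)
  ultimately show ?thesis using that by blast
qed

lemma normal_kernel_rep:
  assumes \<rho>: "matrix_rep n \<rho>"
  shows "{g \<in> carrier G. \<rho> g = \<rho> \<one>} \<lhd> G"
proof (rule normalI_closed)
  note r = matrix_repD[OF \<rho>]
  show "x \<otimes> y \<in> {g \<in> carrier G. \<rho> g = \<rho> \<one>}"
    if "x \<in> {g \<in> carrier G. \<rho> g = \<rho> \<one>}" "y \<in> {g \<in> carrier G. \<rho> g = \<rho> \<one>}" for x y
    using that r(2,3) by simp
  show "inv x \<in> {g \<in> carrier G. \<rho> g = \<rho> \<one>}" if "x \<in> {g \<in> carrier G. \<rho> g = \<rho> \<one>}" for x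
  proof -
    have x: "x \<in> carrier G" "\<rho> x = 1\<^sub>m n" using that r(2) by auto
    have "\<rho> (inv x) = 1\<^sub>m n * \<rho> (inv x)" using r(1)[OF inv_closed[OF x(1)]] by simp
    also have "\<dots> = 1\<^sub>m n" using matrix_rep_inv(1)[OF \<rho> x(1)] x(2) by simp
    finally show ?thesis using x(1) r(2) by simp
  qed
  show "g \<otimes> x \<otimes> inv g \<in> {g \<in> carrier G. \<rho> g = \<rho> \<one>}"
    if x: "x \<in> {g \<in> carrier G. \<rho> g = \<rho> \<one>}" and g: "g \<in> carrier G" for x g
  proof -
    have xx: "x \<in> carrier G" "\<rho> x = 1\<^sub>m n" using x r(2) by auto
    have "\<rho> (g \<otimes> x \<otimes> inv g) = \<rho> g * \<rho> x * \<rho> (inv g)" using r(3) xx(1) g by simp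
    also have "\<dots> = 1\<^sub>m n" using xx(2) r(1)[OF g] matrix_rep_inv(1)[OF \<rho> g] by simp
    finally show ?thesis using xx g r(2) by simp
  qed
qed auto

lemma faithful_iff_no_min_normal_in_kernel:
  assumes \<rho>: "matrix_rep n \<rho>"
  shows "inj_on \<rho> (carrier G) \<longleftrightarrow> \<not> (\<exists>N\<in>{N. min_normal G N}. \<forall>m\<in>N. \<rho> m = \<rho> \<one>)"
proof
  assume inj: "inj_on \<rho> (carrier G)"
  show "\<not> (\<exists>N\<in>{N. min_normal G N}. \<forall>m\<in>N. \<rho> m = \<rho> \<one>)"
  proof
    assume "\<exists>N\<in>{N. min_normal G N}. \<forall>m\<in>N. \<rho> m = \<rho> \<one>"
    then obtain N where N: "min_normal G N" "\<And>m. m \<in> N \<Longrightarrow> \<rho> m = \<rho> \<one>" by blast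
    note nN = normalD[OF min_normalD(1)[OF N(1)]]
    have "m = \<one>" if "m \<in> N" for m using inj_onD[OF inj N(2)[OF that]] nN(2)[OF that] by simp
    thus False using nN(3) min_normalD(2)[OF N(1)] by blast
  qed
next
  let ?K = "{g \<in> carrier G. \<rho> g = \<rho> \<one>}"
  assume no: "\<not> (\<exists>N\<in>{N. min_normal G N}. \<forall>m\<in>N. \<rho> m = \<rho> \<one>)"
  note r = matrix_repD[OF \<rho>]
  have K: "?K = {\<one>}"
  proof (rule ccontr)
    assume "?K \<noteq> {\<one>}"
    then obtain N where "min_normal G N" "N \<subseteq> ?K" using exists_min_normal[OF normal_kernel_rep[OF \<rho>]] by blast
    thus False using no by blast
  qed
  show "inj_on \<rho> (carrier G)"
  proof (rule inj_onI)
    fix x y assume x: "x \<in> carrier G" and y: "y \<in> carrier G" and e: "\<rho> x = \<rho> y"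
    have "\<rho> (inv y \<otimes> x) = \<rho> \<one>" using r(3)[of "inv y" x] x y e matrix_rep_inv(2)[OF \<rho> y] r(2) by simp
    hence "inv y \<otimes> x \<in> ?K" using x y by simp
    hence "inv y \<otimes> x = \<one>" unfolding K by simp
    thus "x = y" using x y inv_solve_left'[of \<one> y x] by simp
  qed
qed

text \<open>The kernel is a normal subgroup, so it contains the join as soon as it contains the
  members. A product of projections for the members of \<open>U\<close> thus becomes the single
  condition that \<open>sum_characters_trivial_on\<close> handles.\<close>

lemma trivial_on_join_iff:
  assumes \<rho>: "matrix_rep n \<rho>" and U: "\<And>N. N \<in> U \<Longrightarrow> N \<lhd> G"
  shows "(\<forall>m\<in>join U. \<rho> m = \<rho> \<one>) \<longleftrightarrow> (\<forall>N\<in>U. \<forall>m\<in>N. \<rho> m = \<rho> \<one>)"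
proof
  assume "\<forall>m\<in>join U. \<rho> m = \<rho> \<one>"
  thus "\<forall>N\<in>U. \<forall>m\<in>N. \<rho> m = \<rho> \<one>" using join_upper by blast
next
  assume h: "\<forall>N\<in>U. \<forall>m\<in>N. \<rho> m = \<rho> \<one>"
  have "join U \<subseteq> {g \<in> carrier G. \<rho> g = \<rho> \<one>}"
    by (rule join_least[OF normal_kernel_rep[OF \<rho>]]) (use h U normalD(2) in blast)
  thus "\<forall>m\<in>join U. \<rho> m = \<rho> \<one>" by blast
qed

lemma faithful_character_sum:
  assumes R: "representatives (faithful_irreps G) (rep_equivalent G) R"
    and x: "x \<in> carrier G" and y: "y \<in> carrier G"
  shows "(\<Sum>\<rho>\<in>R. mat_trace (\<rho> x) * cnj (mat_trace (\<rho> y))) =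
    (\<Sum>U\<in>Pow {N. min_normal G N}. (-1) ^ card U *
      ((\<Sum>m\<in>join U. of_nat (card {g \<in> carrier G. x \<otimes> m \<otimes> g = g \<otimes> y})) / of_nat (card (join U))))"
proof -
  let ?X = "{N. min_normal G N}"
  obtain T where T: "representatives {\<rho>. irreducible_rep G \<rho>} (rep_equivalent G) T"
    and RT: "R = {\<rho> \<in> T. inj_on \<rho> (carrier G)}"
    using faithful_transversal_extends[OF R] .
  have Trep: "matrix_rep (rep_degree G \<rho>) \<rho>" if "\<rho> \<in> T" for \<rho>
    using T that irreducible_matrix_repD(1) by (auto simp: representatives_def irreducible_rep_iff)
  let ?F = "\<lambda>\<rho>. mat_trace (\<rho> x) * cnj (mat_trace (\<rho> y))"
  have "(\<Sum>\<rho>\<in>R. ?F \<rho>) = (\<Sum>\<rho>\<in>T. if inj_on \<rho> (carrier G) then ?F \<rho> else 0)"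
    unfolding RT by (rule sum.inter_filter) (rule transversal_regular_character(1)[OF T])
  also have "\<dots> = (\<Sum>\<rho>\<in>T. \<Sum>U\<in>Pow ?X. (-1) ^ card U * (if \<forall>m\<in>join U. \<rho> m = \<rho> \<one> then ?F \<rho> else 0))"
  proof (rule sum.cong[OF refl])
    fix \<rho> assume \<rho>: "\<rho> \<in> T"
    have "(if inj_on \<rho> (carrier G) then ?F \<rho> else 0) =
      (if \<exists>N\<in>?X. \<forall>m\<in>N. \<rho> m = \<rho> \<one> then 0 else 1) * ?F \<rho>"
    proof -
      have "(if \<not> Q then z else 0) = (if Q then 0 else 1) * z" for Q and z :: complex by simp
      thus ?thesis unfolding faithful_iff_no_min_normal_in_kernel[OF Trep[OF \<rho>]] .
    qed
    also have "\<dots> = (\<Sum>U\<in>Pow ?X. (-1) ^ card U * (if \<forall>N\<in>U. \<forall>m\<in>N. \<rho> m = \<rho> \<one> then 1 else 0)) * ?F \<rho>"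
      unfolding alternating_sum_indicator[OF finite_min_normals, of "\<lambda>N. \<forall>m\<in>N. \<rho> m = \<rho> \<one>"] ..
    also have "\<dots> = (\<Sum>U\<in>Pow ?X. (-1) ^ card U * (if \<forall>N\<in>U. \<forall>m\<in>N. \<rho> m = \<rho> \<one> then 1 else 0) * ?F \<rho>)"
      by (rule sum_distrib_right)
    also have "\<dots> = (\<Sum>U\<in>Pow ?X. (-1) ^ card U * (if \<forall>m\<in>join U. \<rho> m = \<rho> \<one> then ?F \<rho> else 0))"
    proof (rule sum.cong[OF refl])
      fix U assume U: "U \<in> Pow ?X"
      have c: "c * (if Q then 1 else 0) * z = c * (if Q then z else 0)" for Q and c z :: complex by simp
      have j: "(\<forall>m\<in>join U. \<rho> m = \<rho> \<one>) \<longleftrightarrow> (\<forall>N\<in>U. \<forall>m\<in>N. \<rho> m = \<rho> \<one>)"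
        by (rule trivial_on_join_iff[OF Trep[OF \<rho>]]) (use U min_normalD(1) in blast)
      show "(-1) ^ card U * (if \<forall>N\<in>U. \<forall>m\<in>N. \<rho> m = \<rho> \<one> then 1 else 0) * ?F \<rho> =
        (-1) ^ card U * (if \<forall>m\<in>join U. \<rho> m = \<rho> \<one> then ?F \<rho> else 0)" unfolding j by (rule c)
    qed
    finally show "(if inj_on \<rho> (carrier G) then ?F \<rho> else 0) =
      (\<Sum>U\<in>Pow ?X. (-1) ^ card U * (if \<forall>m\<in>join U. \<rho> m = \<rho> \<one> then ?F \<rho> else 0))" .
  qed
  also have "\<dots> = (\<Sum>U\<in>Pow ?X. \<Sum>\<rho>\<in>T. (-1) ^ card U * (if \<forall>m\<in>join U. \<rho> m = \<rho> \<one> then ?F \<rho> else 0))"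
    by (rule sum.swap)
  also have "\<dots> = (\<Sum>U\<in>Pow ?X. (-1) ^ card U *
      ((\<Sum>m\<in>join U. of_nat (card {g \<in> carrier G. x \<otimes> m \<otimes> g = g \<otimes> y})) / of_nat (card (join U))))"
  proof (rule sum.cong[OF refl])
    fix U assume U: "U \<in> Pow ?X"
    have "join U \<lhd> G" by (rule normal_join) (use U min_normalD(1) in blast)
    from sum_characters_trivial_on[OF T this x y]
    show "(\<Sum>\<rho>\<in>T. (-1) ^ card U * (if \<forall>m\<in>join U. \<rho> m = \<rho> \<one> then ?F \<rho> else 0)) = (-1) ^ card U *
      ((\<Sum>m\<in>join U. of_nat (card {g \<in> carrier G. x \<otimes> m \<otimes> g = g \<otimes> y})) / of_nat (card (join U)))"
      unfolding sum_distrib_left[symmetric] by simp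
  qed
  finally show ?thesis .
qed

lemma join_min_normals_subset_socle: "U \<subseteq> {N. min_normal G N} \<Longrightarrow> join U \<subseteq> socle G"
  by (rule join_least[OF normal_socle]) (use min_normal_subset_socle in blast)

text \<open>Assumption \<open>free\<close> says that \<open>x\<close> itself is the only conjugate
  of \<open>x\<close> in its coset modulo the socle. Each inner sum of
  \<open>faithful_character_sum\<close> then reduces to its term at \<open>\<one>\<close>, the order
  of the centralizer \<open>Z\<close>.\<close>

lemma faithful_character_norm:
  assumes R: "representatives (faithful_irreps G) (rep_equivalent G) R"
    and x: "x \<in> carrier G"
    and free: "\<forall>m\<in>socle G. \<forall>g\<in>carrier G. x \<otimes> m \<otimes> g = g \<otimes> x \<longrightarrow> m = \<one>"
  defines "Z \<equiv> {g \<in> carrier G. x \<otimes> g = g \<otimes> x}"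
  shows "(\<Sum>\<rho>\<in>R. mat_trace (\<rho> x) * cnj (mat_trace (\<rho> x))) = of_nat (card Z) * alt_sum (socle G)"
    and "\<exists>z. (\<Sum>\<rho>\<in>R. mat_trace (\<rho> x) * cnj (mat_trace (\<rho> x))) = of_int z"
proof -
  let ?X = "{N. min_normal G N}" and ?S = "socle G"
  note nS = normalD[OF normal_socle]
  have mins: "mins ?S = ?X" using min_normal_subset_socle by (auto simp: mins_def)
  have jn: "join U \<lhd> G" if "U \<in> Pow ?X" for U by (rule normal_join) (use that min_normalD(1) in blast)
  have fixed: "(\<Sum>m\<in>join U. of_nat (card {g \<in> carrier G. x \<otimes> m \<otimes> g = g \<otimes> x})) = (of_nat (card Z) :: complex)"
    if U: "U \<in> Pow ?X" for U
  proof -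
    have "(\<Sum>m\<in>join U. of_nat (card {g \<in> carrier G. x \<otimes> m \<otimes> g = g \<otimes> x})) =
      (\<Sum>m\<in>{\<one>}. of_nat (card {g \<in> carrier G. x \<otimes> m \<otimes> g = g \<otimes> x}) :: complex)"
    proof (rule sum.mono_neutral_right)
      show "finite (join U)" "{\<one>} \<subseteq> join U" using normalD(3,8)[OF jn[OF U]] by auto
      show "\<forall>m\<in>join U - {\<one>}. of_nat (card {g \<in> carrier G. x \<otimes> m \<otimes> g = g \<otimes> x}) = (0 :: complex)"
      proof
        fix m assume m: "m \<in> join U - {\<one>}"
        hence "m \<in> ?S" using join_min_normals_subset_socle[of U] U by blast
        hence "{g \<in> carrier G. x \<otimes> m \<otimes> g = g \<otimes> x} = {}" using free m by blast
        thus "of_nat (card {g \<in> carrier G. x \<otimes> m \<otimes> g = g \<otimes> x}) = (0 :: complex)" by (simp only: card.empty of_nat_0)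
      qed
    qed
    thus ?thesis using x by (simp add: Z_def)
  qed
  have sum: "(\<Sum>\<rho>\<in>R. mat_trace (\<rho> x) * cnj (mat_trace (\<rho> x))) =
    (\<Sum>U\<in>Pow ?X. (-1) ^ card U * (of_nat (card Z) / of_nat (card (join U))))"
    unfolding faithful_character_sum[OF R x x] by (rule sum.cong) (simp_all add: fixed)
  thus "(\<Sum>\<rho>\<in>R. mat_trace (\<rho> x) * cnj (mat_trace (\<rho> x))) = of_nat (card Z) * alt_sum ?S"
    by (simp add: alt_sum_def mins sum_distrib_left mult.commute)
  have Z: "subgroup Z G"
  proof (rule subgroupI)
    show "Z \<subseteq> carrier G" "Z \<noteq> {}" using x by (auto simp: Z_def)
    fix g assume g: "g \<in> Z"
    hence gc: "g \<in> carrier G" "x \<otimes> g = g \<otimes> x" by (auto simp: Z_def)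
    have "inv g \<otimes> (x \<otimes> g) = x" unfolding gc(2) using gc(1) x by (simp flip: m_assoc)
    hence "inv g \<otimes> x = x \<otimes> inv g"
      using gc(1) x inv_solve_right[of "inv g \<otimes> x" x g] by (simp add: m_assoc)
    thus "inv g \<in> Z" using gc(1) by (simp add: Z_def)
    fix h assume h: "h \<in> Z"
    hence hc: "h \<in> carrier G" "x \<otimes> h = h \<otimes> x" by (auto simp: Z_def)
    have "x \<otimes> (g \<otimes> h) = g \<otimes> (x \<otimes> h)" using gc hc(1) x by (simp flip: m_assoc)
    hence "x \<otimes> (g \<otimes> h) = g \<otimes> h \<otimes> x" using hc gc(1) x by (simp add: m_assoc)
    thus "g \<otimes> h \<in> Z" using gc(1) hc(1) by (simp add: Z_def)
  qed
  \<comment> \<open>For \<open>m\<close> in the socle, \<open>x \<otimes> ?s\<close> is the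
    conjugate \<open>inv m \<otimes> x \<otimes> m\<close> of \<open>x\<close>, and
    \<open>?s\<close> is again in the socle, so \<open>free\<close> gives
    \<open>?s = \<one>\<close>. Consequently every join is a subgroup of \<open>Z\<close>, and
    Lagrange's theorem makes all quotients integers.\<close>
  have SZ: "?S \<subseteq> Z"
  proof
    fix m assume m: "m \<in> ?S"
    note mc = nS(2)[OF m]
    let ?s = "inv x \<otimes> inv m \<otimes> x \<otimes> m"
    have s: "?s \<in> ?S" using nS(4)[OF nS(7)[OF nS(5)[OF m] x] m] .
    have "?s = inv x \<otimes> (inv m \<otimes> (x \<otimes> m))" using x mc by (simp add: m_assoc)
    hence xs: "x \<otimes> ?s = inv m \<otimes> (x \<otimes> m)" using x mc inv_solve_left[of ?s x "inv m \<otimes> (x \<otimes> m)"] by simp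
    hence "x \<otimes> ?s \<otimes> inv m = inv m \<otimes> x" using x mc by (simp add: m_assoc)
    hence "?s = \<one>" using free s inv_closed[OF mc] by blast
    hence "inv m \<otimes> (x \<otimes> m) = x" using xs x by simp
    hence "x \<otimes> m = m \<otimes> x" using x mc by (simp add: inv_solve_left')
    thus "m \<in> Z" using mc by (simp add: Z_def)
  qed
  have dvd: "card (join U) dvd card Z" if U: "U \<in> Pow ?X" for U
  proof -
    interpret GZ: group "G\<lparr>carrier := Z\<rparr>" by (rule subgroup_imp_group[OF Z])
    have "join U \<subseteq> Z" using join_min_normals_subset_socle[of U] U SZ by blast
    hence "subgroup (join U) (G\<lparr>carrier := Z\<rparr>)" by (rule subgroup_incl[OF normalD(9)[OF jn[OF U]] Z])
    from GZ.lagrange[OF this] have "card (join U) dvd Coset.order (G\<lparr>carrier := Z\<rparr>)" by (metis dvd_triv_right)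
    thus ?thesis by (simp add: Coset.order_def)
  qed
  have "(\<Sum>U\<in>Pow ?X. (-1) ^ card U * (of_nat (card Z) / of_nat (card (join U)))) =
    (of_int (\<Sum>U\<in>Pow ?X. (-1) ^ card U * int (card Z div card (join U))) :: complex)"
    unfolding of_int_sum
  proof (rule sum.cong[OF refl])
    fix U assume U: "U \<in> Pow ?X"
    obtain k where "card Z = card (join U) * k" using dvd[OF U] by blast
    hence "(of_nat (card Z) / of_nat (card (join U)) :: complex) = of_nat (card Z div card (join U))"
      using card_normal_pos[OF jn[OF U]] by simp
    thus "(-1) ^ card U * (of_nat (card Z) / of_nat (card (join U))) =
      (of_int ((-1) ^ card U * int (card Z div card (join U))) :: complex)" by simp
  qed
  from trans[OF sum this]
  show "\<exists>z. (\<Sum>\<rho>\<in>R. mat_trace (\<rho> x) * cnj (mat_trace (\<rho> x))) = of_int z" by (rule exI)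
qed

section \<open>Conjugacy classes and cosets\<close>

abbreviation conj_class :: "'a \<Rightarrow> 'a set" where
  "conj_class x \<equiv> (\<lambda>g. g \<otimes> x \<otimes> inv g) ` carrier G"

lemma conjugacy_classes_iff: "A \<in> conjugacy_classes G \<longleftrightarrow> (\<exists>x\<in>carrier G. A = conj_class x)"
  by (auto simp: conjugacy_classes_def orbits_def orbit_def image_def)

lemma class_value_conj_class:
  assumes x: "x \<in> carrier G" and \<rho>: "matrix_rep n \<rho>"
  shows "class_value (rep_character \<rho>) (conj_class x) = mat_trace (\<rho> x)"
proof -
  note r = matrix_repD[OF \<rho>]
  have "mat_trace (\<rho> (g \<otimes> x \<otimes> inv g)) = mat_trace (\<rho> x)" if g: "g \<in> carrier G" for g
  proof (rule mat_trace_similar)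
    show "similar_mat_wit (\<rho> (g \<otimes> x \<otimes> inv g)) (\<rho> x) (\<rho> g) (\<rho> (inv g))"
      by (rule similar_mat_witI[of _ _ n])
        (use g x r(3) matrix_rep_inv[OF \<rho> g] r(1)[OF g] r(1)[OF x] r(1)[OF inv_closed[OF g]] in auto)
  qed
  hence "rep_character \<rho> ` conj_class x = {mat_trace (\<rho> x)}"
    by (auto simp: rep_character_eq_trace image_image image_iff)
  thus ?thesis by (simp add: class_value_def)
qed

lemma card_conj_class:
  assumes x: "x \<in> carrier G"
  shows "card (conj_class x) * card {g \<in> carrier G. x \<otimes> g = g \<otimes> x} = Coset.order G"
proof -
  let ?\<phi> = "\<lambda>g. \<lambda>h \<in> carrier G. g \<otimes> h \<otimes> inv g"
  interpret group_action G "carrier G" ?\<phi> by (rule action_by_conjugation)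
  have "Group_Action.orbit G ?\<phi> x = conj_class x" using x by (auto simp: orbit_def)
  moreover have "g \<otimes> x \<otimes> inv g = x \<longleftrightarrow> x \<otimes> g = g \<otimes> x" if "g \<in> carrier G" for g
    using that x inv_solve_right'[of x "g \<otimes> x" g] by auto
  hence "stabilizer G ?\<phi> x = {g \<in> carrier G. x \<otimes> g = g \<otimes> x}" using x by (auto simp: stabilizer_def)
  ultimately show ?thesis using orbit_stabilizer_theorem[OF x] by simp
qed

text \<open>The equation says that \<open>x \<otimes> m\<close> is the conjugate of \<open>y\<close>
  by \<open>g\<close>. So conjugating \<open>y\<close> by \<open>h\<close> is conjugating
  \<open>x \<otimes> m\<close> by \<open>k = h \<otimes> inv g\<close>, which agrees with the
  conjugate \<open>u\<close> of \<open>x\<close> modulo \<open>S\<close>.\<close>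

lemma coset_images_subset:
  assumes S: "S \<lhd> G" and x: "x \<in> carrier G" and y: "y \<in> carrier G" and m: "m \<in> S" and g: "g \<in> carrier G"
    and e: "x \<otimes> m \<otimes> g = g \<otimes> y"
  shows "(\<lambda>z. S #> z) ` conj_class y \<subseteq> (\<lambda>z. S #> z) ` conj_class x"
proof clarsimp
  fix h assume h: "h \<in> carrier G"
  note nS = normalD[OF S]
  note mc = nS(2)[OF m]
  define k where "k = h \<otimes> inv g"
  have k: "k \<in> carrier G" using h g by (simp add: k_def)
  define u where "u = k \<otimes> x \<otimes> inv k"
  have u: "u \<in> carrier G" using k x by (simp add: u_def)
  have "y = inv g \<otimes> (x \<otimes> m \<otimes> g)" using e x y g mc by (simp add: inv_solve_left)
  hence "h \<otimes> y \<otimes> inv h = k \<otimes> (x \<otimes> m) \<otimes> inv k"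
    using h g x mc by (simp add: k_def m_assoc inv_mult_group)
  also have "\<dots> = u \<otimes> (k \<otimes> m \<otimes> inv k)" unfolding u_def by (rule conj_mult[OF x mc k])
  \<comment> \<open>The cosets have the form \<open>S #> z\<close>, so the factor from
    \<open>S\<close> is moved to the left of \<open>u\<close> by conjugation.\<close>
  also have "\<dots> = (u \<otimes> (k \<otimes> m \<otimes> inv k) \<otimes> inv u) \<otimes> u" using u k mc by (simp add: m_assoc)
  finally have e': "h \<otimes> y \<otimes> inv h = (u \<otimes> (k \<otimes> m \<otimes> inv k) \<otimes> inv u) \<otimes> u" .
  have s: "u \<otimes> (k \<otimes> m \<otimes> inv k) \<otimes> inv u \<in> S" by (rule nS(6)[OF nS(6)[OF m k] u])
  have "S #> (h \<otimes> y \<otimes> inv h) = S #> (u \<otimes> (k \<otimes> m \<otimes> inv k) \<otimes> inv u) #> u"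
    unfolding e' using coset_mult_assoc[OF nS(1) nS(2)[OF s] u] by simp
  also have "\<dots> = S #> u" using coset_join2[OF nS(2)[OF s] nS(9) s] by simp
  finally show "S #> (h \<otimes> y \<otimes> inv h) \<in> (\<lambda>z. S #> z) ` conj_class x" using k by (auto simp: u_def)
qed

lemma not_distinct_modulo:
  assumes S: "S \<lhd> G" and x: "x \<in> carrier G" and y: "y \<in> carrier G" and m: "m \<in> S" and g: "g \<in> carrier G"
    and e: "x \<otimes> m \<otimes> g = g \<otimes> y"
  shows "\<not> distinct_modulo G S (conj_class x) (conj_class y)"
proof -
  note nS = normalD[OF S] and mc = normalD(2)[OF S m]
  \<comment> \<open>Solving the equation for \<open>inv g \<otimes> x\<close> gives one of the same
    form with \<open>x\<close> and \<open>y\<close> exchanged, \<open>inv g\<close> for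
    \<open>g\<close>, and this element for \<open>m\<close>; it yields the opposite
    inclusion.\<close>
  have m': "inv g \<otimes> inv m \<otimes> g \<in> S" by (rule nS(7)[OF nS(5)[OF m] g])
  have "y = inv g \<otimes> (x \<otimes> m \<otimes> g)" using e x y g mc by (simp add: inv_solve_left)
  hence "y = inv g \<otimes> x \<otimes> (m \<otimes> g)" using x g mc by (simp add: m_assoc)
  hence "y \<otimes> inv (m \<otimes> g) = inv g \<otimes> x" using x g mc by (simp add: m_assoc del: inv_mult_group)
  moreover have "y \<otimes> (inv g \<otimes> inv m \<otimes> g) \<otimes> inv g = y \<otimes> inv (m \<otimes> g)"
    using y g mc by (simp add: m_assoc inv_mult_group)
  ultimately have "y \<otimes> (inv g \<otimes> inv m \<otimes> g) \<otimes> inv g = inv g \<otimes> x" by simp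
  from coset_images_subset[OF S y x m' inv_closed[OF g] this] coset_images_subset[OF S x y m g e]
  show ?thesis by (simp add: distinct_modulo_def)
qed

text \<open>The cardinality makes multiplication injective on the class times \<open>S\<close>, and
  the pairs \<open>(x, m)\<close> and \<open>(g \<otimes> x \<otimes> inv g, \<one>)\<close> have
  the same product.\<close>

lemma free_of_card_set_mult:
  assumes S: "S \<lhd> G" and x: "x \<in> carrier G"
    and c: "card (conj_class x <#> S) = card (conj_class x) * card S"
    and m: "m \<in> S" and g: "g \<in> carrier G" and e: "x \<otimes> m \<otimes> g = g \<otimes> x"
  shows "m = \<one>"
proof -
  note nS = normalD[OF S] and mc = normalD(2)[OF S m]
  have im: "(\<lambda>(a, b). a \<otimes> b) ` (conj_class x \<times> S) = conj_class x <#> S" by (auto simp: set_mult_def)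
  have inj: "inj_on (\<lambda>(a, b). a \<otimes> b) (conj_class x \<times> S)"
    by (rule eq_card_imp_inj_on) (use nS(8) c im in \<open>auto simp: card_cartesian_product\<close>)
  have "x \<in> conj_class x" by (rule image_eqI[of _ _ \<one>]) (use x in auto)
  moreover have "x \<otimes> m = (g \<otimes> x \<otimes> inv g) \<otimes> \<one>" using e x g mc by (simp add: inv_solve_right)
  ultimately have "(x, m) = (g \<otimes> x \<otimes> inv g, \<one>)"
    by (intro inj_onD[OF inj]) (use m g nS(3) in simp_all)
  thus ?thesis by simp
qed

end

theorem theorem5:
  fixes G :: "('g, 'm) monoid_scheme" (structure)
    and S :: "'g set"
    and R :: "('g \<Rightarrow> complex mat) set"
    and a b :: nat
    and M N :: "nat \<Rightarrow> 'g set"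
    and d q :: "nat \<Rightarrow> nat"
  assumes "group G" and "finite (carrier G)"
    and "S = socle G"
    and "representatives (faithful_irreps G) (rep_equivalent G) R"
    and "inj_on M {1..a}"
    and "representatives (elem_abelian_min_normals G) (G_isomorphic G) (M ` {1..a})"
    and "\<forall>i\<in>{1..a}. G\<lparr>carrier := homogeneous_component G (M i)\<rparr>
           \<cong> product_group {..<d i} (\<lambda>_. G\<lparr>carrier := M i\<rparr>)"
    and "\<forall>i\<in>{1..a}. q i = card (G_hom G (M i) (M i))"
    and "bij_betw N {a+1..a+b} (nonabelian_min_normals G)"
  shows
    "(\<forall>A\<in>conjugacy_classes G. \<forall>B\<in>conjugacy_classes G. distinct_modulo G S A B \<longrightarrow>
        (\<Sum>\<rho>\<in>R. class_value (rep_character \<rho>) A * cnj (class_value (rep_character \<rho>) B)) = 0)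
   \<and> (\<forall>C\<in>conjugacy_classes G. card (C <#> S) = card C * card S \<longrightarrow>
        (\<Sum>\<rho>\<in>R. class_value (rep_character \<rho>) C * cnj (class_value (rep_character \<rho>) C)) =
          of_nat (Coset.order G) / of_nat (card C)
          * (\<Prod>i\<in>{1..a}. \<Prod>j<d i. 1 - of_nat (q i) ^ j / of_nat (card (M i)))
          * (\<Prod>k\<in>{a+1..a+b}. 1 - 1 / of_nat (card (N k))))
   \<and> (\<Sum>\<rho>\<in>R. (rep_character \<rho> \<one>)\<^sup>2) = of_nat (\<Sum>\<rho>\<in>R. (rep_degree G \<rho>)\<^sup>2)
   \<and> (\<forall>C\<in>conjugacy_classes G. card (C <#> S) = card C * card S \<longrightarrow>
        card C dvd (\<Sum>\<rho>\<in>R. (rep_degree G \<rho>)\<^sup>2))"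
proof -
  interpret fin_group G by (intro fin_group.intro fin_group_axioms.intro assms(1,2))
  note R = assms(4)
  have S: "S \<lhd> G" using normal_socle assms(3) by simp
  have Rrep: "matrix_rep (rep_degree G \<rho>) \<rho>" if "\<rho> \<in> R" for \<rho>
    using R that irreducible_matrix_repD(1)
    by (auto simp: representatives_def faithful_irreps_def irreducible_rep_iff)
  have sum_class: "(\<Sum>\<rho>\<in>R. class_value (rep_character \<rho>) (conj_class x) * cnj (class_value (rep_character \<rho>) (conj_class y))) =
    (\<Sum>\<rho>\<in>R. mat_trace (\<rho> x) * cnj (mat_trace (\<rho> y)))" if "x \<in> carrier G" "y \<in> carrier G" for x y
    by (rule sum.cong) (simp_all add: class_value_conj_class[OF _ Rrep] that)
  note alt = alt_sum_socle[OF assms(5-9)]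
  have one: "mat_trace (\<rho> \<one>) = of_nat (rep_degree G \<rho>)" if "\<rho> \<in> R" for \<rho>
    using matrix_repD(2)[OF Rrep[OF that]] mat_trace_one by simp
  \<comment> \<open>The norm formula at \<open>x = \<one>\<close>, whose centralizer is the whole
    group.\<close>
  have deg: "of_nat (\<Sum>\<rho>\<in>R. (rep_degree G \<rho>)\<^sup>2) = of_nat (Coset.order G) * alt_sum (socle G)"
  proof -
    have "\<forall>m\<in>socle G. \<forall>g\<in>carrier G. \<one> \<otimes> m \<otimes> g = g \<otimes> \<one> \<longrightarrow> m = \<one>"
      using normalD(2)[OF normal_socle] by simp
    from faithful_character_norm(1)[OF R one_closed this]
    have "(\<Sum>\<rho>\<in>R. mat_trace (\<rho> \<one>) * cnj (mat_trace (\<rho> \<one>))) =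
      of_nat (card {g \<in> carrier G. \<one> \<otimes> g = g \<otimes> \<one>}) * alt_sum (socle G)" .
    moreover have "{g \<in> carrier G. \<one> \<otimes> g = g \<otimes> \<one>} = carrier G" by auto
    moreover have "(\<Sum>\<rho>\<in>R. mat_trace (\<rho> \<one>) * cnj (mat_trace (\<rho> \<one>))) = of_nat (\<Sum>\<rho>\<in>R. (rep_degree G \<rho>)\<^sup>2)"
      by (simp add: one power2_eq_square)
    ultimately show ?thesis by (simp add: Coset.order_def)
  qed
  have norm: "(\<Sum>\<rho>\<in>R. mat_trace (\<rho> x) * cnj (mat_trace (\<rho> x))) =
      of_nat (Coset.order G) / of_nat (card (conj_class x)) * alt_sum (socle G)"
    "card (conj_class x) dvd (\<Sum>\<rho>\<in>R. (rep_degree G \<rho>)\<^sup>2)"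
    if x: "x \<in> carrier G" and c: "card (conj_class x <#> S) = card (conj_class x) * card S" for x
  proof -
    have free: "\<forall>m\<in>socle G. \<forall>g\<in>carrier G. x \<otimes> m \<otimes> g = g \<otimes> x \<longrightarrow> m = \<one>"
      using free_of_card_set_mult[OF S x c] assms(3) by blast
    note n = faithful_character_norm[OF R x free]
    have c0: "card (conj_class x) \<noteq> 0" by (simp add: card_eq_0_iff) (use one_closed in blast)
    have o: "(of_nat (Coset.order G) :: complex) =
      of_nat (card (conj_class x)) * of_nat (card {g \<in> carrier G. x \<otimes> g = g \<otimes> x})"
      unfolding of_nat_mult[symmetric] card_conj_class[OF x] ..
    show "(\<Sum>\<rho>\<in>R. mat_trace (\<rho> x) * cnj (mat_trace (\<rho> x))) =
      of_nat (Coset.order G) / of_nat (card (conj_class x)) * alt_sum (socle G)"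
      using n(1) c0 unfolding o by simp
    \<comment> \<open>The sum of squared degrees is the order of the class times the order of the
      centralizer times \<open>alt_sum (socle G)\<close>, and the product of the last two is the
      integer \<open>z\<close>.\<close>
    obtain z where z: "(\<Sum>\<rho>\<in>R. mat_trace (\<rho> x) * cnj (mat_trace (\<rho> x))) = of_int z" using n(2) by blast
    have "(of_nat (\<Sum>\<rho>\<in>R. (rep_degree G \<rho>)\<^sup>2) :: complex) = of_nat (card (conj_class x)) * of_int z"
      unfolding deg o z[symmetric] using n(1) by simp
    hence "(of_int (int (\<Sum>\<rho>\<in>R. (rep_degree G \<rho>)\<^sup>2)) :: complex) = of_int (int (card (conj_class x)) * z)"
      by (simp only: of_int_mult of_int_of_nat_eq)
    hence "int (\<Sum>\<rho>\<in>R. (rep_degree G \<rho>)\<^sup>2) = int (card (conj_class x)) * z" by (simp only: of_int_eq_iff)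
    hence "int (card (conj_class x)) dvd int (\<Sum>\<rho>\<in>R. (rep_degree G \<rho>)\<^sup>2)" by (rule dvdI)
    thus "card (conj_class x) dvd (\<Sum>\<rho>\<in>R. (rep_degree G \<rho>)\<^sup>2)" by (simp only: int_dvd_int_iff)
  qed
  show ?thesis
  proof (intro conjI ballI impI)
    fix A B assume "A \<in> conjugacy_classes G" "B \<in> conjugacy_classes G" and dm: "distinct_modulo G S A B"
    then obtain x y where x: "x \<in> carrier G" "A = conj_class x" and y: "y \<in> carrier G" "B = conj_class y"
      by (auto simp: conjugacy_classes_iff)
    \<comment> \<open>A solution \<open>g\<close> would make the two classes agree modulo
      \<open>S\<close>, so every count in \<open>faithful_character_sum\<close> is 0.\<close>
    have e: "{g \<in> carrier G. x \<otimes> m \<otimes> g = g \<otimes> y} = {}" if "m \<in> S" for m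
      using not_distinct_modulo[OF S x(1) y(1) that] dm x(2) y(2) by blast
    have "(\<Sum>m\<in>join U. of_nat (card {g \<in> carrier G. x \<otimes> m \<otimes> g = g \<otimes> y})) = (0 :: complex)"
      if "U \<in> Pow {N. min_normal G N}" for U
      using e join_min_normals_subset_socle[of U] that assms(3) by (intro sum.neutral) auto
    hence "(\<Sum>\<rho>\<in>R. mat_trace (\<rho> x) * cnj (mat_trace (\<rho> y))) = 0"
      unfolding faithful_character_sum[OF R x(1) y(1)] by (intro sum.neutral) simp
    thus "(\<Sum>\<rho>\<in>R. class_value (rep_character \<rho>) A * cnj (class_value (rep_character \<rho>) B)) = 0"
      unfolding x(2) y(2) sum_class[OF x(1) y(1)] .
  next
    fix C assume "C \<in> conjugacy_classes G" and c: "card (C <#> S) = card C * card S"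
    then obtain x where x: "x \<in> carrier G" "C = conj_class x" by (auto simp: conjugacy_classes_iff)
    show "(\<Sum>\<rho>\<in>R. class_value (rep_character \<rho>) C * cnj (class_value (rep_character \<rho>) C)) =
          of_nat (Coset.order G) / of_nat (card C)
          * (\<Prod>i\<in>{1..a}. \<Prod>j<d i. 1 - of_nat (q i) ^ j / of_nat (card (M i)))
          * (\<Prod>k\<in>{a+1..a+b}. 1 - 1 / of_nat (card (N k)))"
      unfolding x(2) sum_class[OF x(1) x(1)] norm(1)[OF x(1) c[unfolded x(2)]] alt by (simp only: mult.assoc)
    show "card C dvd (\<Sum>\<rho>\<in>R. (rep_degree G \<rho>)\<^sup>2)" using norm(2)[OF x(1)] c x(2) by simp
  next
    show "(\<Sum>\<rho>\<in>R. (rep_character \<rho> \<one>)\<^sup>2) = of_nat (\<Sum>\<rho>\<in>R. (rep_degree G \<rho>)\<^sup>2)"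
      by (simp add: rep_character_eq_trace one)
  qed
qed

end
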